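(* Let $\alpha,\beta\in\mathbb{R}\setminus\{0\}$, $0<s<1$ and $C\ge 1$. There exist constants $\epsilon=\epsilon(s)>0$, $\delta_0=\delta_0(\alpha,\beta,s,C)>0$, $K=K(s)>0$ and $c_0=c_0(\alpha,\beta,s)>0$ such that the following holds for all $0<\delta\le\delta_0$. Let $A\subset[0,1]$ be a $\delta$-separated set with $\#A=\lceil\delta^{-s}\rceil$ such that $\#(A\cap I)\le C\,l^{s}\,\#A$ for every interval $I$ of length $l\ge\delta$. Then for every $G\subseteq A\times A$ with $\#G\ge\delta^{\epsilon}(\#A)^2$, $$\mathcal{E}_\delta(A+_GA)+\mathcal{E}_\delta(\alpha\cdot A^{\wedge 2}+_G\beta\cdot A^{\wedge 2})\ \ge\ c_0\, C^{-K}\,\delta^{-\epsilon}\,\#A.$$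
   Context: $\mathcal{E}_\delta(E)$ denotes the $\delta$-covering number of $E\subset\mathbb{R}$ (the minimal number of intervals of length $\delta$ needed to cover $E$). A set is $\delta$-separated if any two distinct points are at distance at least $\delta$. For $G\subseteq A\times A$: $A+_GA=\{x+y:(x,y)\in G\}$ and $\alpha\cdot A^{\wedge2}+_G\beta\cdot A^{\wedge 2}=\{\alpha x^2+\beta y^2:(x,y)\in G\}$. *)

theory Defs
  imports Complex_Main
begin

definition covering_number :: "real \<Rightarrow> real set \<Rightarrow> nat" where
  "covering_number \<delta> E =
     (LEAST n. \<exists>F. finite F \<and> card F = n \<and> E \<subseteq> (\<Union>a\<in>F. {a..a+\<delta>}))"

definition delta_separated :: "real \<Rightarrow> real set \<Rightarrow> bool" where
  "delta_separated \<delta> A \<longleftrightarrow> (\<forall>x\<in>A. \<forall>y\<in>A. x \<noteq> y \<longrightarrow> \<bar>x - y\<bar> \<ge> \<delta>)"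

definition partial_sumset :: "(real \<times> real) set \<Rightarrow> real set" where
  "partial_sumset G = (\<lambda>(x, y). x + y) ` G"

definition partial_sq_sumset :: "real \<Rightarrow> real \<Rightarrow> (real \<times> real) set \<Rightarrow> real set" where
  "partial_sq_sumset \<alpha> \<beta> G = (\<lambda>(x, y). \<alpha> * x^2 + \<beta> * y^2) ` G"

end

theory Submission
  imports Defs "HOL-Library.Set_Algebras"
begin

text \<open>
  Suppose that both covering numbers are at most \<open>K |A|\<close> with \<open>K = \<delta>\<^bsup>-\<epsilon>\<^esup>\<close>; as \<open>\<delta>0\<close> may depend on all the
  data, every constant is absorbed into powers of \<open>K\<close>. Applying Balog--Szemeredi--Gowers first to the
  sums and then to the sums of squares, and Pluennecke--Ruzsa afterwards, gives a large \<open>X \<subseteq> A\<close> such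
  that the iterated difference sets of \<open>X\<close> and of \<open>X\<^sup>2\<close> have size about \<open>|A|\<close>.

  If \<open>d\<close> is a popular difference of \<open>X\<close>, then \<open>(v + d)\<^sup>2 - v\<^sup>2 = 2 d v + d\<^sup>2\<close> shows that \<open>d X\<close> is covered
  by few translates of \<open>2 X\<^sup>2 - 2 X\<^sup>2\<close>. Hence \<open>b X + a X\<close> has about \<open>|b|\<^sup>s |A|\<close> cells whenever \<open>|a| \<le> |b|\<close> and
  \<open>a, b\<close> are short sums of such differences; this is the smallest possible size, and no loss occurs for
  small \<open>b\<close> because \<open>A\<close> has exactly \<open>\<delta>\<^bsup>-s\<^esup>\<close> points and satisfies the Frostman condition.

  Following Guth, Katz and Zahl, consider the set \<open>R\<close> of quotients \<open>a / b\<close>. Either it is dense in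
  \<open>[0, 1]\<close> at a scale slightly above \<open>\<delta>\<close>, and then averaging the additive energy of \<open>X + z X\<close> over
  \<open>z \<in> [0, 1]\<close> gives a contradiction, or one of \<open>r / 2\<close>, \<open>(r + 1) / 2\<close> with \<open>r \<in> R\<close> is far from \<open>R\<close>; for
  such a slope the energy is too small.
\<close>

subsection \<open>The Balog--Szemeredi--Gowers theorem\<close>

text \<open>The combinatorial theorems are exact statements about finite sets in abelian groups,
  while the hypotheses hold at scale \<delta>. Reals are therefore replaced by integers: x by the
  floor of x/\<delta>, and x^2 by the floor of x^2/\<theta>. The obstacle is that squaring contracts
  distances near 0. Points below \<open>1 / K ^ m\<close> are discarded, which the Frostman
  condition makes cheap, and \<theta> = \<delta> / K^(m+1) is finer than \<delta>, so distinct
  points keep distinct cells after squaring.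

  The slopes r/2 and (r+1)/2 come from binary expansions: halving and adding a digit, starting from
  0 and 1, approaches all of [0,1]. A common base point for the popular differences makes each
  difference of two selected points a difference of two popular ones, so eight dilates suffice for b
  X + a X.

  The average over slopes is won by a factor \<delta>^(-5\<kappa>), where 10\<kappa> = 1 - s. The
  large exponents of K only record accumulated losses; \<epsilon> is the value that keeps them
  within \<delta>^(-\<kappa>s).\<close>

lemma sum_card_fibres:
  assumes "finite A" "finite B" "G \<subseteq> A \<times> B"
  shows "card G = (\<Sum>b\<in>B. card {a\<in>A. (a, b) \<in> G})"
    and "card G = (\<Sum>a\<in>A. card {b\<in>B. (a, b) \<in> G})"
proof -
  have "G = (\<Union>b\<in>B. (\<lambda>a. (a, b)) ` {a\<in>A. (a, b) \<in> G})"
    using assms(3) by auto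
  then have "card G = card (\<Union>b\<in>B. (\<lambda>a. (a, b)) ` {a\<in>A. (a, b) \<in> G})"
    by simp
  also have "\<dots> = (\<Sum>b\<in>B. card ((\<lambda>a. (a, b)) ` {a\<in>A. (a, b) \<in> G}))"
    by (rule card_UN_disjoint) (use assms in auto)
  also have "\<dots> = (\<Sum>b\<in>B. card {a\<in>A. (a, b) \<in> G})"
    by (intro sum.cong refl card_image) (auto simp: inj_on_def)
  finally show "card G = (\<Sum>b\<in>B. card {a\<in>A. (a, b) \<in> G})" .
  have "G = (SIGMA a:A. {b\<in>B. (a, b) \<in> G})"
    using assms(3) by auto
  then have "card G = card (SIGMA a:A. {b\<in>B. (a, b) \<in> G})"
    by simp
  also have "\<dots> = (\<Sum>a\<in>A. card {b\<in>B. (a, b) \<in> G})"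
    using assms by (subst card_SigmaI) auto
  finally show "card G = (\<Sum>a\<in>A. card {b\<in>B. (a, b) \<in> G})" .
qed

lemma sum_le_threshold:
  fixes f :: "'a \<Rightarrow> real"
  assumes "finite A" "0 \<le> c"
  shows "sum f A \<le> sum f {a\<in>A. c \<le> f a} + c * card A"
proof -
  have "sum f A = sum f {a\<in>A. c \<le> f a} + sum f {a\<in>A. \<not> c \<le> f a}"
    using assms(1) by (subst sum.union_disjoint[symmetric]) (auto intro: sum.cong)
  also have "sum f {a\<in>A. \<not> c \<le> f a} \<le> (\<Sum>a\<in>{a\<in>A. \<not> c \<le> f a}. c)"
    by (rule sum_mono) auto
  also have "\<dots> = c * card {a\<in>A. \<not> c \<le> f a}" by simp
  also have "\<dots> \<le> c * card A"
    using assms by (intro mult_left_mono) (auto intro!: card_mono)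
  finally show ?thesis by simp
qed

lemma sum_squared_le_card_mult:
  fixes f :: "'a \<Rightarrow> real"
  assumes "finite A"
  shows "(sum f A)\<^sup>2 \<le> card A * (\<Sum>a\<in>A. (f a)\<^sup>2)"
proof (cases "A = {}")
  case False
  then have n: "real (card A) > 0" using assms by (simp add: card_gt_0_iff)
  define m where "m = sum f A / card A"
  have "0 \<le> (\<Sum>a\<in>A. (f a - m)\<^sup>2)" by (simp add: sum_nonneg)
  also have "\<dots> = (\<Sum>a\<in>A. (f a)\<^sup>2) - (\<Sum>a\<in>A. 2 * m * f a) + card A * m\<^sup>2"
    by (simp add: power2_diff sum.distrib sum_subtractf ac_simps)
  also have "\<dots> = (\<Sum>a\<in>A. (f a)\<^sup>2) - 2 * m * sum f A + card A * m\<^sup>2"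
    by (simp only: sum_distrib_left)
  also have "\<dots> = (\<Sum>a\<in>A. (f a)\<^sup>2) - (sum f A)\<^sup>2 / card A"
    using n by (simp add: m_def power2_eq_square field_simps)
  finally show ?thesis using n by (simp add: field_simps)
qed simp

lemma exists_ge_average:
  fixes f :: "'a \<Rightarrow> real" and c :: real
  assumes "finite A" "A \<noteq> {}" "c * card A \<le> sum f A"
  shows "\<exists>a\<in>A. c \<le> f a"
proof (rule ccontr)
  assume "\<not> ?thesis"
  then have "sum f A < (\<Sum>a\<in>A. c)" using assms by (intro sum_strict_mono) auto
  then show False using assms(3) by (simp add: mult.commute)
qed


text \<open>A good pivot \<open>y0\<close> on the right is found by averaging: its neighbourhood is
  large and contains few pairs with few common neighbours. Removing the vertices that lie in many
  such bad pairs gives \<open>A'\<close>; \<open>B'\<close> consists of the vertices with many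
  neighbours in \<open>A'\<close>. From y in \<open>B'\<close> one reaches more points of
  \<open>A'\<close> than can be bad for x, and each good one shares many neighbours with x. The edge
  count on \<open>A'\<close> and \<open>B'\<close> is recorded so that the theorem can be iterated
  inside the same graph.\<close>

lemma dense_bipartite_graph_paths3:
  fixes K :: real
  assumes fin: "finite A" "finite B" and G: "G \<subseteq> A \<times> B" "G \<noteq> {}" and K: "1 \<le> K"
    and dens: "real (card A) * real (card B) \<le> K * card G"
  obtains A' B' where "A' \<subseteq> A" "B' \<subseteq> B"
    "real (card A) * card B \<le> 24 * K^2 * card (G \<inter> A' \<times> B')"
    "\<And>x y. x \<in> A' \<Longrightarrow> y \<in> B' \<Longrightarrow> real (card A) * card B
       \<le> 12288 * K^5 * card {(y1, x1). (x, y1) \<in> G \<and> (x1, y1) \<in> G \<and> (x1, y) \<in> G}"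
proof -
  define a b where "a = real (card A)" and "b = real (card B)"
  have "A \<noteq> {}" "B \<noteq> {}" using G by auto
  then have ab: "a > 0" "b > 0" using fin by (auto simp: a_def b_def card_gt_0_iff)
  define deg where "deg x = real (card {y\<in>B. (x, y) \<in> G})" for x
  define A1 where "A1 = {x\<in>A. b / (2*K) \<le> deg x}"
  have finA1: "finite A1" using fin by (auto simp: A1_def)
  have "a * b / K \<le> card G" using dens K by (simp add: a_def b_def field_simps)
  also have "real (card G) = sum deg A"
    using sum_card_fibres(2)[OF fin G(1)] by (simp add: deg_def)
  also have "\<dots> \<le> sum deg A1 + b / (2*K) * a"
    unfolding A1_def a_def
    by (rule sum_le_threshold) (use fin K ab in auto)
  finally have degA1: "a * b / (2*K) \<le> sum deg A1" using K by (simp add: field_simps)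
  define N where "N y = {x\<in>A1. (x, y) \<in> G}" for y
  have finN: "finite (N y)" for y using finA1 by (auto simp: N_def)
  have "sum deg A1 = card (G \<inter> A1 \<times> B)"
    using sum_card_fibres(2)[OF finA1 fin(2), of "G \<inter> A1 \<times> B"]
    by (auto simp: deg_def intro!: sum.cong arg_cong[where f=card])
  also have "\<dots> = (\<Sum>y\<in>B. real (card (N y)))"
    using sum_card_fibres(1)[OF finA1 fin(2), of "G \<inter> A1 \<times> B"]
    by (auto simp: N_def intro!: sum.cong arg_cong[where f=card])
  finally have sumN: "a * b / (2*K) \<le> (\<Sum>y\<in>B. real (card (N y)))" using degA1 by simp
  have "(a * b / (2*K))\<^sup>2 \<le> (\<Sum>y\<in>B. real (card (N y)))\<^sup>2"
    using sumN ab K by (intro power_mono) auto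
  also have "\<dots> \<le> b * (\<Sum>y\<in>B. (real (card (N y)))\<^sup>2)"
    unfolding b_def by (rule sum_squared_le_card_mult[OF fin(2)])
  finally have sumN2: "a\<^sup>2 * b / (4*K\<^sup>2) \<le> (\<Sum>y\<in>B. (real (card (N y)))\<^sup>2)"
    using ab K by (simp add: power2_eq_square field_simps)
  \<comment> \<open>The ratio \<theta>/c = 1/(8K^2) is half of the 1/(4K^2) in \<open>sumN2\<close>,
    so half of the second moment survives the penalty for bad pairs. The value of c makes 2cn =
    n/(16K), half of the degree n/(8K) that vertices of \<open>B'\<close> have into
    \<open>A'\<close>.\<close>
  define \<theta> where "\<theta> = 1 / (256 * K^3)"
  define c where "c = 1 / (32 * K)"
  have c: "c > 0" "\<theta> > 0" using K by (auto simp: c_def \<theta>_def)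
  have \<theta>c: "\<theta> / c = 1 / (8 * K\<^sup>2)" using K by (simp add: c_def \<theta>_def power2_eq_square power3_eq_cube)
  define cod where "cod p = real (card {y\<in>B. (fst p, y) \<in> G \<and> (snd p, y) \<in> G})" for p
  define Bad where "Bad = {p\<in>A1 \<times> A1. cod p < \<theta> * b}"
  have finBad: "finite Bad" using finA1 by (auto simp: Bad_def)
  have "(\<Sum>y\<in>B. real (card (Bad \<inter> N y \<times> N y))) =
      card {(p, y). p \<in> Bad \<and> y \<in> B \<and> p \<in> N y \<times> N y}"
    by (subst sum_card_fibres(1)[OF finBad fin(2)]) (auto simp: Int_def)
  also have "\<dots> = (\<Sum>p\<in>Bad. cod p)"
    by (subst sum_card_fibres(2)[OF finBad fin(2)])
       (auto simp: cod_def Bad_def N_def intro!: sum.cong arg_cong[where f=card])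
  also have "\<dots> \<le> (\<Sum>p\<in>Bad. \<theta> * b)" by (rule sum_mono) (auto simp: Bad_def)
  also have "\<dots> = \<theta> * b * card Bad" by simp
  also have "\<dots> \<le> \<theta> * b * a\<^sup>2"
  proof -
    have "card Bad \<le> card (A \<times> A)" using fin by (intro card_mono) (auto simp: Bad_def A1_def)
    then have "real (card Bad) \<le> a\<^sup>2" 
      by (metis a_def card_cartesian_product of_nat_le_iff of_nat_mult power2_eq_square)
    then show ?thesis using c ab by (intro mult_left_mono) auto
  qed
  finally have sumBad: "(\<Sum>y\<in>B. real (card (Bad \<inter> N y \<times> N y))) \<le> \<theta> * b * a\<^sup>2" .
  \<comment> \<open>Bad pairs are charged with weight 1/c. A vertex of at least average value then
    has, at the same time, a large neighbourhood and at most c n^2 bad pairs in it.\<close>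
  have "a\<^sup>2 / (8*K\<^sup>2) * card B \<le> a\<^sup>2 * b / (4*K\<^sup>2) - (\<theta> / c) * b * a\<^sup>2"
    unfolding \<theta>c using K by (simp add: b_def field_simps)
  also have "\<dots> \<le> (\<Sum>y\<in>B. (real (card (N y)))\<^sup>2) - (\<Sum>y\<in>B. real (card (Bad \<inter> N y \<times> N y))) / c"
    using sumN2 divide_right_mono[OF sumBad, of c] c by simp
  also have "\<dots> = (\<Sum>y\<in>B. (real (card (N y)))\<^sup>2 - real (card (Bad \<inter> N y \<times> N y)) / c)"
    by (simp add: sum_subtractf sum_divide_distrib)
  finally obtain y0 where y0: "y0 \<in> B"
    "a\<^sup>2 / (8*K\<^sup>2) \<le> (real (card (N y0)))\<^sup>2 - real (card (Bad \<inter> N y0 \<times> N y0)) / c"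
    using exists_ge_average[OF fin(2) \<open>B \<noteq> {}\<close>] by blast
  define n where "n = real (card (N y0))"
  have n2: "a\<^sup>2 / (8*K\<^sup>2) \<le> n\<^sup>2" using y0(2) c 
    by (smt (verit) divide_nonneg_pos n_def of_nat_0_le_iff)
  have badn: "real (card (Bad \<inter> N y0 \<times> N y0)) \<le> c * n\<^sup>2"
  proof -
    have "a\<^sup>2 / (8*K\<^sup>2) \<ge> 0" by simp
    then have "real (card (Bad \<inter> N y0 \<times> N y0)) / c \<le> n\<^sup>2" using y0(2) unfolding n_def by linarith
    then show ?thesis using c by (simp add: field_simps)
  qed
  \<comment> \<open>The 3 replaces the square root of 8.\<close>
  have na: "a / (3*K) \<le> n"
  proof (rule power2_le_imp_le)
    have "(a / (3*K))\<^sup>2 = a\<^sup>2 / (9*K\<^sup>2)" by (simp add: power_divide power_mult_distrib)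
    also have "\<dots> \<le> a\<^sup>2 / (8*K\<^sup>2)" using K by (intro divide_left_mono) auto
    finally show "(a / (3*K))\<^sup>2 \<le> n\<^sup>2" using n2 by simp
  qed (simp add: n_def)
  have n0: "n > 0" using na ab K by (smt (verit) divide_pos_pos mult_pos_pos)
  define bd where "bd x = real (card {x'\<in>N y0. (x, x') \<in> Bad})" for x
  define A' where "A' = {x\<in>N y0. bd x \<le> 2 * c * n}"
  have finA': "finite A'" using finN by (auto simp: A'_def)
  have A'A1: "A' \<subseteq> A1" by (auto simp: A'_def N_def)
  have "n \<le> 2 * card A'"
  proof -
    have "2 * c * n * card (N y0 - A') = (\<Sum>x\<in>N y0 - A'. 2 * c * n)" by simp
    also have "\<dots> \<le> sum bd (N y0 - A')" by (rule sum_mono) (auto simp: A'_def)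
    also have "\<dots> \<le> sum bd (N y0)" using finN by (intro sum_mono2) (auto simp: bd_def)
    also have "\<dots> = card (Bad \<inter> N y0 \<times> N y0)"
      using sum_card_fibres(2)[OF finN finN, of "Bad \<inter> N y0 \<times> N y0" y0 y0]
      by (auto simp: bd_def intro!: sum.cong arg_cong[where f=card])
    finally have "2 * c * n * card (N y0 - A') \<le> c * n\<^sup>2" using badn by simp
    then have "2 * real (card (N y0 - A')) \<le> n" using c n0 by (simp add: power2_eq_square)
    moreover have "real (card (N y0 - A')) = n - card A'"
      using finN by (subst card_Diff_subset) (auto simp: A'_def n_def intro!: of_nat_diff card_mono)
    ultimately show ?thesis by simp
  qed
  then have A'n: "n / 2 \<le> card A'" by simp
  define dB where "dB y = real (card {x\<in>A'. (x, y) \<in> G})" for y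
  define B' where "B' = {y\<in>B. card A' / (4*K) \<le> dB y}"
  have "card A' * (b / (2*K)) = (\<Sum>x\<in>A'. b / (2*K))" by simp
  also have "\<dots> \<le> sum deg A'" using A'A1 by (intro sum_mono) (auto simp: A1_def)
  also have "\<dots> = card (G \<inter> A' \<times> B)"
    using sum_card_fibres(2)[OF finA' fin(2), of "G \<inter> A' \<times> B"]
    by (auto simp: deg_def intro!: sum.cong arg_cong[where f=card])
  also have "\<dots> = sum dB B"
    using sum_card_fibres(1)[OF finA' fin(2), of "G \<inter> A' \<times> B"]
    by (auto simp: dB_def intro!: sum.cong arg_cong[where f=card])
  also have "\<dots> \<le> sum dB B' + card A' / (4*K) * b"
    unfolding B'_def b_def
    by (rule sum_le_threshold) (use fin K in auto)
  also have "sum dB B' = card (G \<inter> A' \<times> B')"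
    using sum_card_fibres(1)[OF finA', of B' "G \<inter> A' \<times> B'"] fin
    by (auto simp: dB_def B'_def intro!: sum.cong arg_cong[where f=card])
  finally have G': "card A' * b / (4*K) \<le> card (G \<inter> A' \<times> B')"
    using K by (simp add: field_simps)
  show thesis
  proof
    show "A' \<subseteq> A" "B' \<subseteq> B" using A'A1 by (auto simp: A1_def B'_def)
    have "a * b / (24 * K\<^sup>2) = (a / (3*K)) * (b / (8*K))" by (simp add: power2_eq_square)
    also have "\<dots> \<le> n * (b / (8*K))" using na ab K by (intro mult_right_mono) auto
    also have "\<dots> = n / 2 * b / (4*K)" by simp
    also have "\<dots> \<le> card A' * b / (4*K)" using A'n ab K
      by (intro divide_right_mono mult_right_mono) auto
    also note G'
    finally have "a * b / (24 * K\<^sup>2) \<le> card (G \<inter> A' \<times> B')" .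
    then show "real (card A) * card B \<le> 24 * K^2 * card (G \<inter> A' \<times> B')"
      using K by (simp add: a_def b_def pos_divide_le_eq mult.commute)
    fix x y assume x: "x \<in> A'" and y: "y \<in> B'"
    let ?P = "{(y1, x1). (x, y1) \<in> G \<and> (x1, y1) \<in> G \<and> (x1, y) \<in> G}"
    \<comment> \<open>At least n/(8K) neighbours of y lie in \<open>A'\<close>, and at most n/(16K)
      of them form a bad pair with x.\<close>
    define W where "W = {x1\<in>A'. (x1, y) \<in> G \<and> (x, x1) \<notin> Bad}"
    have finW: "finite W" using finA' by (auto simp: W_def)
    have "n / 2 / (4*K) \<le> card A' / (4*K)" using A'n K by (intro divide_right_mono) auto
    also have "\<dots> \<le> dB y" using y by (simp add: B'_def)
    also have "\<dots> \<le> card W + bd x"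
    proof -
      have "card {x1\<in>A'. (x1, y) \<in> G} \<le> card (W \<union> {x'\<in>N y0. (x, x') \<in> Bad})"
        using finW finN by (intro card_mono) (auto simp: W_def A'_def)
      also have "\<dots> \<le> card W + card {x'\<in>N y0. (x, x') \<in> Bad}" by (rule card_Un_le)
      finally show ?thesis by (simp add: dB_def bd_def)
    qed
    also have "bd x \<le> 2 * c * n" using x by (simp add: A'_def)
    finally have W: "n / (16*K) \<le> card W" using K by (simp add: c_def field_simps)
    have "\<theta> * b * card W = (\<Sum>x1\<in>W. \<theta> * b)" by simp
    also have "\<dots> \<le> (\<Sum>x1\<in>W. cod (x, x1))"
      using x A'A1 by (intro sum_mono) (auto simp: W_def Bad_def not_less)
    also have "\<dots> = card (SIGMA x1:W. {y\<in>B. (x, y) \<in> G \<and> (x1, y) \<in> G})"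
      using finW fin by (subst card_SigmaI) (auto simp: cod_def)
    also have "\<dots> = card (prod.swap ` (SIGMA x1:W. {y\<in>B. (x, y) \<in> G \<and> (x1, y) \<in> G}))"
      by (subst card_image) auto
    also have "\<dots> \<le> card ?P"
    proof -
      have "?P \<subseteq> B \<times> A" using G by auto
      then have "finite ?P" using fin finite_subset by blast
      then show ?thesis by (intro of_nat_mono card_mono) (auto simp: W_def)
    qed
    finally have P: "\<theta> * b * card W \<le> card ?P" .
    have "a * b / (12288 * K^5) = \<theta> * b * ((a / (3*K)) / (16*K))"
      using K by (simp add: \<theta>_def field_simps eval_nat_numeral)
    also have "\<dots> \<le> \<theta> * b * (n / (16*K))"
      using na K c ab by (intro mult_left_mono divide_right_mono) auto
    also have "\<dots> \<le> \<theta> * b * card W" using W c ab by (intro mult_left_mono) auto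
    finally have "a * b / (12288 * K^5) \<le> card ?P" using P by simp
    then show "real (card A) * card B \<le> 12288 * K^5 * card ?P"
      using K by (simp add: a_def b_def pos_divide_le_eq mult.commute)
  qed
qed

text \<open>Along a path \<open>x, y1, x1, y\<close> of length three one has
  \<open>f x + g y = (f x + g y1) - (f x1 + g y1) + (f x1 + g y)\<close>, so that each element of the full
  sumset is represented many times by three elements of the partial one.\<close>

theorem Balog_Szemeredi_Gowers:
  fixes f :: "'a \<Rightarrow> 'c::ab_group_add" and g :: "'b \<Rightarrow> 'c" and K :: real
  assumes fin: "finite A" "finite B" and G: "G \<subseteq> A \<times> B" "G \<noteq> {}" and K: "1 \<le> K"
    and dens: "real (card A) * real (card B) \<le> K * card G"
    and inj: "inj_on f A" "inj_on g B"
  obtains A' B' where "A' \<subseteq> A" "B' \<subseteq> B"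
    "real (card A) * card B \<le> 24 * K^2 * card (G \<inter> A' \<times> B')"
    "card (f ` A' + g ` B') * (real (card A) * card B)
       \<le> 12288 * K^5 * real (card ((\<lambda>(x, y). f x + g y) ` G)) ^ 3"
proof -
  obtain A' B' where AB: "A' \<subseteq> A" "B' \<subseteq> B"
    "real (card A) * card B \<le> 24 * K^2 * card (G \<inter> A' \<times> B')"
    and paths: "\<And>x y. x \<in> A' \<Longrightarrow> y \<in> B' \<Longrightarrow> real (card A) * card B
       \<le> 12288 * K^5 * card {(y1, x1). (x, y1) \<in> G \<and> (x1, y1) \<in> G \<and> (x1, y) \<in> G}"
    using dense_bipartite_graph_paths3[OF fin G K dens] by blast
  define S where "S = (\<lambda>(x, y). f x + g y) ` G"
  have finS: "finite S" using G(1) fin unfolding S_def by (meson finite_SigmaI finite_imageI finite_subset)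
  define Q where "Q = f ` A' + g ` B'"
  have finQ: "finite Q" unfolding Q_def using AB fin by (intro finite_set_plus finite_imageI) (auto dest: finite_subset)
  have "\<forall>q\<in>Q. \<exists>p. fst p \<in> A' \<and> snd p \<in> B' \<and> q = f (fst p) + g (snd p)"
    by (force simp: Q_def set_plus_def)
  then obtain p where p: "\<And>q. q \<in> Q \<Longrightarrow> fst (p q) \<in> A' \<and> snd (p q) \<in> B' \<and> q = f (fst (p q)) + g (snd (p q))"
    by metis
  define P where "P q = {(y1, x1). (fst (p q), y1) \<in> G \<and> (x1, y1) \<in> G \<and> (x1, snd (p q)) \<in> G}" for q
  have "P q \<subseteq> B \<times> A" for q using G by (auto simp: P_def)
  then have finP: "finite (P q)" for q using fin finite_subset by blast
  define h where "h = (\<lambda>(q, (y1, x1)). (f (fst (p q)) + g y1, f x1 + g y1, f x1 + g (snd (p q))))"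
  have inj_h: "inj_on h (Sigma Q P)"
  proof (rule inj_onI)
    fix u v
    assume uv: "u \<in> Sigma Q P" "v \<in> Sigma Q P" "h u = h v"
    obtain q y1 x1 q' y1' x1' where eqs: "u = (q, y1, x1)" "v = (q', y1', x1')"
      by (metis prod.exhaust)
    with uv have q: "q \<in> Q" "(y1, x1) \<in> P q" "q' \<in> Q" "(y1', x1') \<in> P q'"
      and eq: "h (q, y1, x1) = h (q', y1', x1')" by auto
    have "q = (f (fst (p q)) + g y1) - (f x1 + g y1) + (f x1 + g (snd (p q)))"
      using p[OF q(1)] by simp
    also have "\<dots> = (f (fst (p q')) + g y1') - (f x1' + g y1') + (f x1' + g (snd (p q')))"
      using eq by (simp add: h_def)
    also have "\<dots> = q'" using p[OF q(3)] by simp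
    finally have qq: "q = q'" .
    with eq have "g y1 = g y1'" by (simp add: h_def)
    then have y: "y1 = y1'" using q G(1) inj(2) by (auto simp: P_def inj_on_def)
    with eq qq have "f x1 = f x1'" by (simp add: h_def)
    then have "x1 = x1'" using q G(1) inj(1) by (auto simp: P_def inj_on_def)
    with qq y show "u = v" by (simp add: eqs)
  qed
  have "h ` Sigma Q P \<subseteq> S \<times> S \<times> S" by (auto simp: h_def P_def S_def)
  then have "card (h ` Sigma Q P) \<le> card (S \<times> S \<times> S)"
    using finS by (intro card_mono) auto
  then have "card (Sigma Q P) \<le> card S ^ 3"
    by (simp add: card_image[OF inj_h] power3_eq_cube card_cartesian_product)
  moreover have "card (Sigma Q P) = (\<Sum>q\<in>Q. card (P q))"
    using finQ finP by (subst card_SigmaI) auto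
  ultimately have le: "(\<Sum>q\<in>Q. card (P q)) \<le> card S ^ 3" by simp
  have "card Q * (real (card A) * card B) = (\<Sum>q\<in>Q. real (card A) * card B)" by simp
  also have "\<dots> \<le> (\<Sum>q\<in>Q. 12288 * K^5 * card (P q))"
    using p paths unfolding P_def by (intro sum_mono) blast
  also have "\<dots> = 12288 * K^5 * real (\<Sum>q\<in>Q. card (P q))"
    by (simp add: sum_distrib_left)
  also have "\<dots> \<le> 12288 * K^5 * real (card S ^ 3)"
    using le K by (intro mult_left_mono of_nat_mono) auto
  finally show thesis using that[OF AB] by (simp add: Q_def S_def)
qed

subsection \<open>Pluennecke--Ruzsa inequalities\<close>

lemma card_add_singleton:
  fixes A :: "'a::ab_group_add set"
  shows "card (A + {c}) = card A"
proof -
  have "A + {c} = (\<lambda>a. a + c) ` A" by (auto simp: set_plus_def)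
  then show ?thesis by (simp add: card_image)
qed

lemma set_plus_insert:
  fixes A :: "'a::ab_group_add set"
  shows "A + insert c C = (A + C) \<union> (A + {c})"
  using set_plus_Un[of A "{c}" C] by (simp add: Un_commute)

lemma Un_subset_Un_Diff: "D \<subseteq> A \<Longrightarrow> A \<union> E \<subseteq> A \<union> (E - D)"
  by blast

text \<open>Induction on C. A new element c contributes X+B+c to the left side, but the translates
  x+B+c with x in \<open>Z\<close> are already present, and minimality of |X+B|/|X| bounds |Z+B|
  from below. On the right side X+C grows by exactly |X| - |W|, and \<open>W\<close> is contained in
  \<open>Z\<close>, so the growth on the right pays for the growth on the left.\<close>

lemma Petridis:
  fixes X B C :: "'a::ab_group_add set"
  assumes fin: "finite X" "finite B" "finite C"
    and min: "\<And>Z. Z \<subseteq> X \<Longrightarrow> card (X + B) * card Z \<le> card (Z + B) * card X"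
  shows "card (X + B + C) * card X \<le> card (X + B) * card (X + C)"
  using fin(3)
proof (induction C rule: finite_induct)
  case (insert c C)
  define Z where "Z = {x\<in>X. \<forall>b\<in>B. x + b + c \<in> X + B + C}"
  define W where "W = {x\<in>X. x + c \<in> X + C}"
  have ZX: "Z \<subseteq> X" and WX: "W \<subseteq> X" by (auto simp: Z_def W_def)
  have finZ: "finite Z" "finite W" using fin(1) ZX WX finite_subset by auto
  have WZ: "W \<subseteq> Z"
  proof
    fix x assume "x \<in> W"
    then obtain y d where y: "x \<in> X" "y \<in> X" "d \<in> C" "x + c = y + d"
      by (auto simp: W_def set_plus_def)
    have "x + b + c \<in> X + B + C" if "b \<in> B" for b
    proof -
      have "x + b + c = (x + c) + b" by (simp add: ac_simps)
      also have "\<dots> = y + b + d" unfolding y by (simp add: ac_simps)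
      finally have "x + b + c = y + b + d" .
      then show ?thesis using set_plus_intro[OF set_plus_intro[OF y(2) that] y(3)] by (simp only:)
    qed
    then show "x \<in> Z" using y by (simp add: Z_def)
  qed
  have "X + B + insert c C \<subseteq> (X + B + C) \<union> ((X + B + {c}) - (Z + B + {c}))"
  proof -
    have "Z + B + {c} \<subseteq> X + B + C"
    proof
      fix u assume "u \<in> Z + B + {c}"
      then obtain x b where "x \<in> Z" "b \<in> B" "u = x + b + c" by (auto elim!: set_plus_elim)
      then show "u \<in> X + B + C" by (simp add: Z_def)
    qed
    then show ?thesis unfolding set_plus_insert[of _ c C] by (rule Un_subset_Un_Diff)
  qed
  then have "card (X + B + insert c C) \<le> card ((X + B + C) \<union> ((X + B + {c}) - (Z + B + {c})))"
    by (rule card_mono[rotated]) (intro finite_UnI finite_Diff finite_set_plus fin insert.hyps finite.emptyI finite.insertI)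
  also have "\<dots> \<le> card (X + B + C) + card ((X + B + {c}) - (Z + B + {c}))"
    by (rule card_Un_le)
  also have "card ((X + B + {c}) - (Z + B + {c})) = card (X + B) - card (Z + B)"
    by (subst card_Diff_subset)
       (simp_all add: card_add_singleton finite_set_plus fin finZ set_plus_mono2 ZX)
  \<comment> \<open>The count moves to \<open>int\<close> because subtraction of naturals
    truncates.\<close>
  finally have 1: "int (card (X + B + insert c C)) \<le> int (card (X + B + C)) + card (X + B) - card (Z + B)"
    using card_mono[OF finite_set_plus[OF fin(1,2)] set_plus_mono2[OF ZX order_refl]] by linarith
  have "card ((X + C) \<union> ((X + {c}) - (W + {c}))) \<le> card (X + insert c C)"
    unfolding set_plus_insert[of _ c C]
    by (rule card_mono) (auto simp: finite_set_plus fin insert.hyps)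
  also have "card ((X + C) \<union> ((X + {c}) - (W + {c}))) = card (X + C) + card ((X + {c}) - (W + {c}))"
  proof (rule card_Un_disjoint)
    show "(X + C) \<inter> ((X + {c}) - (W + {c})) = {}"
    proof (rule equals0I)
      fix u assume "u \<in> (X + C) \<inter> ((X + {c}) - (W + {c}))"
      then have u: "u \<in> X + C" "u \<in> X + {c}" "u \<notin> W + {c}" by auto
      from u(2) obtain x where x: "x \<in> X" "u = x + c" by (auto elim!: set_plus_elim)
      with u(1) have "x \<in> W" by (simp add: W_def)
      then have "u \<in> W + {c}" unfolding x by (simp add: set_plus_intro)
      then show False using u by simp
    qed
  qed (simp_all add: finite_set_plus fin insert.hyps)
  also have "card ((X + {c}) - (W + {c})) = card X - card W"
    by (subst card_Diff_subset)
       (simp_all add: card_add_singleton finite_set_plus fin finZ set_plus_mono2 WX)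
  finally have 2: "int (card (X + insert c C)) \<ge> int (card (X + C)) + card X - card W"
    using card_mono[OF fin(1) WX] by linarith
  have cWZ: "int (card W) \<le> card Z" using card_mono[OF finZ(1) WZ] by simp
  let ?x = "int (card X)" and ?b = "int (card (X + B))"
  have "int (card (X + B + insert c C)) * ?x \<le> (int (card (X + B + C)) + card (X + B) - card (Z + B)) * ?x"
    using 1 by (intro mult_right_mono) auto
  also have "\<dots> = int (card (X + B + C)) * ?x + ?b * ?x - card (Z + B) * ?x"
    by (simp add: algebra_simps)
  also have "\<dots> \<le> ?b * card (X + C) + ?b * ?x - ?b * card Z"
  proof -
    have "int (card (X + B + C)) * ?x \<le> ?b * card (X + C)"
      using insert.IH by (metis of_nat_le_iff of_nat_mult)
    moreover have "?b * card Z \<le> card (Z + B) * ?x"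
      using min[OF ZX] by (metis of_nat_le_iff of_nat_mult)
    ultimately show ?thesis by linarith
  qed
  also have "\<dots> \<le> ?b * card (X + C) + ?b * ?x - ?b * card W"
    using cWZ by (simp add: mult_left_mono)
  also have "\<dots> = ?b * (int (card (X + C)) + card X - card W)" by (simp add: algebra_simps)
  also have "\<dots> \<le> ?b * card (X + insert c C)" using 2 by (intro mult_left_mono) auto
  finally show ?case by (metis of_nat_le_iff of_nat_mult)
qed simp

section \<open>Iterated sum and difference sets\<close>

fun iterated_sumset :: "nat \<Rightarrow> 'a::ab_group_add set \<Rightarrow> 'a set" where
  "iterated_sumset 0 A = {0}"
| "iterated_sumset (Suc n) A = A + iterated_sumset n A"

lemma finite_iterated_sumset: "finite A \<Longrightarrow> finite (iterated_sumset n A)"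
  by (induction n) (auto intro!: finite_set_plus)

lemma iterated_sumset_add:
  "iterated_sumset (m + n) A = iterated_sumset m A + iterated_sumset n A"
  by (induction m) (auto simp: add.assoc)

definition iterated_diffset :: "nat \<Rightarrow> 'a::ab_group_add set \<Rightarrow> 'a set" where
  "iterated_diffset n A = {x - y |x y. x \<in> iterated_sumset n A \<and> y \<in> iterated_sumset n A}"

lemma finite_iterated_diffset: "finite A \<Longrightarrow> finite (iterated_diffset n A)"
  unfolding iterated_diffset_def using finite_iterated_sumset[of A n]
  by (intro finite_image_set2) auto

lemma iterated_diffset_add:
  assumes "x \<in> iterated_diffset m A" "y \<in> iterated_diffset n A"
  shows "x + y \<in> iterated_diffset (m + n) A"
proof -
  from assms obtain a b c d where "x = a - b" "y = c - d"
    "a \<in> iterated_sumset m A" "b \<in> iterated_sumset m A" "c \<in> iterated_sumset n A" "d \<in> iterated_sumset n A"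
    by (auto simp: iterated_diffset_def)
  moreover from this have "x + y = (a + c) - (b + d)" by (simp add: algebra_simps)
  ultimately show ?thesis
    unfolding iterated_diffset_def iterated_sumset_add by blast
qed

lemma diff_in_iterated_diffset_1: "x \<in> A \<Longrightarrow> y \<in> A \<Longrightarrow> x - y \<in> iterated_diffset 1 A"
  unfolding iterated_diffset_def by auto

lemma uminus_iterated_diffset: "x \<in> iterated_diffset n A \<Longrightarrow> - x \<in> iterated_diffset n A"
  unfolding iterated_diffset_def by force

text \<open>Fix one representation e = b - c of each difference. The map (y, e) to (y + b, y + c) is
  injective: subtracting the coordinates recovers e, and then y.\<close>

lemma Ruzsa_triangle:
  fixes Y B C :: "'a::ab_group_add set"
  assumes fin: "finite Y" "finite B" "finite C"
  shows "card Y * card {b - c |b c. b \<in> B \<and> c \<in> C} \<le> card (Y + B) * card (Y + C)"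
proof -
  define E where "E = {b - c |b c. b \<in> B \<and> c \<in> C}"
  have "\<forall>e\<in>E. \<exists>p. fst p \<in> B \<and> snd p \<in> C \<and> e = fst p - snd p"
    by (force simp: E_def)
  then obtain p where p: "\<And>e. e \<in> E \<Longrightarrow> fst (p e) \<in> B \<and> snd (p e) \<in> C \<and> e = fst (p e) - snd (p e)"
    by metis
  define h where "h = (\<lambda>(y, e). (y + fst (p e), y + snd (p e)))"
  have "inj_on h (Y \<times> E)"
  proof (rule inj_onI)
    fix u v assume uv: "u \<in> Y \<times> E" "v \<in> Y \<times> E" "h u = h v"
    obtain y e y' e' where eqs: "u = (y, e)" "v = (y', e')" by (metis prod.exhaust)
    have e: "e \<in> E" "e' \<in> E" using uv eqs by auto
    have "e = (y + fst (p e)) - (y + snd (p e))" using p[OF e(1)] by simp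
    also have "\<dots> = (y' + fst (p e')) - (y' + snd (p e'))" using uv eqs by (simp add: h_def)
    also have "\<dots> = e'" using p[OF e(2)] by simp
    finally have "e = e'" .
    with uv eqs show "u = v" by (simp add: h_def)
  qed
  then have "card Y * card E = card (h ` (Y \<times> E))"
    by (simp add: card_image card_cartesian_product)
  also have "\<dots> \<le> card ((Y + B) \<times> (Y + C))"
    using fin p by (intro card_mono) (auto simp: h_def finite_set_plus intro!: set_plus_intro)
  finally show ?thesis by (simp add: E_def card_cartesian_product)
qed

text \<open>A nonempty subset X of Q minimising |X+P|/|X| satisfies the hypothesis of
  \<open>Petridis\<close>. Applying that with C an iterated sumset of P multiplies |X| by at most K
  per summand, and the Ruzsa triangle inequality through X turns sums into differences. P and Q are
  kept apart because the two sides later come from different maps.\<close>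

lemma Pluennecke_Ruzsa:
  fixes P Q :: "'a::ab_group_add set" and K :: real
  assumes fin: "finite P" "finite Q" and Q: "Q \<noteq> {}" and K: "0 \<le> K"
    and le: "card (P + Q) \<le> K * card Q"
  shows "card (iterated_diffset n P) \<le> K ^ (2*n) * card Q"
proof -
  define ratio where "ratio Z = real (card (Z + P)) / card Z" for Z
  have "finite {Z. Z \<subseteq> Q \<and> Z \<noteq> {}}" "{Z. Z \<subseteq> Q \<and> Z \<noteq> {}} \<noteq> {}" using fin Q by auto
  then obtain X where X: "X \<subseteq> Q" "X \<noteq> {}"
    and min: "\<And>Z. Z \<subseteq> Q \<Longrightarrow> Z \<noteq> {} \<Longrightarrow> ratio X \<le> ratio Z"
    using arg_min_if_finite(1)[of "{Z. Z \<subseteq> Q \<and> Z \<noteq> {}}" ratio]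
      arg_min_least[of "{Z. Z \<subseteq> Q \<and> Z \<noteq> {}}" _ ratio] by auto
  have finX: "finite X" using X fin finite_subset by auto
  have cX: "real (card X) > 0" using X finX by (simp add: card_gt_0_iff)
  have cQ: "real (card Q) > 0" using Q fin by (simp add: card_gt_0_iff)
  have "ratio X \<le> K"
  proof -
    have "ratio X \<le> ratio Q" using min Q by auto
    also have "\<dots> \<le> K" using le cQ by (simp add: ratio_def add.commute divide_le_eq)
    finally show ?thesis .
  qed
  then have XP: "card (X + P) \<le> K * card X" using cX by (simp add: ratio_def divide_le_eq)
  have minX: "card (X + P) * card Z \<le> card (Z + P) * card X" if "Z \<subseteq> X" for Z
  proof (cases "Z = {}")
    case False
    have "real (card Z) > 0" using that finX False finite_subset by (auto simp: card_gt_0_iff)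
    moreover have "ratio X \<le> ratio Z" using min that X False by auto
    ultimately have "real (card (X + P)) * card Z \<le> real (card (Z + P)) * card X"
      using cX by (simp add: ratio_def field_simps)
    then show ?thesis by (metis of_nat_le_iff of_nat_mult)
  qed simp
  have XnP: "card (X + iterated_sumset n P) \<le> K ^ n * card X" for n
  proof (induction n)
    case (Suc n)
    have "card (X + P + iterated_sumset n P) * card X \<le> card (X + P) * card (X + iterated_sumset n P)"
      by (rule Petridis[OF finX fin(1) finite_iterated_sumset[OF fin(1)] minX])
    then have "real (card (X + P + iterated_sumset n P)) * card X
        \<le> real (card (X + P)) * card (X + iterated_sumset n P)"
      by (metis of_nat_le_iff of_nat_mult)
    also have "\<dots> \<le> (K * card X) * (K ^ n * card X)"
      using Suc XP K by (intro mult_mono) auto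
    finally show ?case using cX by (simp add: add.assoc mult.assoc)
  qed simp
  have "card X * card (iterated_diffset n P) \<le> card (X + iterated_sumset n P) * card (X + iterated_sumset n P)"
    unfolding iterated_diffset_def
    by (rule Ruzsa_triangle) (use finX fin finite_iterated_sumset in auto)
  then have "real (card X) * card (iterated_diffset n P)
      \<le> real (card (X + iterated_sumset n P)) * card (X + iterated_sumset n P)"
    by (metis of_nat_le_iff of_nat_mult)
  also have "\<dots> \<le> (K ^ n * card X) * (K ^ n * card X)"
    using XnP[of n] K by (intro mult_mono) auto
  finally have "card (iterated_diffset n P) \<le> K ^ n * K ^ n * card X" using cX by (simp add: mult.assoc)
  also have "\<dots> = K ^ (2*n) * card X" by (simp add: mult_2 power_add)
  also have "\<dots> \<le> K ^ (2*n) * card Q" using X fin K by (intro mult_left_mono) (auto intro!: card_mono)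
  finally show ?thesis .
qed

text \<open>T is a maximal subset of P for which the translates t - Z are pairwise disjoint. They
  all lie in P - P, which bounds their number; by maximality p - Z meets one of them for every
  further p.\<close>

lemma Ruzsa_covering:
  fixes P Z :: "'a::ab_group_add set"
  assumes fin: "finite P" and Z: "Z \<subseteq> P"
  obtains T where "finite T" "card T * card Z \<le> card (iterated_diffset 1 P)"
    "\<And>p. p \<in> P \<Longrightarrow> Z \<noteq> {} \<Longrightarrow> \<exists>t\<in>T. \<exists>z\<in>Z. \<exists>z'\<in>Z. p = t + z - z'"
proof -
  define indep where "indep T \<longleftrightarrow> T \<subseteq> P \<and> (\<forall>t\<in>T. \<forall>t'\<in>T. \<forall>z\<in>Z. \<forall>z'\<in>Z. t - z = t' - z' \<longrightarrow> t = t')" for T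
  have "finite {T. indep T}"
    by (rule finite_subset[of _ "Pow P"]) (use fin in \<open>auto simp: indep_def\<close>)
  moreover have "{} \<in> {T. indep T}" by (auto simp: indep_def)
  ultimately obtain T where T: "indep T" and max: "\<And>T'. indep T' \<Longrightarrow> T \<subseteq> T' \<Longrightarrow> T = T'"
    using finite_has_maximal2[of "{T. indep T}" "{}"] by auto
  have finT: "finite T" using T fin finite_subset by (auto simp: indep_def)
  show thesis
  proof
    show "finite T" by fact
    have "inj_on (\<lambda>(t, z). t - z) (T \<times> Z)"
      using T by (fastforce simp: inj_on_def indep_def)
    then have "card T * card Z = card ((\<lambda>(t, z). t - z) ` (T \<times> Z))"
      by (simp add: card_image card_cartesian_product)
    also have "\<dots> \<le> card (iterated_diffset 1 P)"
      using T Z fin by (intro card_mono finite_iterated_diffset)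
        (auto simp: indep_def intro!: diff_in_iterated_diffset_1[simplified])
    finally show "card T * card Z \<le> card (iterated_diffset 1 P)" .
    fix p assume p: "p \<in> P" and ne: "Z \<noteq> {}"
    show "\<exists>t\<in>T. \<exists>z\<in>Z. \<exists>z'\<in>Z. p = t + z - z'"
    proof (cases "p \<in> T")
      case True
      then show ?thesis using ne by (metis add_diff_cancel_right' ex_in_conv)
    next
      case False
      then have "\<not> indep (insert p T)" using max by blast
      then obtain t z z' where "t \<in> T" "z \<in> Z" "z' \<in> Z" "p - z = t - z'"
        using T p unfolding indep_def by (metis insert_iff insert_subset)
      then have "p = t + z - z'" by (simp add: algebra_simps eq_diff_eq diff_eq_eq)
      then show ?thesis using \<open>t \<in> T\<close> \<open>z \<in> Z\<close> \<open>z' \<in> Z\<close> by blast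
    qed
  qed
qed

text \<open>Double counting of the pairs (p, z + p - p0). The second entry lies in the next iterated
  difference set, and a given value d arises from those p only for which d + p0 - p lies in Z. If Z
  is confined to a short interval, m can be a Frostman bound, so that a short piece of the iterated
  difference set is small in proportion.\<close>

lemma card_iterated_diffset_local:
  fixes P Z :: "'a::ab_group_add set" and m :: real
  assumes fin: "finite P" and Z: "Z \<subseteq> iterated_diffset n P"
    and m: "\<And>y. card {p\<in>P. y - p \<in> Z} \<le> m"
  shows "real (card Z) * card P \<le> m * card (iterated_diffset (Suc n) P)"
proof (cases "P = {}")
  case False
  then obtain p0 where p0: "p0 \<in> P" by blast
  define D where "D = iterated_diffset (Suc n) P"
  have finD: "finite D" unfolding D_def by (rule finite_iterated_diffset[OF fin])
  define H where "H = (\<lambda>(z, p). (p, z + p - p0)) ` (Z \<times> P)"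
  have "H \<subseteq> P \<times> D"
  proof
    fix h assume "h \<in> H"
    then obtain z p where h: "h = (p, z + p - p0)" "z \<in> Z" "p \<in> P" by (auto simp: H_def)
    have "z + (p - p0) \<in> iterated_diffset (n + 1) P"
      using h Z p0 by (intro iterated_diffset_add diff_in_iterated_diffset_1) auto
    then show "h \<in> P \<times> D" using h by (simp add: D_def algebra_simps)
  qed
  then have "real (card H) = (\<Sum>d\<in>D. real (card {p\<in>P. (p, d) \<in> H}))"
    using sum_card_fibres(1)[OF fin finD] by simp
  also have "\<dots> \<le> (\<Sum>d\<in>D. m)"
  proof (rule sum_mono)
    fix d assume "d \<in> D"
    have "real (card {p\<in>P. (p, d) \<in> H}) \<le> card {p\<in>P. (d + p0) - p \<in> Z}"
      using fin by (intro of_nat_mono card_mono) (auto simp: H_def)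
    also have "\<dots> \<le> m" by (rule m)
    finally show "real (card {p\<in>P. (p, d) \<in> H}) \<le> m" .
  qed
  also have "card H = card Z * card P"
    unfolding H_def by (subst card_image) (auto simp: inj_on_def card_cartesian_product)
  finally show ?thesis by (simp add: D_def mult.commute)
\<comment> \<open>For empty P the left side is 0, and m is nonnegative because it bounds a
  cardinality.\<close>
qed (use order_trans[OF of_nat_0_le_iff m[of 0]] in simp)

subsection \<open>Frostman sets with small sums of dilates\<close>

lemma card_int_near:
  fixes c r :: real
  assumes "0 \<le> r"
  shows "finite {j::int. \<bar>real_of_int j - c\<bar> \<le> r}" "card {j::int. \<bar>real_of_int j - c\<bar> \<le> r} \<le> 2 * r + 1"
proof -
  have sub: "{j::int. \<bar>real_of_int j - c\<bar> \<le> r} \<subseteq> {\<lceil>c - r\<rceil>..\<lfloor>c + r\<rfloor>}"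
    by (auto simp: ceiling_le_iff le_floor_iff abs_le_iff)
  then show "finite {j::int. \<bar>real_of_int j - c\<bar> \<le> r}" by (rule finite_subset) simp
  have "card {j::int. \<bar>real_of_int j - c\<bar> \<le> r} \<le> card {\<lceil>c - r\<rceil>..\<lfloor>c + r\<rfloor>}"
    using sub by (intro card_mono) auto
  moreover have "real (card {\<lceil>c - r\<rceil>..\<lfloor>c + r\<rfloor>}) \<le> 2 * r + 1"
  proof -
    have "real_of_int \<lfloor>c + r\<rfloor> \<le> c + r" "c - r \<le> real_of_int \<lceil>c - r\<rceil>" by auto
    then have "real_of_int (\<lfloor>c + r\<rfloor> - \<lceil>c - r\<rceil> + 1) \<le> 2 * r + 1" by linarith
    then show ?thesis using assms by (cases "0 \<le> \<lfloor>c + r\<rfloor> - \<lceil>c - r\<rceil> + 1") simp_all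
  qed
  ultimately show "card {j::int. \<bar>real_of_int j - c\<bar> \<le> r} \<le> 2 * r + 1" by linarith
qed

lemma card_nat_near:
  fixes c r :: real
  assumes "0 \<le> r"
  shows "card {j. j < J \<and> \<bar>real j - c\<bar> \<le> r} \<le> 2 * r + 1"
proof -
  have "card {j. j < J \<and> \<bar>real j - c\<bar> \<le> r} \<le> card {j::int. \<bar>real_of_int j - c\<bar> \<le> r}"
    by (rule card_inj_on_le[where f=int]) (use card_int_near(1)[OF assms] in auto)
  then show ?thesis using card_int_near(2)[OF assms, of c] by linarith
qed

text \<open>Peel off the first binary digit j of z, approximate 2z - j, and halve: an error e
  becomes e/2 + \<rho>, whose fixed point is 2\<rho>. The third \<rho> pays for stopping after
  finitely many digits.\<close>

lemma halving_dense:
  fixes R :: "real set" and \<rho> :: real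
  assumes R01: "0 \<in> R" "1 \<in> R" and \<rho>: "0 < \<rho>"
    and step: "\<And>r j. r \<in> R \<Longrightarrow> 0 \<le> r \<Longrightarrow> r \<le> 1 \<Longrightarrow> j = 0 \<or> j = 1 \<Longrightarrow>
      \<exists>r'\<in>R. \<bar>(r + j) / 2 - r'\<bar> \<le> \<rho>"
    and z: "0 \<le> z" "z \<le> 1"
  shows "\<exists>r\<in>R. 0 \<le> r \<and> r \<le> 1 \<and> \<bar>z - r\<bar> \<le> 3 * \<rho>"
proof -
  \<comment> \<open>The approximants must remain in [0,1] for the recursion. One that leaves the
    interval is replaced by the endpoint it passed, which is at least as close to (r + j)/2.\<close>
  have step': "\<exists>r'\<in>R. 0 \<le> r' \<and> r' \<le> 1 \<and> \<bar>(r + j) / 2 - r'\<bar> \<le> \<rho>"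
    if r: "r \<in> R" "0 \<le> r" "r \<le> 1" "j = 0 \<or> j = 1" for r j
  proof -
    obtain r' where r': "r' \<in> R" "\<bar>(r + j) / 2 - r'\<bar> \<le> \<rho>" using step r by blast
    consider "r' < 0" | "0 \<le> r'" "r' \<le> 1" | "1 < r'" by linarith
    then show ?thesis
    proof cases
      case 1
      have "0 \<le> j" using r(4) by auto
      moreover have "(r + j) / 2 \<le> \<rho>" using 1 abs_le_D1[OF r'(2)] by linarith
      ultimately have "\<bar>(r + j) / 2 - 0\<bar> \<le> \<rho>" using r(2) by simp
      then show ?thesis using R01 by (intro bexI[of _ 0]) auto
    next
      case 3
      have "j \<le> 1" using r(4) by auto
      moreover have "1 - (r + j) / 2 \<le> \<rho>" using 3 abs_le_D2[OF r'(2)] by linarith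
      ultimately have "\<bar>(r + j) / 2 - 1\<bar> \<le> \<rho>" using r(3) by (simp add: abs_le_iff)
      then show ?thesis using R01 by (intro bexI[of _ 1]) auto
    qed (use r' in auto)
  qed
  have approx: "\<exists>r\<in>R. 0 \<le> r \<and> r \<le> 1 \<and> \<bar>z - r\<bar> \<le> (1/2)^n + 2 * \<rho>"
    if "0 \<le> z" "z \<le> 1" for n and z :: real
    using that
  proof (induction n arbitrary: z)
    case 0
    then show ?case using R01 \<rho> by (intro bexI[of _ 0]) auto
  next
    case (Suc n)
    define j :: real where "j = (if z \<le> 1/2 then 0 else 1)"
    have j: "j = 0 \<or> j = 1" by (simp add: j_def)
    have "0 \<le> 2 * z - j" "2 * z - j \<le> 1" using Suc.prems by (auto simp: j_def)
    then obtain r where r: "r \<in> R" "0 \<le> r" "r \<le> 1" "\<bar>2 * z - j - r\<bar> \<le> (1/2)^n + 2 * \<rho>"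
      using Suc.IH by blast
    obtain r' where r': "r' \<in> R" "0 \<le> r'" "r' \<le> 1" "\<bar>(r + j) / 2 - r'\<bar> \<le> \<rho>"
      using step'[OF r(1-3) j] by blast
    have "\<bar>z - r'\<bar> \<le> \<bar>2 * z - j - r\<bar> / 2 + \<bar>(r + j) / 2 - r'\<bar>" by (auto simp: abs_if field_simps)
    also have "\<dots> \<le> ((1/2)^n + 2 * \<rho>) / 2 + \<rho>" using add_mono[OF divide_right_mono[OF r(4), of 2] r'(4)] by simp
    finally show ?case using r' by (intro bexI[of _ r']) (auto simp: field_simps)
  qed
  obtain n where n: "(1/2::real)^n < \<rho>" using real_arch_pow_inv[OF \<rho>, of "1/2"] by auto
  show ?thesis using approx[OF z, of n] n by fastforce
qed

lemma powr_mult_le: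
  fixes c x s :: real
  assumes "1 \<le> c" "0 \<le> x" "0 \<le> s" "s \<le> 1"
  shows "(c * x) powr s \<le> c * x powr s"
proof -
  have "(c * x) powr s = c powr s * x powr s" using assms by (simp add: powr_mult)
  also have "c powr s \<le> c powr 1" using assms by (intro powr_mono) auto
  finally show ?thesis using assms by (simp add: mult_right_mono)
qed

text \<open>A single K serves as Frostman constant and as the unit in which all losses are counted;
  \<open>100 \<le> K\<close> lets a power of K swallow numerical factors. The factor 2 in
  \<open>card_upper\<close> leaves room for the rounding in the prescribed cardinality.\<close>

locale frostman_set =
  fixes s :: real and K :: real and \<delta> :: real and A :: "real set"
  assumes s: "0 < s" "s < 1" and K: "100 \<le> K" and \<delta>: "0 < \<delta>" "\<delta> < 1"
    and finA: "finite A" and A01: "A \<subseteq> {0..1}"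
    and card_lower: "\<delta> powr (-s) \<le> card A" and card_upper: "card A \<le> 2 * \<delta> powr (-s)"
    and frostman: "\<And>a l. \<delta> \<le> l \<Longrightarrow> card (A \<inter> {a..a+l}) \<le> K * l powr s * card A"
begin

lemma card_pos: "0 < real (card A)"
proof -
  have "0 < \<delta> powr (-s)" using \<delta> by simp
  then show ?thesis using card_lower by linarith
qed

lemma frostman_centred:
  assumes "\<delta> \<le> l"
  shows "card {x\<in>A. \<bar>x - c\<bar> \<le> l} \<le> 2 * K * l powr s * card A"
proof -
  have "card {x\<in>A. \<bar>x - c\<bar> \<le> l} \<le> card (A \<inter> {c - l..(c - l) + 2 * l})"
    using finA by (intro card_mono) auto
  also have "real \<dots> \<le> K * (2 * l) powr s * card A"
    using assms \<delta> by (intro frostman) auto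
  also have "\<dots> \<le> K * (2 * l powr s) * card A"
    using assms \<delta> s K by (intro mult_right_mono mult_left_mono powr_mult_le) auto
  finally show ?thesis by (simp add: mult_ac)
qed

text \<open>Choose w and v' freely. Then w' lies within l1 of w, and v within l2 of a point
  determined by the other three, so the Frostman bound applies twice.\<close>

lemma card_close_quadruples:
  fixes t :: real
  assumes "\<delta> \<le> l1" "\<delta> \<le> l2"
  shows "card {(v, w, v', w'). v \<in> A \<and> w \<in> A \<and> v' \<in> A \<and> w' \<in> A \<and>
      \<bar>w - w'\<bar> \<le> l1 \<and> \<bar>v - v' + t * (w - w')\<bar> \<le> l2}
    \<le> 4 * K\<^sup>2 * l1 powr s * l2 powr s * real (card A) ^ 4"
proof -
  let ?H = "{(v, w, v', w'). v \<in> A \<and> w \<in> A \<and> v' \<in> A \<and> w' \<in> A \<and>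
      \<bar>w - w'\<bar> \<le> l1 \<and> \<bar>v - v' + t * (w - w')\<bar> \<le> l2}"
  define n where "n = real (card A)"
  let ?S = "SIGMA p:(SIGMA p:A \<times> A. {w'\<in>A. \<bar>w' - fst p\<bar> \<le> l1}).
      {v\<in>A. \<bar>v - (snd (fst p) - t * (fst (fst p) - snd p))\<bar> \<le> l2}"
  have fin: "finite (SIGMA p:A \<times> A. {w'\<in>A. \<bar>w' - fst p\<bar> \<le> l1})" using finA by auto
  have H: "?H = (\<lambda>(((w, v'), w'), v). (v, w, v', w')) ` ?S"
  proof (intro equalityI subsetI)
    fix x assume "x \<in> ?H"
    then obtain v w v' w' where x: "x = (v, w, v', w')" "v \<in> A" "w \<in> A" "v' \<in> A" "w' \<in> A"
      "\<bar>w - w'\<bar> \<le> l1" "\<bar>v - v' + t * (w - w')\<bar> \<le> l2" by auto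
    then show "x \<in> (\<lambda>(((w, v'), w'), v). (v, w, v', w')) ` ?S"
      by (intro image_eqI[where x="(((w, v'), w'), v)"]) (auto simp: abs_minus_commute algebra_simps)
  qed (auto simp: abs_minus_commute algebra_simps)
  have "real (card ?H) \<le> real (card ?S)"
    unfolding H of_nat_le_iff by (rule card_image_le) (use fin finA in auto)
  also have "\<dots> = (\<Sum>p\<in>(SIGMA p:A \<times> A. {w'\<in>A. \<bar>w' - fst p\<bar> \<le> l1}).
      real (card {v\<in>A. \<bar>v - (snd (fst p) - t * (fst (fst p) - snd p))\<bar> \<le> l2}))"
    using finA by (subst card_SigmaI) auto
  also have "\<dots> \<le> (\<Sum>p\<in>(SIGMA p:A \<times> A. {w'\<in>A. \<bar>w' - fst p\<bar> \<le> l1}). 2 * K * l2 powr s * n)"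
    unfolding n_def by (intro sum_mono frostman_centred assms)
  also have "\<dots> = 2 * K * l2 powr s * n * card (SIGMA p:A \<times> A. {w'\<in>A. \<bar>w' - fst p\<bar> \<le> l1})"
    by simp
  finally have 1: "card ?H \<le> 2 * K * l2 powr s * n * card (SIGMA p:A \<times> A. {w'\<in>A. \<bar>w' - fst p\<bar> \<le> l1})" .
  have "real (card (SIGMA p:A \<times> A. {w'\<in>A. \<bar>w' - fst p\<bar> \<le> l1}))
      = (\<Sum>p\<in>A \<times> A. real (card {w'\<in>A. \<bar>w' - fst p\<bar> \<le> l1}))"
    using finA by (subst card_SigmaI) auto
  also have "\<dots> \<le> (\<Sum>p\<in>A \<times> A. 2 * K * l1 powr s * n)"
    unfolding n_def by (intro sum_mono frostman_centred assms)
  also have "\<dots> = n * n * (2 * K * l1 powr s * n)" by (simp add: n_def card_cartesian_product)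
  finally have 2: "2 * K * l2 powr s * n * card (SIGMA p:A \<times> A. {w'\<in>A. \<bar>w' - fst p\<bar> \<le> l1})
      \<le> 2 * K * l2 powr s * n * (n * n * (2 * K * l1 powr s * n))"
    using K by (intro mult_left_mono) (auto simp: n_def)
  have "2 * K * l2 powr s * n * (n * n * (2 * K * l1 powr s * n)) = 4 * K\<^sup>2 * l1 powr s * l2 powr s * n ^ 4"
    by (simp add: power2_eq_square eval_nat_numeral mult_ac)
  with order_trans[OF 1 2] show ?thesis by (simp only: n_def)
qed

end

text \<open>The hypothesis \<open>energy\<close> says that \<open>b X + a X\<close> is as small as a set confined to an interval of
  length \<open>\<bar>b\<bar>\<close> can be, for all \<open>a, b\<close> formed from differences of \<open>X\<close>. If the quotient set \<open>R\<close> of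
  these differences is dense, averaging over the slopes contradicts \<open>s < 1\<close>; otherwise some
  slope \<open>(r + j) / 2\<close> with \<open>r \<in> R\<close> is far from \<open>R\<close>, so that \<open>v + t w\<close> is essentially injective
  on pairs, which contradicts \<open>s > 0\<close>.\<close>

locale small_dilate_sums = frostman_set s K \<delta> A
  for s :: real and K :: real and \<delta> :: real and A :: "real set" +
  fixes X :: "real set" and q :: nat and \<kappa> :: real
  assumes XA: "X \<subseteq> A" and X_large: "card A \<le> K ^ q * card X"
    and \<kappa>: "\<kappa> = (1 - s) / 10"
    and small_K: "K ^ (q + 10) \<le> \<delta> powr (- (\<kappa> * s))"
    and energy: "\<And>x1 x2 x3 x4 x5 x6 b a. \<lbrakk>x1 \<in> X; x2 \<in> X; x3 \<in> X; x4 \<in> X; x5 \<in> X; x6 \<in> X;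
      b = 2 * (x3 - x4); a = (x1 - x2) + (x5 - x6); \<delta> \<le> \<bar>b\<bar>; \<bar>a\<bar> \<le> \<bar>b\<bar>\<rbrakk> \<Longrightarrow>
      real (card A) ^ 3 \<le> K ^ q * \<bar>b\<bar> powr s *
        card {(v, w, v', w'). v \<in> X \<and> w \<in> X \<and> v' \<in> X \<and> w' \<in> X \<and> \<bar>b * (v - v') + a * (w - w')\<bar> \<le> \<delta>}"
begin

definition n :: real where "n = card A"
text \<open>\<tau> keeps denominators away from 0. \<rho> = \<delta>/\<tau>^2 is the precision to
  which a collision at scale \<delta> determines a quotient when both denominators have size at
  least \<tau>. \<sigma> separates near from far pairs: for near pairs the exponents give 3\<kappa>
  + (1 - 2\<kappa>) - 1 = \<kappa> > 0, and for far pairs 3\<kappa> - (1 - 2\<kappa>) + s =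
  -5\<kappa> < 0, because 10\<kappa> = 1 - s.\<close>

definition \<tau> :: real where "\<tau> = \<delta> powr \<kappa>"
definition \<rho> :: real where "\<rho> = \<delta> powr (1 - 2 * \<kappa>)"
definition \<sigma> :: real where "\<sigma> = \<delta> powr (3 * \<kappa>)"
definition R :: "real set" where
  "R = {(x1 - x2) / (x3 - x4) |x1 x2 x3 x4. x1 \<in> X \<and> x2 \<in> X \<and> x3 \<in> X \<and> x4 \<in> X \<and> \<tau> \<le> \<bar>x3 - x4\<bar>}"

lemma \<kappa>_bounds: "0 < \<kappa>" "\<kappa> < 1/10" "10 * \<kappa> = 1 - s"
  using \<kappa> s by auto

lemma n_pos: "0 < n"
  using card_pos by (simp add: n_def)

lemma scales:
  "0 < \<tau>" "0 < \<rho>" "0 < \<sigma>" "\<delta> \<le> \<tau>" "\<delta> \<le> \<rho>" "\<delta> \<le> \<sigma>" "\<tau> \<le> 1" "\<rho> \<le> 1" "\<sigma> \<le> 1"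
proof -
  have le: "\<delta> \<le> \<delta> powr x" if "x \<le> 1" for x
    using powr_mono'[OF that, of \<delta>] \<delta> by simp
  have le1: "\<delta> powr x \<le> 1" if "0 \<le> x" for x
    using powr_mono'[OF that, of \<delta>] \<delta> by simp
  show "0 < \<tau>" "0 < \<rho>" "0 < \<sigma>" "\<delta> \<le> \<tau>" "\<delta> \<le> \<rho>" "\<delta> \<le> \<sigma>" "\<tau> \<le> 1" "\<rho> \<le> 1" "\<sigma> \<le> 1"
    using \<kappa>_bounds \<delta> by (auto simp: \<tau>_def \<rho>_def \<sigma>_def intro!: le le1)
qed

lemma \<rho>_eq: "\<rho> = \<delta> / \<tau>\<^sup>2"
  using \<delta> unfolding \<rho>_def \<tau>_def
  by (simp add: powr_diff powr_powr powr_power mult.commute)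

text \<open>Every contradiction below takes the form of a gain \<delta>^(\<kappa>s) beating a loss c
  K^q. The margin K^10 in \<open>small_K\<close> leaves room for the coefficients c listed in
  \<open>num_le_K\<close>.\<close>

lemma loss_small:
  assumes "c \<le> K ^ 5" "0 \<le> c"
  shows "c * K ^ q * \<delta> powr (\<kappa> * s) < 1"
proof -
  have "c * K ^ q * \<delta> powr (\<kappa> * s) \<le> K ^ 5 * K ^ q * \<delta> powr (\<kappa> * s)"
    using assms K by (intro mult_right_mono) auto
  also have "\<dots> < K ^ (q + 10) * \<delta> powr (\<kappa> * s)"
  proof -
    have "K ^ 5 * K ^ q < K ^ (q + 10)" 
      using K by (simp add: power_add[symmetric] add.commute)
    then show ?thesis using \<delta> by (intro mult_strict_right_mono) auto
  qed
  also have "\<dots> \<le> \<delta> powr (- (\<kappa> * s)) * \<delta> powr (\<kappa> * s)"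
    using small_K by (intro mult_right_mono) auto
  also have "\<dots> = 1" using \<delta> by (simp add: powr_add[symmetric])
  finally show ?thesis .
qed

lemma num_le_K: "16 * K\<^sup>2 \<le> K ^ 5" "2 * K \<le> K ^ 5" "64 * K ^ 3 \<le> K ^ 5"
proof -
  have "K \<le> K ^ 3" "K \<le> K ^ 4" "K \<le> K\<^sup>2"
    using K by (auto intro!: self_le_power)
  then have c: "16 \<le> K ^ 3" "2 \<le> K ^ 4" "64 \<le> K\<^sup>2"
    using K by linarith+
  have e: "K ^ 3 * K\<^sup>2 = K ^ 5" "K ^ 4 * K = K ^ 5" "K\<^sup>2 * K ^ 3 = K ^ 5"
    by (simp_all add: eval_nat_numeral)
  show "16 * K\<^sup>2 \<le> K ^ 5" "2 * K \<le> K ^ 5" "64 * K ^ 3 \<le> K ^ 5"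
    using mult_right_mono[OF c(1), of "K\<^sup>2"] mult_right_mono[OF c(2), of K]
      mult_right_mono[OF c(3), of "K ^ 3"] K unfolding e by auto
qed

lemma \<tau>_powr: "\<tau> powr s = \<delta> powr (\<kappa> * s)"
  by (simp add: \<tau>_def powr_powr)

text \<open>Otherwise X lies within \<tau> of one of its points, and the Frostman condition makes it
  smaller than \<open>X_large\<close> allows.\<close>

lemma exists_separated: "\<exists>x\<in>X. \<exists>y\<in>X. \<tau> \<le> \<bar>x - y\<bar>"
proof (rule ccontr)
  assume "\<not> ?thesis"
  then have near: "\<And>x y. x \<in> X \<Longrightarrow> y \<in> X \<Longrightarrow> \<bar>x - y\<bar> < \<tau>" by force
  have "card X > 0" using X_large n_pos by (auto simp: n_def intro: gr0I)
  then obtain y where y: "y \<in> X" by (metis card.empty ex_in_conv less_irrefl)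
  have "real (card X) \<le> card {x\<in>A. \<bar>x - y\<bar> \<le> \<tau>}"
    using finA XA near y by (intro of_nat_mono card_mono) (auto intro: less_imp_le)
  also have "\<dots> \<le> 2 * K * \<tau> powr s * n"
    unfolding n_def by (rule frostman_centred[OF scales(4)])
  finally have "K ^ q * card X \<le> K ^ q * (2 * K * \<tau> powr s * n)"
    using K by (intro mult_left_mono) auto
  then have "n * 1 \<le> n * (2 * K * K ^ q * \<delta> powr (\<kappa> * s))"
    using X_large by (simp add: n_def \<tau>_powr mult_ac)
  then show False using n_pos loss_small[OF num_le_K(2)] K by simp
qed

lemma R_01: "0 \<in> R" "1 \<in> R"
proof -
  obtain x y where xy: "x \<in> X" "y \<in> X" "\<tau> \<le> \<bar>x - y\<bar>" using exists_separated by blast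
  then have "x \<noteq> y" using scales(1) by auto
  then have "0 = (x - x) / (x - y)" "1 = (x - y) / (x - y)" by auto
  then show "0 \<in> R" "1 \<in> R" unfolding R_def using xy by blast+
qed

text \<open>Write the slope t = (r + j)/2 as a/b. A collision with |w - w'| > \<tau> would put the
  element (v' - v)/(w - w') of R within \<rho> of t. If t is far from R, all collisions therefore
  have |w - w'| \<le> \<tau>, and there are too few of these for the lower bound
  \<open>energy\<close>.\<close>

lemma no_gap:
  assumes r: "r \<in> R" "0 \<le> r" "r \<le> 1" and j: "j = 0 \<or> j = 1"
  shows "\<exists>r'\<in>R. \<bar>(r + j) / 2 - r'\<bar> \<le> \<rho>"
proof (rule ccontr)
  assume "\<not> ?thesis"
  then have gap: "\<And>r'. r' \<in> R \<Longrightarrow> \<rho> < \<bar>(r + j) / 2 - r'\<bar>" by force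
  obtain x1 x2 x3 x4 where x: "x1 \<in> X" "x2 \<in> X" "x3 \<in> X" "x4 \<in> X" "\<tau> \<le> \<bar>x3 - x4\<bar>"
    and r_eq: "r = (x1 - x2) / (x3 - x4)" using r(1) by (auto simp: R_def)
  define b where "b = 2 * (x3 - x4)"
  define a where "a = (x1 - x2) + j * (x3 - x4)"
  define t where "t = (r + j) / 2"
  have ne: "x3 \<noteq> x4" using x scales(1) by auto
  have b0: "b \<noteq> 0" using ne by (simp add: b_def)
  have t: "0 \<le> t" "t \<le> 1" using r j by (auto simp: t_def)
  have "t = a / b" using ne by (simp add: t_def r_eq a_def b_def field_simps)
  then have a_eq: "a = t * b" using b0 by simp
  have b_ge: "2 * \<tau> \<le> \<bar>b\<bar>" using x by (simp add: b_def)
  have b_le: "\<bar>b\<bar> \<le> 2"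
  proof -
    have "x3 \<in> {0..1}" "x4 \<in> {0..1}" using x XA A01 by auto
    then show ?thesis by (auto simp: b_def)
  qed
  have b_\<delta>: "\<delta> \<le> \<bar>b\<bar>" using b_ge scales by linarith
  have ab: "\<bar>a\<bar> \<le> \<bar>b\<bar>" using t by (simp add: a_eq abs_mult mult_left_le_one_le)
  let ?C = "{(v, w, v', w'). v \<in> X \<and> w \<in> X \<and> v' \<in> X \<and> w' \<in> X \<and> \<bar>b * (v - v') + a * (w - w')\<bar> \<le> \<delta>}"
  \<comment> \<open>The factor 2 keeps the radius 2\<delta>/|b| at least \<delta>, as the Frostman
    bound requires; |b| may be as large as 2.\<close>
  let ?H = "{(v, w, v', w'). v \<in> A \<and> w \<in> A \<and> v' \<in> A \<and> w' \<in> A \<and>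
      \<bar>w - w'\<bar> \<le> \<tau> \<and> \<bar>v - v' + t * (w - w')\<bar> \<le> 2 * (\<delta> / \<bar>b\<bar>)}"
  \<comment> \<open>The digit j selects the third difference: x5 - x6 is 0 for j = 0 and x3 - x4 for
    j = 1. This is why \<open>energy\<close> allows a sum of two differences in a and a doubled
    difference in b.\<close>
  have E: "n ^ 3 \<le> K ^ q * \<bar>b\<bar> powr s * card ?C"
  proof (cases "j = 0")
    case True
    show ?thesis unfolding n_def
      by (rule energy[OF x(1-4) x(3) x(3) b_def _ b_\<delta> ab]) (simp add: a_def True)
  next
    case False
    then show ?thesis unfolding n_def
      using j by (intro energy[OF x(1-4) x(3) x(4) b_def _ b_\<delta> ab]) (simp add: a_def)
  qed
  have "?C \<subseteq> ?H"
  proof clarify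
    fix v w v' w'
    assume X: "v \<in> X" "w \<in> X" "v' \<in> X" "w' \<in> X" and le: "\<bar>b * (v - v') + a * (w - w')\<bar> \<le> \<delta>"
    have "b * (v - v') + a * (w - w') = b * (v - v' + t * (w - w'))"
      by (simp add: a_eq algebra_simps)
    then have "\<bar>b\<bar> * \<bar>v - v' + t * (w - w')\<bar> \<le> \<delta>"
      using le by (simp only: abs_mult)
    then have le': "\<bar>v - v' + t * (w - w')\<bar> \<le> \<delta> / \<bar>b\<bar>"
      using b0 by (simp add: pos_le_divide_eq mult.commute)
    have "\<bar>w - w'\<bar> \<le> \<tau>"
    proof (rule ccontr)
      assume "\<not> ?thesis"
      then have far: "\<tau> < \<bar>w - w'\<bar>" by simp
      then have w: "w \<noteq> w'" using scales(1) by auto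
      have "(v' - v) / (w - w') \<in> R" unfolding R_def mem_Collect_eq
        by (intro exI[of _ v'] exI[of _ v] exI[of _ w] exI[of _ w'] conjI refl) (use X far in auto)
      then have "\<rho> < \<bar>t - (v' - v) / (w - w')\<bar>" using gap by (simp add: t_def)
      also have "t - (v' - v) / (w - w') = (v - v' + t * (w - w')) / (w - w')"
        using w by (simp add: field_simps)
      also have "\<bar>\<dots>\<bar> = \<bar>v - v' + t * (w - w')\<bar> / \<bar>w - w'\<bar>" by simp
      also have "\<dots> \<le> (\<delta> / \<bar>b\<bar>) / \<tau>"
        using le' far scales(1) \<delta> by (intro frac_le) auto
      also have "\<dots> \<le> (\<delta> / (2 * \<tau>)) / \<tau>"
        using b_ge scales(1) \<delta> b0 by (intro divide_right_mono divide_left_mono) auto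
      also have "\<dots> \<le> \<rho>" using scales(1) \<delta> by (simp add: \<rho>_eq power2_eq_square field_simps)
      finally show False by simp
    qed
    moreover have "\<delta> / \<bar>b\<bar> \<le> 2 * (\<delta> / \<bar>b\<bar>)"
      using divide_nonneg_nonneg[of \<delta> "\<bar>b\<bar>"] \<delta> by linarith
    ultimately show "v \<in> A \<and> w \<in> A \<and> v' \<in> A \<and> w' \<in> A \<and>
      \<bar>w - w'\<bar> \<le> \<tau> \<and> \<bar>v - v' + t * (w - w')\<bar> \<le> 2 * (\<delta> / \<bar>b\<bar>)"
      using X XA le' by auto
  qed
  moreover have "finite ?H"
    by (rule finite_subset[of _ "A \<times> A \<times> A \<times> A"]) (use finA in auto)
  ultimately have "real (card ?C) \<le> card ?H" by (intro of_nat_mono card_mono)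
  also have "real (card ?H) \<le> 4 * K\<^sup>2 * \<tau> powr s * (2 * (\<delta> / \<bar>b\<bar>)) powr s * n ^ 4"
    unfolding n_def
  proof (rule card_close_quadruples[OF scales(4)])
    have "\<delta> * \<bar>b\<bar> \<le> \<delta> * 2" using b_le \<delta> by (intro mult_left_mono) auto
    then show "\<delta> \<le> 2 * (\<delta> / \<bar>b\<bar>)" using b0 by (simp add: field_simps)
  qed
  also have "\<dots> \<le> 4 * K\<^sup>2 * \<tau> powr s * (2 * (\<delta> / \<bar>b\<bar>) powr s) * n ^ 4"
    using K n_pos \<delta> s by (intro mult_right_mono mult_left_mono powr_mult_le) auto
  also have "(\<delta> / \<bar>b\<bar>) powr s = \<delta> powr s / \<bar>b\<bar> powr s" using \<delta> by (simp add: powr_divide)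
  also have "4 * K\<^sup>2 * \<tau> powr s * (2 * (\<delta> powr s / \<bar>b\<bar> powr s)) * n ^ 4
      = 8 * K\<^sup>2 * \<tau> powr s * (\<delta> powr s * n) * n ^ 3 / \<bar>b\<bar> powr s"
    by (simp add: power4_eq_xxxx power3_eq_cube)
  \<comment> \<open>The upper bound on the size of A enters here: \<delta>^s n \<le> 2 turns n^4
    into n^3, with the factor \<tau>^s left as gain.\<close>
  also have "\<dots> \<le> 8 * K\<^sup>2 * \<tau> powr s * 2 * n ^ 3 / \<bar>b\<bar> powr s"
  proof -
    have "\<delta> powr s * n \<le> \<delta> powr s * (2 * \<delta> powr (-s))"
      using card_upper by (intro mult_left_mono) (auto simp: n_def)
    also have "\<dots> = 2" using \<delta> by (simp add: powr_minus)
    finally show ?thesis using K n_pos by (intro divide_right_mono mult_right_mono mult_left_mono) auto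
  qed
  finally have "K ^ q * \<bar>b\<bar> powr s * card ?C
      \<le> K ^ q * \<bar>b\<bar> powr s * (8 * K\<^sup>2 * \<tau> powr s * 2 * n ^ 3 / \<bar>b\<bar> powr s)"
    using K by (intro mult_left_mono) auto
  also have "\<dots> = n ^ 3 * (16 * K\<^sup>2 * K ^ q * \<delta> powr (\<kappa> * s))"
    using b0 by (simp add: \<tau>_powr)
  also have "\<dots> < n ^ 3 * 1"
    using n_pos loss_small[OF num_le_K(1)] by (intro mult_strict_left_mono) auto
  finally show False using E by simp
qed

lemma R_dense:
  assumes "0 \<le> z" "z \<le> 1"
  shows "\<exists>r\<in>R. 0 \<le> r \<and> r \<le> 1 \<and> \<bar>z - r\<bar> \<le> 3 * \<rho>"
  using halving_dense[OF R_01 scales(2) no_gap assms] .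

text \<open>Take r in R within 3\<rho> of z and write r = a/b with a = 2(x1 - x2), b = 2(x3 - x4).
  Dividing a collision by b costs precision \<delta>/|b| \<le> \<rho>, and replacing r by z costs
  3\<rho> because |w - w'| \<le> 1; this gives 4\<rho>.\<close>

lemma many_collisions:
  assumes z: "0 \<le> z" "z \<le> 1"
  shows "n ^ 3 \<le> K ^ (q + 1) *
    card {(v, w, v', w'). v \<in> A \<and> w \<in> A \<and> v' \<in> A \<and> w' \<in> A \<and> \<bar>v - v' + z * (w - w')\<bar> \<le> 4 * \<rho>}"
    
proof -
  let ?H = "{(v, w, v', w'). v \<in> A \<and> w \<in> A \<and> v' \<in> A \<and> w' \<in> A \<and> \<bar>v - v' + z * (w - w')\<bar> \<le> 4 * \<rho>}"
  obtain r where r: "r \<in> R" "0 \<le> r" "r \<le> 1" "\<bar>z - r\<bar> \<le> 3 * \<rho>" using R_dense z by blast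
  obtain x1 x2 x3 x4 where x: "x1 \<in> X" "x2 \<in> X" "x3 \<in> X" "x4 \<in> X" "\<tau> \<le> \<bar>x3 - x4\<bar>"
    and r_eq: "r = (x1 - x2) / (x3 - x4)" using r(1) by (auto simp: R_def)
  define b where "b = 2 * (x3 - x4)"
  define a where "a = (x1 - x2) + (x1 - x2)"
  have ne: "x3 \<noteq> x4" using x scales(1) by auto
  have b0: "b \<noteq> 0" using ne by (simp add: b_def)
  have "r = a / b" using ne by (simp add: r_eq a_def b_def field_simps)
  then have a_eq: "a = r * b" using b0 by simp
  have b_ge: "\<tau> \<le> \<bar>b\<bar>" using x by (simp add: b_def)
  have b_le: "\<bar>b\<bar> \<le> 2"
  proof -
    have "x3 \<in> {0..1}" "x4 \<in> {0..1}" using x XA A01 by auto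
    then show ?thesis by (auto simp: b_def)
  qed
  have b_\<delta>: "\<delta> \<le> \<bar>b\<bar>" using b_ge scales by linarith
  have ab: "\<bar>a\<bar> \<le> \<bar>b\<bar>" using r by (simp add: a_eq abs_mult mult_left_le_one_le)
  let ?C = "{(v, w, v', w'). v \<in> X \<and> w \<in> X \<and> v' \<in> X \<and> w' \<in> X \<and> \<bar>b * (v - v') + a * (w - w')\<bar> \<le> \<delta>}"
  have "n ^ 3 \<le> K ^ q * \<bar>b\<bar> powr s * card ?C"
    unfolding n_def by (rule energy[OF x(1-4) x(1) x(2) b_def a_def b_\<delta> ab])
  also have "\<dots> \<le> K ^ q * K * card ?H"
  proof (intro mult_mono mult_left_mono of_nat_mono card_mono)
    have "\<bar>b\<bar> powr s \<le> 2 powr s" using b_le s by (intro powr_mono2) auto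
    also have "\<dots> \<le> 2 powr 1" using s by (intro powr_mono) auto
    finally show "\<bar>b\<bar> powr s \<le> K" using K by simp
    show "finite ?H"
      by (rule finite_subset[of _ "A \<times> A \<times> A \<times> A"]) (use finA in auto)
    show "?C \<subseteq> ?H"
    proof clarify
      fix v w v' w'
      assume X: "v \<in> X" "w \<in> X" "v' \<in> X" "w' \<in> X" and le: "\<bar>b * (v - v') + a * (w - w')\<bar> \<le> \<delta>"
      have "b * (v - v') + a * (w - w') = b * (v - v' + r * (w - w'))"
        by (simp add: a_eq algebra_simps)
      then have "\<bar>b\<bar> * \<bar>v - v' + r * (w - w')\<bar> \<le> \<delta>"
        using le by (simp only: abs_mult)
      then have "\<bar>v - v' + r * (w - w')\<bar> \<le> \<delta> / \<bar>b\<bar>"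
        using b0 by (simp add: pos_le_divide_eq mult.commute)
      also have "\<dots> \<le> \<delta> / \<tau>" using b_ge b0 scales \<delta> by (intro divide_left_mono) auto
      also have "\<dots> \<le> \<delta> / \<tau>\<^sup>2"
        using scales \<delta> by (intro divide_left_mono) (auto simp: power2_eq_square mult_left_le_one_le)
      finally have 1: "\<bar>v - v' + r * (w - w')\<bar> \<le> \<rho>" by (simp add: \<rho>_eq)
      have "w \<in> {0..1}" "w' \<in> {0..1}" using X XA A01 by auto
      then have "\<bar>w - w'\<bar> \<le> 1" by auto
      then have 2: "\<bar>(z - r) * (w - w')\<bar> \<le> 3 * \<rho> * 1"
        unfolding abs_mult using r scales by (intro mult_mono) auto
      have "v - v' + z * (w - w') = (v - v' + r * (w - w')) + (z - r) * (w - w')"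
        by (simp add: algebra_simps)
      then have "\<bar>v - v' + z * (w - w')\<bar> \<le> 4 * \<rho>" using 1 2 by linarith
      then show "v \<in> A \<and> w \<in> A \<and> v' \<in> A \<and> w' \<in> A \<and> \<bar>v - v' + z * (w - w')\<bar> \<le> 4 * \<rho>"
        using X XA by auto
    qed
  qed (use K in auto)
  finally show ?thesis by (simp add: mult_ac)
qed

text \<open>Sum \<open>many_collisions\<close> over about 1/\<rho> equally spaced slopes. Moving the
  slope by \<rho> moves v - v' + z(w - w') by \<rho>|w - w'|, so a quadruple with |w - w'| >
  \<sigma> collides for O(1/\<sigma>) slopes only. Quadruples with |w - w'| \<le> \<sigma> are few
  for each slope by the Frostman condition. Together this forces 1/\<rho> to be at most about
  n/\<sigma>, against s < 1.\<close>

theorem contradiction: False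
proof -
  define J where "J = nat \<lfloor>1 / \<rho>\<rfloor>"
  have J_le: "real J * \<rho> \<le> 1"
  proof -
    have "real J \<le> 1 / \<rho>" using scales by (simp add: J_def)
    then show ?thesis using scales by (simp add: field_simps)
  qed
  have J_ge: "1 / (2 * \<rho>) \<le> J"
  proof -
    have "1 \<le> 1 / \<rho>" using scales by simp
    \<comment> \<open>A real number at least 1 is at most twice its floor.\<close>
    then have floor: "1 \<le> \<lfloor>1 / \<rho>\<rfloor>" by (simp only: le_floor_iff of_int_1)
    then have "1 / \<rho> \<le> 2 * real_of_int \<lfloor>1 / \<rho>\<rfloor>"
      using real_of_int_floor_add_one_ge[of "1 / \<rho>"] by linarith
    also have "\<lfloor>1 / \<rho>\<rfloor> = int J" using floor unfolding J_def by linarith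
    finally show ?thesis by simp
  qed
  define far where "far j p = (case p of (v, w, v', w') \<Rightarrow>
      \<sigma> < \<bar>w - w'\<bar> \<and> \<bar>v - v' + real j * \<rho> * (w - w')\<bar> \<le> 4 * \<rho>)" for j :: nat and p :: "real \<times> real \<times> real \<times> real"
  let ?Q = "A \<times> A \<times> A \<times> A"
  have finQ: "finite ?Q" using finA by simp
  define Near where "Near j = {(v, w, v', w'). v \<in> A \<and> w \<in> A \<and> v' \<in> A \<and> w' \<in> A \<and>
      \<bar>w - w'\<bar> \<le> \<sigma> \<and> \<bar>v - v' + (real j * \<rho>) * (w - w')\<bar> \<le> 4 * \<rho>}" for j
  have near: "card (Near j) \<le> 16 * K\<^sup>2 * (\<sigma> powr s * \<rho> powr s * n) * n ^ 3" for j
  proof -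
    have "card (Near j) \<le> 4 * K\<^sup>2 * \<sigma> powr s * (4 * \<rho>) powr s * n ^ 4"
      unfolding Near_def n_def using scales by (intro card_close_quadruples) auto
    also have "\<dots> \<le> 4 * K\<^sup>2 * \<sigma> powr s * (4 * \<rho> powr s) * n ^ 4"
      using n_pos scales s by (intro mult_right_mono mult_left_mono powr_mult_le) auto
    finally show ?thesis by (simp add: mult_ac eval_nat_numeral)
  qed
  have each: "n ^ 3 \<le> K ^ (q + 1) * (real (card {p\<in>?Q. far j p}) + card (Near j))" if "j < J" for j
  proof -
    have z: "0 \<le> real j * \<rho>" "real j * \<rho> \<le> 1"
    proof -
      have "real j * \<rho> \<le> real J * \<rho>" using that scales by (intro mult_right_mono) auto
      then show "real j * \<rho> \<le> 1" using J_le by simp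
    qed (use scales in auto)
    have fin: "finite (Near j)"
      by (rule finite_subset[OF _ finQ]) (auto simp: Near_def)
    have "n ^ 3 \<le> K ^ (q + 1) * card {(v, w, v', w'). v \<in> A \<and> w \<in> A \<and> v' \<in> A \<and> w' \<in> A \<and>
        \<bar>v - v' + (real j * \<rho>) * (w - w')\<bar> \<le> 4 * \<rho>}" by (rule many_collisions[OF z])
    also have "\<dots> \<le> K ^ (q + 1) * card ({p\<in>?Q. far j p} \<union> Near j)"
      using K finQ fin
      by (intro mult_left_mono of_nat_mono card_mono) (auto simp: far_def Near_def)
    also have "\<dots> \<le> K ^ (q + 1) * (card {p\<in>?Q. far j p} + card (Near j))"
      using K by (intro mult_left_mono of_nat_mono card_Un_le) auto
    finally show ?thesis by simp
  qed
  have far_sum: "(\<Sum>j<J. real (card {p\<in>?Q. far j p})) \<le> 9 / \<sigma> * n ^ 4"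
  proof -
    define H where "H = {(p, j). p \<in> ?Q \<and> j < J \<and> far j p}"
    have H: "H \<subseteq> ?Q \<times> {..<J}" by (auto simp: H_def)
    have "card H = (\<Sum>j<J. card {p\<in>?Q. far j p})"
      unfolding sum_card_fibres(1)[OF finQ finite_lessThan H]
      by (rule sum.cong) (auto simp: H_def intro!: arg_cong[where f=card])
    moreover have "card H = (\<Sum>p\<in>?Q. card {j\<in>{..<J}. far j p})"
      unfolding sum_card_fibres(2)[OF finQ finite_lessThan H]
      by (rule sum.cong) (auto simp: H_def intro!: arg_cong[where f=card])
    ultimately have "(\<Sum>j<J. real (card {p\<in>?Q. far j p})) = (\<Sum>p\<in>?Q. real (card {j\<in>{..<J}. far j p}))"
      by (simp only: of_nat_sum[symmetric])
    also have "\<dots> \<le> (\<Sum>p\<in>?Q. 9 / \<sigma>)"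
    proof (rule sum_mono)
      fix p :: "real \<times> real \<times> real \<times> real"
      obtain v w v' w' where p: "p = (v, w, v', w')" by (metis prod.exhaust)
      show "real (card {j\<in>{..<J}. far j p}) \<le> 9 / \<sigma>"
      proof (cases "\<sigma> < \<bar>w - w'\<bar>")
        case True
        then have w: "w \<noteq> w'" using scales by auto
        \<comment> \<open>c is the real index at which v - v' + j\<rho>(w - w') vanishes.\<close>
        define c where "c = - (v - v') / (\<rho> * (w - w'))"
        have "{j\<in>{..<J}. far j p} \<subseteq> {j. j < J \<and> \<bar>real j - c\<bar> \<le> 4 / \<sigma>}"
        proof clarify
          fix j assume j: "j < J" and f: "far j p"
          have "real j - c = (v - v' + real j * \<rho> * (w - w')) / (\<rho> * (w - w'))"
            using w scales by (simp add: c_def field_simps)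
          also have "\<bar>\<dots>\<bar> = \<bar>v - v' + real j * \<rho> * (w - w')\<bar> / (\<rho> * \<bar>w - w'\<bar>)"
            using scales by (simp add: abs_mult)
          also have "\<dots> \<le> 4 * \<rho> / (\<rho> * \<sigma>)"
            using f True scales by (intro frac_le) (auto simp: far_def p)
          also have "\<dots> = 4 / \<sigma>" using scales by simp
          finally show "\<bar>real j - c\<bar> \<le> 4 / \<sigma>" .
        qed
        then have "card {j\<in>{..<J}. far j p} \<le> card {j. j < J \<and> \<bar>real j - c\<bar> \<le> 4 / \<sigma>}"
          by (intro card_mono) auto
        also have "real \<dots> \<le> 2 * (4 / \<sigma>) + 1" using scales by (intro card_nat_near) auto
        also have "\<dots> \<le> 9 / \<sigma>" using scales by (simp add: field_simps)
        finally show ?thesis by simp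
      next
        case False
        then show ?thesis using scales by (simp add: far_def p)
      qed
    qed
    also have "\<dots> = 9 / \<sigma> * n ^ 4" by (simp add: n_def card_cartesian_product eval_nat_numeral)
    finally show ?thesis .
  qed
  have near_n: "\<sigma> powr s * \<rho> powr s * n \<le> 2 * \<delta> powr (\<kappa> * s)"
  proof -
    have "\<sigma> powr s * \<rho> powr s * n \<le> \<sigma> powr s * \<rho> powr s * (2 * \<delta> powr (-s))"
      using card_upper by (intro mult_left_mono) (auto simp: n_def)
    also have "\<dots> = 2 * \<delta> powr (3 * \<kappa> * s + (1 - 2 * \<kappa>) * s + (-s))"
      by (simp only: \<sigma>_def \<rho>_def powr_powr powr_add mult.assoc mult.left_commute)
    also have "3 * \<kappa> * s + (1 - 2 * \<kappa>) * s + (-s) = \<kappa> * s" by (simp add: algebra_simps)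
    finally show ?thesis .
  qed
  have "J * n ^ 3 = (\<Sum>j<J. n ^ 3)" by simp
  also have "\<dots> \<le> (\<Sum>j<J. K ^ (q + 1) * (real (card {p\<in>?Q. far j p}) + card (Near j)))"
    using each by (intro sum_mono) auto
  also have "\<dots> = K ^ (q + 1) * ((\<Sum>j<J. real (card {p\<in>?Q. far j p})) + (\<Sum>j<J. real (card (Near j))))"
    by (simp add: sum_distrib_left sum.distrib distrib_left)
  also have "\<dots> \<le> K ^ (q + 1) * (9 / \<sigma> * n ^ 4 + (\<Sum>j<J. 16 * K\<^sup>2 * (2 * \<delta> powr (\<kappa> * s)) * n ^ 3))"
  proof -
    have "real (card (Near j)) \<le> 16 * K\<^sup>2 * (2 * \<delta> powr (\<kappa> * s)) * n ^ 3" for j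
      by (rule order_trans[OF near]) (use near_n n_pos in \<open>intro mult_right_mono mult_left_mono, auto\<close>)
    then show ?thesis using far_sum K by (intro mult_left_mono add_mono sum_mono) auto
  qed
  also have "\<dots> = n ^ 3 * (K ^ (q + 1) * (9 / \<sigma> * n) + J * (32 * K ^ 3 * K ^ q * \<delta> powr (\<kappa> * s)))"
    by (simp add: algebra_simps eval_nat_numeral)
  finally have "J \<le> K ^ (q + 1) * (9 / \<sigma> * n) + J * (32 * K ^ 3 * K ^ q * \<delta> powr (\<kappa> * s))"
    using n_pos by (simp add: mult.commute)
  \<comment> \<open>The coefficient is half of the 64K^3 in \<open>num_le_K\<close>, so the near
    quadruples account for at most half of J and are moved to the other side.\<close>
  also have "J * (32 * K ^ 3 * K ^ q * \<delta> powr (\<kappa> * s)) \<le> J * (1/2)"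
    using loss_small[OF num_le_K(3)] K by (intro mult_left_mono) auto
  finally have "J \<le> 2 * (K ^ (q + 1) * (9 / \<sigma> * n))" by simp
  then have "1 / (2 * \<rho>) \<le> 2 * (K ^ (q + 1) * (9 / \<sigma> * n))" using J_ge by linarith
  also have "\<dots> \<le> 2 * (K ^ (q + 1) * (9 / \<sigma> * (2 * \<delta> powr (-s))))"
    using card_upper K scales by (intro mult_left_mono) (auto simp: n_def)
  \<comment> \<open>72 collects 2 from the near part, 9 from the far part, 2 from the size of A and
    2 from the lower bound on J. The left side equals \<delta>^(-5\<kappa>), which exceeds every
    admissible loss.\<close>
  finally have "\<sigma> / \<rho> * \<delta> powr s \<le> 72 * K ^ (q + 1)"
    using scales \<delta> by (simp add: field_simps powr_minus)
  also have "\<dots> < K ^ (q + 10)"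
  proof -
    have "72 * K ^ (q + 1) < K * K ^ (q + 1)" using K by (intro mult_strict_right_mono) auto
    also have "\<dots> = K ^ (q + 2)" by simp
    also have "\<dots> \<le> K ^ (q + 10)" using K by (intro power_increasing) auto
    finally show ?thesis .
  qed
  also have "\<dots> \<le> \<delta> powr (- (\<kappa> * s))" by (rule small_K)
  also have "\<dots> \<le> \<delta> powr (- (5 * \<kappa>))"
  proof -
    have "\<kappa> * s \<le> \<kappa> * 5" using \<kappa>_bounds s by (intro mult_left_mono) auto
    then show ?thesis using \<delta> by (intro powr_mono') auto
  qed
  also have "\<sigma> / \<rho> * \<delta> powr s = \<delta> powr (- (5 * \<kappa>))"
  proof -
    have "\<sigma> / \<rho> * \<delta> powr s = \<delta> powr (3 * \<kappa> - (1 - 2 * \<kappa>) + s)"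
      by (simp only: \<sigma>_def \<rho>_def powr_diff[of _ "3 * \<kappa>"] powr_add)
    also have "3 * \<kappa> - (1 - 2 * \<kappa>) + s = - (5 * \<kappa>)" using \<kappa>_bounds by linarith
    finally show ?thesis .
  qed
  finally show False by simp
qed

end

subsection \<open>Dilates by popular differences\<close>

text \<open>Cauchy--Schwarz over the fibres of f. It converts an upper bound on the number of
  occupied cells into a lower bound on the energy.\<close>

lemma card_collisions:
  assumes "finite S"
  shows "(real (card S))\<^sup>2 \<le> card (f ` S) * real (card {(x, y). x \<in> S \<and> y \<in> S \<and> f x = f y})"
proof -
  define g where "g z = card {x\<in>S. f x = z}" for z
  have "card {(x, z). x \<in> S \<and> z \<in> f ` S \<and> f x = z} = (\<Sum>z\<in>f ` S. g z)"
    using assms by (subst sum_card_fibres(1)[of S "f ` S"]) (auto simp: g_def intro!: sum.cong arg_cong[where f=card])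
  moreover have "{(x, z). x \<in> S \<and> z \<in> f ` S \<and> f x = z} = (\<lambda>x. (x, f x)) ` S" by auto
  moreover have "card ((\<lambda>x. (x, f x)) ` S) = card S" by (intro card_image) (auto simp: inj_on_def)
  ultimately have S: "card S = (\<Sum>z\<in>f ` S. g z)" by simp
  have "card {(x, y). x \<in> S \<and> y \<in> S \<and> f x = f y} = (\<Sum>y\<in>S. g (f y))"
    using assms by (subst sum_card_fibres(1)[of S S]) (auto simp: g_def intro!: sum.cong arg_cong[where f=card])
  also have "\<dots> = (\<Sum>z\<in>f ` S. \<Sum>y\<in>{x\<in>S. f x = z}. g (f y))"
    using assms by (rule sum.image_gen)
  also have "\<dots> = (\<Sum>z\<in>f ` S. (g z)\<^sup>2)"
    by (intro sum.cong refl) (simp add: g_def power2_eq_square)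
  finally have C: "card {(x, y). x \<in> S \<and> y \<in> S \<and> f x = f y} = (\<Sum>z\<in>f ` S. (g z)\<^sup>2)" .
  have "(\<Sum>z\<in>f ` S. real (g z))\<^sup>2 \<le> card (f ` S) * (\<Sum>z\<in>f ` S. (real (g z))\<^sup>2)"
    using assms by (intro sum_squared_le_card_mult) auto
  then show ?thesis unfolding C unfolding S by simp
qed

text \<open>With r(d) the number of representations of d as a difference, Cauchy--Schwarz gives a
  large sum of r(d)^2, which is the sum of r(x - y) over all pairs. Averaging fixes y0, and the x
  with r(x - y0) below half the average contribute at most half. The common base point is the
  purpose: x - x' = (x - y0) - (x' - y0) expresses any difference within \<open>P0\<close> by two
  popular ones.\<close>

lemma popular_differences:
  fixes P :: "'a::ab_group_add set" and M :: real
  assumes fin: "finite P" and ne: "P \<noteq> {}" and M: "0 < M"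
    and diff: "card (iterated_diffset 1 P) \<le> M * card P"
  obtains y0 P0 where "y0 \<in> P" "P0 \<subseteq> P" "card P \<le> 2 * M * card P0"
    "\<And>x. x \<in> P0 \<Longrightarrow> card P \<le> 2 * M * card {v\<in>P. v + (x - y0) \<in> P}"
proof -
  define D where "D = iterated_diffset 1 P"
  define N where "N = real (card P)"
  define r where "r d = real (card {y\<in>P. y + d \<in> P})" for d
  have N: "0 < N" using fin ne by (simp add: N_def card_gt_0_iff)
  have finD: "finite D" unfolding D_def by (rule finite_iterated_diffset[OF fin])
  have inD: "x - y \<in> D" if "x \<in> P" "y \<in> P" for x y
    unfolding D_def using that by (rule diff_in_iterated_diffset_1)
  have image: "{d\<in>D. y + d \<in> P} = (\<lambda>x. x - y) ` P" if "y \<in> P" for y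
  proof (intro equalityI subsetI)
    fix d assume "d \<in> {d\<in>D. y + d \<in> P}"
    then show "d \<in> (\<lambda>x. x - y) ` P" by (intro image_eqI[of _ _ "y + d"]) auto
  qed (use that inD in auto)
  have inj: "inj_on (\<lambda>x. x - y) P" for y by (auto simp: inj_on_def)
  define H where "H = {(y, d). y \<in> P \<and> d \<in> D \<and> y + d \<in> P}"
  have H: "H \<subseteq> P \<times> D" by (auto simp: H_def)
  have "card H = (\<Sum>y\<in>P. card {d\<in>D. y + d \<in> P})"
    unfolding sum_card_fibres(2)[OF fin finD H]
    by (rule sum.cong) (auto simp: H_def intro!: arg_cong[where f=card])
  also have "\<dots> = (\<Sum>y\<in>P. card P)"
    by (rule sum.cong) (simp_all only: image card_image[OF inj])
  finally have "real (card H) = N\<^sup>2" by (simp add: N_def power2_eq_square)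
  moreover have "real (card H) = (\<Sum>d\<in>D. r d)"
    unfolding sum_card_fibres(1)[OF fin finD H] r_def of_nat_sum
    by (rule sum.cong) (auto simp: H_def intro!: arg_cong[where f=card])
  ultimately have sum_r: "(\<Sum>d\<in>D. r d) = N\<^sup>2" by simp
  have "(N\<^sup>2)\<^sup>2 \<le> card D * (\<Sum>d\<in>D. (r d)\<^sup>2)"
    using sum_squared_le_card_mult[OF finD, of r] by (simp add: sum_r)
  also have "\<dots> \<le> M * N * (\<Sum>d\<in>D. (r d)\<^sup>2)"
    using diff by (intro mult_right_mono) (auto simp: D_def N_def sum_nonneg)
  finally have "N * N ^ 3 \<le> N * (M * (\<Sum>d\<in>D. (r d)\<^sup>2))" by (simp add: power2_eq_square power3_eq_cube mult_ac)
  then have sum_r2: "N ^ 3 \<le> M * (\<Sum>d\<in>D. (r d)\<^sup>2)" using N by simp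
  have "(\<Sum>y\<in>P. \<Sum>x\<in>P. r (x - y)) = (\<Sum>y\<in>P. \<Sum>d | d \<in> D \<and> y + d \<in> P. r d)"
    by (rule sum.cong) (simp_all add: image[unfolded Collect_conj_eq] sum.reindex[OF inj] image)
  also have "\<dots> = (\<Sum>d\<in>D. \<Sum>y | y \<in> P \<and> y + d \<in> P. r d)"
    by (rule sum.swap_restrict[OF fin finD])
  also have "\<dots> = (\<Sum>d\<in>D. (r d)\<^sup>2)" by (simp add: r_def power2_eq_square)
  finally have "N\<^sup>2 / M * card P \<le> (\<Sum>y\<in>P. \<Sum>x\<in>P. r (x - y))"
    using sum_r2 M by (simp add: N_def[symmetric] field_simps power2_eq_square power3_eq_cube)
  then obtain y0 where y0: "y0 \<in> P" "N\<^sup>2 / M \<le> (\<Sum>x\<in>P. r (x - y0))"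
    using exists_ge_average[OF fin ne] by blast
  define P0 where "P0 = {x\<in>P. N / (2 * M) \<le> r (x - y0)}"
  have rN: "r d \<le> N" for d unfolding r_def N_def using fin by (intro of_nat_mono card_mono) auto
  have "(\<Sum>x\<in>P. r (x - y0)) \<le> (\<Sum>x\<in>P0. r (x - y0)) + N / (2 * M) * N"
    unfolding P0_def N_def
    by (rule sum_le_threshold) (use fin M in auto)
  also have "(\<Sum>x\<in>P0. r (x - y0)) \<le> (\<Sum>x\<in>P0. N)" by (intro sum_mono rN)
  finally have "N\<^sup>2 / M \<le> N * card P0 + N\<^sup>2 / (2 * M)"
    using y0 by (simp add: power2_eq_square mult.commute)
  then have "N * N \<le> N * (2 * M * card P0)" using M by (simp add: field_simps power2_eq_square)
  then have "N \<le> 2 * M * card P0" using N by simp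
  moreover have "N \<le> 2 * M * card {v\<in>P. v + (x - y0) \<in> P}" if "x \<in> P0" for x
    using that M by (simp add: P0_def r_def field_simps)
  moreover have "P0 \<subseteq> P" by (auto simp: P0_def)
  ultimately show thesis using that y0(1) unfolding N_def by blast
qed

lemma floor_divide_bounds:
  fixes \<theta> x :: real
  assumes "0 < \<theta>"
  shows "\<theta> * \<lfloor>x / \<theta>\<rfloor> \<le> x" "x < \<theta> * \<lfloor>x / \<theta>\<rfloor> + \<theta>"
proof -
  have "\<theta> * \<lfloor>x / \<theta>\<rfloor> \<le> \<theta> * (x / \<theta>)" "\<theta> * (x / \<theta>) < \<theta> * (real_of_int \<lfloor>x / \<theta>\<rfloor> + 1)"
    using assms by (intro mult_left_mono mult_strict_left_mono; linarith)+
  then show "\<theta> * \<lfloor>x / \<theta>\<rfloor> \<le> x" "x < \<theta> * \<lfloor>x / \<theta>\<rfloor> + \<theta>"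
    using assms by (simp_all add: distrib_left)
qed

text \<open>All sumset information refers to integer cells: \<delta>-cells of the points and
  \<theta>-cells of their squares. The lower bound \<open>X_lower\<close> permits passing back from
  closeness of squares to closeness of points at the cost of a power of K. The exponent in
  \<open>diff1\<close> and \<open>diff2\<close> is linear in k, as the Pluennecke--Ruzsa inequality
  provides.\<close>

locale additively_structured = frostman_set s K \<delta> A
  for s :: real and K :: real and \<delta> :: real and A :: "real set" +
  fixes X :: "real set" and m p :: nat and \<theta> :: real
  assumes XA: "X \<subseteq> A" and X_large: "card A \<le> K ^ p * card X"
    and X_lower: "\<And>x. x \<in> X \<Longrightarrow> 1 / K ^ m \<le> x"
    and \<theta>: "\<theta> = \<delta> / K ^ (m + 1)"
    and inj1: "inj_on (\<lambda>x. \<lfloor>x / \<delta>\<rfloor>) X" and inj2: "inj_on (\<lambda>x. \<lfloor>x\<^sup>2 / \<theta>\<rfloor>) X"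
    and diff1: "\<And>k. card (iterated_diffset k ((\<lambda>x. \<lfloor>x / \<delta>\<rfloor>) ` X)) \<le> K ^ (p * k) * card A"
    and diff2: "\<And>k. card (iterated_diffset k ((\<lambda>x. \<lfloor>x\<^sup>2 / \<theta>\<rfloor>) ` X)) \<le> K ^ (p * k) * card A"
begin

abbreviation f1 :: "real \<Rightarrow> int" where "f1 x \<equiv> \<lfloor>x / \<delta>\<rfloor>"
abbreviation f2 :: "real \<Rightarrow> int" where "f2 x \<equiv> \<lfloor>x\<^sup>2 / \<theta>\<rfloor>"

lemma K1: "1 \<le> K" "0 < K" using K by auto

lemma \<theta>_bounds: "0 < \<theta>" "\<theta> \<le> \<delta>" "\<delta> / \<theta> = K ^ (m + 1)"
proof -
  have "1 \<le> K ^ (m + 1)" using K1 by (intro one_le_power)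
  then show "0 < \<theta>" "\<theta> \<le> \<delta>" "\<delta> / \<theta> = K ^ (m + 1)"
    using \<delta> K1 by (auto simp: \<theta> divide_le_eq)
qed

lemma finX: "finite X" using XA finA finite_subset by blast

lemma X01: "x \<in> X \<Longrightarrow> 0 \<le> x \<and> x \<le> 1" using XA A01 by auto

text \<open>The factor 2 in the cardinality bound absorbs the rounding errors in sums.\<close>

definition controlled :: "nat \<Rightarrow> real set \<Rightarrow> bool" where
  "controlled k E \<longleftrightarrow> (\<exists>T. finite T \<and> 2 * real (card T) \<le> (K ^ (4 * p + m + 4)) ^ k \<and>
     (\<forall>e\<in>E. \<exists>t\<in>T. \<lfloor>e / \<theta>\<rfloor> - t \<in> iterated_diffset (2 * k) (f2 ` X)))"

text \<open>The floor of a sum exceeds the sum of the floors by 0 or 1, so the translates t + u are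
  doubled, and 2 |V| \<le> (2 |T|)(2 |U|). The set G is only required to consist of some sums e + f:
  for a dilate of X by a sum of two numbers, e and f are taken at the same point of X.\<close>

lemma controlled_add:
  assumes E: "controlled k E" and F: "controlled l F"
    and sum: "\<And>g. g \<in> G \<Longrightarrow> \<exists>e\<in>E. \<exists>f\<in>F. g = e + f"
  shows "controlled (k + l) G"
proof -
  let ?L = "K ^ (4 * p + m + 4)"
  obtain T where T: "finite T" "2 * real (card T) \<le> ?L ^ k"
    "\<And>e. e \<in> E \<Longrightarrow> \<exists>t\<in>T. \<lfloor>e / \<theta>\<rfloor> - t \<in> iterated_diffset (2 * k) (f2 ` X)"
    using E unfolding controlled_def by blast
  obtain U where U: "finite U" "2 * real (card U) \<le> ?L ^ l"
    "\<And>f. f \<in> F \<Longrightarrow> \<exists>t\<in>U. \<lfloor>f / \<theta>\<rfloor> - t \<in> iterated_diffset (2 * l) (f2 ` X)"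
    using F unfolding controlled_def by blast
  define V where "V = (\<lambda>(t, u, i). t + u + i) ` (T \<times> U \<times> {0, 1::int})"
  have "card V \<le> card (T \<times> U \<times> {0, 1::int})" unfolding V_def using T U by (intro card_image_le) auto
  also have "\<dots> = 2 * card T * card U" by (simp add: card_cartesian_product)
  finally have "real (card V) \<le> 2 * real (card T) * real (card U)"
    by (metis of_nat_le_iff of_nat_mult of_nat_numeral)
  then have "2 * real (card V) \<le> (2 * real (card T)) * (2 * real (card U))" by simp
  also have "\<dots> \<le> ?L ^ k * ?L ^ l" using T U K1 by (intro mult_mono) auto
  finally have cV: "2 * real (card V) \<le> ?L ^ (k + l)" by (simp only: power_add)
  have "\<exists>v\<in>V. \<lfloor>g / \<theta>\<rfloor> - v \<in> iterated_diffset (2 * (k + l)) (f2 ` X)" if "g \<in> G" for g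
  proof -
    obtain e f where ef: "e \<in> E" "f \<in> F" "g = e + f" using sum \<open>g \<in> G\<close> by blast
    obtain t u where tu: "t \<in> T" "\<lfloor>e / \<theta>\<rfloor> - t \<in> iterated_diffset (2 * k) (f2 ` X)"
      "u \<in> U" "\<lfloor>f / \<theta>\<rfloor> - u \<in> iterated_diffset (2 * l) (f2 ` X)" using T(3) U(3) ef by blast
    define i where "i = \<lfloor>g / \<theta>\<rfloor> - \<lfloor>e / \<theta>\<rfloor> - \<lfloor>f / \<theta>\<rfloor>"
    have "i = 0 \<or> i = 1" unfolding i_def ef(3) add_divide_distrib by linarith
    then have "t + u + i \<in> V" unfolding V_def
      using tu by (intro image_eqI[of _ _ "(t, u, i)"]) auto
    moreover have "\<lfloor>g / \<theta>\<rfloor> - (t + u + i) = (\<lfloor>e / \<theta>\<rfloor> - t) + (\<lfloor>f / \<theta>\<rfloor> - u)"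
      by (simp add: i_def)
    moreover have "\<dots> \<in> iterated_diffset (2 * k + 2 * l) (f2 ` X)"
      using tu by (intro iterated_diffset_add)
    ultimately show ?thesis by (metis distrib_left)
  qed
  then show ?thesis using cV T U unfolding controlled_def V_def
    by (intro exI[of _ V]) (auto simp: V_def)
qed

text \<open>If \<open>u - v\<close> is within \<open>2\<delta>\<close> of \<open>d\<close> then \<open>2 d v\<close> is, up to the constant \<open>d\<^sup>2\<close>, within \<open>O(\<delta>)\<close>
  of \<open>u\<^sup>2 - v\<^sup>2\<close>; so the dilate of \<open>X\<close> by a popular difference \<open>d\<close> lies in few translates of sums
  of squares.\<close>

lemma controlled_dilate:
  fixes \<epsilon> :: int
  assumes xy: "x \<in> X" "y \<in> X" and Z: "Z \<subseteq> X" and Z_large: "card A \<le> K ^ (3 * p + 1) * card Z"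
    and pop: "\<And>v. v \<in> Z \<Longrightarrow> \<exists>u\<in>X. f1 u - f1 v = f1 x - f1 y"
    and \<epsilon>: "\<epsilon> = 1 \<or> \<epsilon> = - 1"
  shows "controlled 1 ((\<lambda>v. \<epsilon> * (2 * (x - y) * v)) ` X)"
proof -
  define d where "d = x - y"
  have cZ: "0 < card Z" using Z_large card_pos by (auto intro: gr0I)
  \<comment> \<open>A partner u with u - v close to d is available only for v in Z. Ruzsa covering
    writes each v in X, up to O(\<delta>), as \<delta>t + v1 - v2 with v1, v2 in Z. Hence 2dv is
    2d\<delta>t plus a combination of four squares, and the two constants d^2 cancel.\<close>
  obtain T0 where T0: "finite T0" "card T0 * card (f1 ` Z) \<le> card (iterated_diffset 1 (f1 ` X))"
    and cov: "\<And>q. q \<in> f1 ` X \<Longrightarrow> f1 ` Z \<noteq> {} \<Longrightarrow> \<exists>t\<in>T0. \<exists>z\<in>f1 ` Z. \<exists>z'\<in>f1 ` Z. q = t + z - z'"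
    by (rule Ruzsa_covering[of "f1 ` X" "f1 ` Z"]) (use finX Z in \<open>auto intro: image_mono\<close>)
  have "card (f1 ` Z) = card Z" using inj1 Z by (intro card_image) (rule inj_on_subset)
  then have "real (card T0) * card Z \<le> card (iterated_diffset 1 (f1 ` X))"
    using T0(2) by (metis of_nat_le_iff of_nat_mult)
  also have "\<dots> \<le> K ^ p * card A" using diff1[of 1] by simp
  also have "\<dots> \<le> K ^ p * (K ^ (3 * p + 1) * card Z)"
    using Z_large K1 by (intro mult_left_mono) auto
  also have "\<dots> = K ^ (4 * p + 1) * card Z"
  proof -
    have "K ^ p * K ^ (3 * p + 1) = K ^ (p + (3 * p + 1))" by (rule power_add[symmetric])
    also have "p + (3 * p + 1) = 4 * p + 1" by simp
    finally show ?thesis by (simp only: mult.assoc[symmetric])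
  qed
  finally have cT0: "real (card T0) \<le> K ^ (4 * p + 1)"
    using cZ by simp
  \<comment> \<open>The error \<open>e\<close> below is at most (4 + 6 + 6)\<delta>, that is 16
    K^(m+1) in units of \<theta>. Rounding adds 4 for the four squares and 2 for the two remaining
    floors.\<close>
  define J :: int where "J = \<lceil>16 * K ^ (m + 1)\<rceil> + 6"
  define T where "T = (\<lambda>(t, j). \<lfloor>\<epsilon> * (2 * d * (\<delta> * t)) / \<theta>\<rfloor> + j) ` (T0 \<times> {-J..J})"
  have K_ge: "1 \<le> K ^ (m + 1)" using K1 by (intro one_le_power)
  have J: "16 * K ^ (m + 1) + 6 \<le> J" "J \<le> 16 * K ^ (m + 1) + 7" "0 \<le> J"
  proof -
    show J1: "16 * K ^ (m + 1) + 6 \<le> J" "J \<le> 16 * K ^ (m + 1) + 7" unfolding J_def by linarith+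
    then have "(0::real) \<le> J" using K_ge by linarith
    then show "0 \<le> J" by simp
  qed
  have finT: "finite T" using T0 by (auto simp: T_def)
  have "card T \<le> card (T0 \<times> {-J..J})" unfolding T_def using T0 by (intro card_image_le) auto
  also have "\<dots> = card T0 * nat (2 * J + 1)" by (simp add: card_cartesian_product)
  finally have "real (card T) \<le> card T0 * real (nat (2 * J + 1))" by (metis of_nat_le_iff of_nat_mult)
  also have "real (nat (2 * J + 1)) = 2 * real_of_int J + 1" using J by simp
  \<comment> \<open>2J + 1 is at most 32 K^(m+1) + 15, and \<open>K_ge\<close> absorbs the
    15.\<close>
  also have "card T0 * (2 * real_of_int J + 1) \<le> K ^ (4 * p + 1) * (47 * K ^ (m + 1))"
    using cT0 J K_ge K1 by (intro mult_mono) auto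
  finally have "2 * real (card T) \<le> 94 * (K ^ (4 * p + 1) * K ^ (m + 1))" by linarith
  also have "\<dots> \<le> K\<^sup>2 * (K ^ (4 * p + 1) * K ^ (m + 1))"
  proof (intro mult_right_mono)
    have "94 * 1 \<le> K * K" using K by (intro mult_mono) auto
    then show "94 \<le> K\<^sup>2" by (simp add: power2_eq_square)
  qed (use K1 in auto)
  also have "\<dots> = (K ^ (4 * p + m + 4)) ^ 1"
  proof -
    have "K\<^sup>2 * (K ^ (4 * p + 1) * K ^ (m + 1)) = K ^ (2 + ((4 * p + 1) + (m + 1)))"
      by (simp only: power_add)
    also have "2 + ((4 * p + 1) + (m + 1)) = 4 * p + m + 4" by simp
    finally show ?thesis by (simp only: power_one_right)
  qed
  finally have cT: "2 * real (card T) \<le> (K ^ (4 * p + m + 4)) ^ 1" .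
  have "\<exists>t\<in>T. \<lfloor>\<epsilon> * (2 * d * v) / \<theta>\<rfloor> - t \<in> iterated_diffset (2 * 1) (f2 ` X)" if v: "v \<in> X" for v
  proof -
    have "f1 ` Z \<noteq> {}" using cZ by auto
    then obtain t v1 v2 where t: "t \<in> T0" and v12: "v1 \<in> Z" "v2 \<in> Z" and tv: "f1 v = t + f1 v1 - f1 v2"
      using cov v by blast
    obtain u1 u2 where u: "u1 \<in> X" "u2 \<in> X" "f1 u1 - f1 v1 = f1 x - f1 y" "f1 u2 - f1 v2 = f1 x - f1 y"
      using pop v12 by blast
    note fb = floor_divide_bounds[OF \<delta>(1)]
    have close: "\<bar>u' - v' - d\<bar> \<le> 2 * \<delta>" if "f1 u' - f1 v' = f1 x - f1 y" for u' v'
    proof -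
      have "\<delta> * real_of_int (f1 u' - f1 v') = \<delta> * real_of_int (f1 x - f1 y)" using that by simp
      then have "\<delta> * f1 u' - \<delta> * f1 v' = \<delta> * f1 x - \<delta> * f1 y" by (simp add: algebra_simps)
      then show ?thesis using fb[of u'] fb[of v'] fb[of x] fb[of y] unfolding d_def by linarith
    qed
    have close_t: "\<bar>v - \<delta> * t - v1 + v2\<bar> \<le> 2 * \<delta>"
    proof -
      have "\<delta> * real_of_int (f1 v) = \<delta> * real_of_int (t + f1 v1 - f1 v2)" using tv by simp
      then have "\<delta> * f1 v = \<delta> * t + \<delta> * f1 v1 - \<delta> * f1 v2" by (simp add: algebra_simps)
      then show ?thesis using fb[of v] fb[of v1] fb[of v2] \<delta> by linarith
    qed
    have d1: "\<bar>d\<bar> \<le> 1" using X01[OF xy(1)] X01[OF xy(2)] unfolding d_def by linarith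
    have sq: "\<bar>u'\<^sup>2 - (v' + d)\<^sup>2\<bar> \<le> 6 * \<delta>" if "u' \<in> X" "v' \<in> X" "f1 u' - f1 v' = f1 x - f1 y" for u' v'
    proof -
      have "\<bar>u'\<^sup>2 - (v' + d)\<^sup>2\<bar> = \<bar>u' - v' - d\<bar> * \<bar>u' + v' + d\<bar>"
        by (simp add: abs_mult[symmetric] power2_eq_square algebra_simps)
      also have "\<dots> \<le> (2 * \<delta>) * 3"
        using close[OF that(3)] X01[OF that(1)] X01[OF that(2)] d1 \<delta> by (intro mult_mono) auto
      finally show ?thesis by simp
    qed
    define e where "e = 2 * d * v - 2 * d * (\<delta> * t) - (u1\<^sup>2 - v1\<^sup>2) + (u2\<^sup>2 - v2\<^sup>2)"
    have "e = 2 * d * (v - \<delta> * t - v1 + v2) - (u1\<^sup>2 - (v1 + d)\<^sup>2) + (u2\<^sup>2 - (v2 + d)\<^sup>2)"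
      by (simp add: e_def power2_eq_square algebra_simps)
    moreover have "\<bar>2 * d * (v - \<delta> * t - v1 + v2)\<bar> \<le> 2 * 1 * (2 * \<delta>)"
      unfolding abs_mult using d1 close_t by (intro mult_mono) auto
    moreover have "\<bar>u1\<^sup>2 - (v1 + d)\<^sup>2\<bar> \<le> 6 * \<delta>" "\<bar>u2\<^sup>2 - (v2 + d)\<^sup>2\<bar> \<le> 6 * \<delta>"
      using sq u v12 Z by blast+
    ultimately have "\<bar>e\<bar> \<le> 16 * \<delta>" by linarith
    then have e: "\<bar>e\<bar> / \<theta> \<le> 16 * K ^ (m + 1)"
      using divide_right_mono[of "\<bar>e\<bar>" "16 * \<delta>" \<theta>] \<theta>_bounds by simp
    define q where "q = \<epsilon> * (f2 u1 - f2 v1 - f2 u2 + f2 v2)"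
    have 1: "(f2 u1 - f2 v1) + (f2 v2 - f2 u2) \<in> iterated_diffset 2 (f2 ` X)"
      unfolding one_add_one[symmetric]
      using u v12 Z by (intro iterated_diffset_add diff_in_iterated_diffset_1) auto
    have q: "q \<in> iterated_diffset 2 (f2 ` X)"
    proof (cases "\<epsilon> = 1")
      case True
      then show ?thesis using 1 by (simp add: q_def algebra_simps)
    next
      case False
      then show ?thesis using uminus_iterated_diffset[OF 1] \<epsilon> by (simp add: q_def algebra_simps)
    qed
    define j where "j = \<lfloor>\<epsilon> * (2 * d * v) / \<theta>\<rfloor> - q - \<lfloor>\<epsilon> * (2 * d * (\<delta> * t)) / \<theta>\<rfloor>"
    have "\<bar>real_of_int j\<bar> \<le> 16 * K ^ (m + 1) + 6"
    proof -
      define g where "g = u1\<^sup>2 / \<theta> - v1\<^sup>2 / \<theta> - u2\<^sup>2 / \<theta> + v2\<^sup>2 / \<theta>"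
      have "\<epsilon> * (2 * d * v) / \<theta> - \<epsilon> * (2 * d * (\<delta> * t)) / \<theta> - \<epsilon> * g = \<epsilon> * (e / \<theta>)"
        by (simp add: e_def g_def algebra_simps diff_divide_distrib add_divide_distrib)
      moreover have "\<bar>real_of_int \<epsilon> * (e / \<theta>)\<bar> \<le> 16 * K ^ (m + 1)"
        using e \<epsilon> \<theta>_bounds by (auto simp: abs_mult)
      moreover have "\<bar>real_of_int q - \<epsilon> * g\<bar> \<le> 4"
      proof -
        have "\<bar>real_of_int (f2 u1 - f2 v1 - f2 u2 + f2 v2) - g\<bar> \<le> 4"
          unfolding g_def by linarith
        then have "\<bar>real_of_int \<epsilon> * (real_of_int (f2 u1 - f2 v1 - f2 u2 + f2 v2) - g)\<bar> \<le> 4"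
          using \<epsilon> by (auto simp: abs_mult)
        then show ?thesis by (simp add: q_def algebra_simps)
      qed
      moreover have "\<bar>real_of_int (\<lfloor>a\<rfloor> - q - \<lfloor>b\<rfloor>)\<bar> \<le> r + 6"
        if "a - b - c = h" "\<bar>h\<bar> \<le> r" "\<bar>real_of_int q - c\<bar> \<le> 4" for a b c h r :: real
        using that by linarith
      ultimately show ?thesis unfolding j_def by blast
    qed
    then have "\<bar>real_of_int j\<bar> \<le> J" using J by linarith
    then have "j \<in> {-J..J}" by (simp add: abs_le_iff)
    then have "\<lfloor>\<epsilon> * (2 * d * (\<delta> * t)) / \<theta>\<rfloor> + j \<in> T" using t by (auto simp: T_def)
    moreover have "\<lfloor>\<epsilon> * (2 * d * v) / \<theta>\<rfloor> - (\<lfloor>\<epsilon> * (2 * d * (\<delta> * t)) / \<theta>\<rfloor> + j) = q"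
      by (simp add: j_def)
    ultimately show ?thesis using q by (intro bexI) auto
  qed
  then show ?thesis unfolding controlled_def d_def[symmetric] using finT cT by blast
qed

text \<open>The cells lie in few translates of pieces of an iterated difference set, each piece
  confined to an interval of length about l/\<theta>. By \<open>card_iterated_diffset_local\<close>
  such a piece is bounded through the number of points of X with square in a comparable interval. As
  X stays above K^(-m), these points lie in an interval of length O(K^m l), so the Frostman
  condition supplies the factor l^s down to l = \<delta>.\<close>

lemma card_cells_le:
  assumes E: "controlled k E" and E_le: "\<And>e. e \<in> E \<Longrightarrow> \<bar>e\<bar> \<le> l" and l: "\<delta> \<le> l"
  shows "card ((\<lambda>e. \<lfloor>e / \<theta>\<rfloor>) ` E)
    \<le> (K ^ (4 * p + m + 4)) ^ k * K ^ (m + 2 + p * (2 * k + 2)) * l powr s * card A"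
proof -
  let ?L = "K ^ (4 * p + m + 4)" and ?n = "real (card A)"
  let ?P = "f2 ` X"
  obtain T where T: "finite T" "2 * real (card T) \<le> ?L ^ k"
    "\<And>e. e \<in> E \<Longrightarrow> \<exists>t\<in>T. \<lfloor>e / \<theta>\<rfloor> - t \<in> iterated_diffset (2 * k) ?P"
    using E unfolding controlled_def by blast
  have finP: "finite ?P" using finX by simp
  define Z where "Z t = {q\<in>iterated_diffset (2 * k) ?P. \<bar>real_of_int (t + q)\<bar> \<le> l / \<theta> + 1}" for t
  have finZ: "finite (Z t)" for t using finite_iterated_diffset[OF finP] by (simp add: Z_def)
  have sub: "(\<lambda>e. \<lfloor>e / \<theta>\<rfloor>) ` E \<subseteq> (\<Union>t\<in>T. (\<lambda>q. t + q) ` Z t)"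
  proof clarify
    fix e assume e: "e \<in> E"
    then obtain t where t: "t \<in> T" "\<lfloor>e / \<theta>\<rfloor> - t \<in> iterated_diffset (2 * k) ?P" using T(3) by blast
    have "\<bar>e / \<theta>\<bar> \<le> l / \<theta>" using E_le[OF e] \<theta>_bounds by (simp add: divide_right_mono)
    then have "\<bar>real_of_int \<lfloor>e / \<theta>\<rfloor>\<bar> \<le> l / \<theta> + 1" by linarith
    then have "\<lfloor>e / \<theta>\<rfloor> - t \<in> Z t" using t by (simp add: Z_def)
    then show "\<lfloor>e / \<theta>\<rfloor> \<in> (\<Union>t\<in>T. (\<lambda>q. t + q) ` Z t)" using t(1)
      by (intro UN_I[of t] image_eqI[of _ _ "\<lfloor>e / \<theta>\<rfloor> - t"]) auto
  qed
  \<comment> \<open>The Frostman count gives 6 K^(m+1) l^s n, and one more K absorbs the 6.\<close>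
  define M where "M = K ^ (m + 2) * l powr s * ?n"
  have M0: "0 \<le> M" using K1 by (simp add: M_def)
  have local: "card {q\<in>?P. y - q \<in> Z t} \<le> M" for y t
  proof -
    let ?W = "{x\<in>X. y - f2 x \<in> Z t}"
    have "card {q\<in>?P. y - q \<in> Z t} \<le> card (f2 ` ?W)"
      using finX by (intro card_mono) auto
    also have "\<dots> \<le> card ?W" using finX by (intro card_image_le) auto
    finally have le: "real (card {q\<in>?P. y - q \<in> Z t}) \<le> card ?W" by simp
    show ?thesis
    proof (cases "?W = {}")
      case True
      then show ?thesis using le M0 by (simp add: True)
    next
      case False
      then obtain z where z: "z \<in> ?W" by blast
      have "?W \<subseteq> {x\<in>A. \<bar>x - z\<bar> \<le> 3 * K ^ m * l}"
      proof
        fix x assume x: "x \<in> ?W"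
        have "\<bar>real_of_int (t + (y - f2 x))\<bar> \<le> l / \<theta> + 1" "\<bar>real_of_int (t + (y - f2 z))\<bar> \<le> l / \<theta> + 1"
          using x z by (auto simp: Z_def)
        then have "\<bar>x\<^sup>2 / \<theta> - z\<^sup>2 / \<theta>\<bar> \<le> 2 * (l / \<theta>) + 3" by linarith
        then have "\<theta> * \<bar>x\<^sup>2 / \<theta> - z\<^sup>2 / \<theta>\<bar> \<le> \<theta> * (2 * (l / \<theta>) + 3)"
          using \<theta>_bounds by (intro mult_left_mono) auto
        also have "\<theta> * \<bar>x\<^sup>2 / \<theta> - z\<^sup>2 / \<theta>\<bar> = \<bar>x\<^sup>2 - z\<^sup>2\<bar>"
          using \<theta>_bounds by (simp add: diff_divide_distrib[symmetric])
        also have "\<theta> * (2 * (l / \<theta>) + 3) = 2 * l + 3 * \<theta>" using \<theta>_bounds by (simp add: field_simps)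
        finally have 1: "\<bar>x\<^sup>2 - z\<^sup>2\<bar> \<le> 5 * l" using \<theta>_bounds l by linarith
        have "1 / K ^ m \<le> x" "1 / K ^ m \<le> z" using X_lower x z by auto
        then have "2 / K ^ m \<le> x + z" by simp
        then have "\<bar>x - z\<bar> * (2 / K ^ m) \<le> \<bar>x - z\<bar> * (x + z)" by (intro mult_left_mono) auto
        also have "\<dots> = \<bar>x\<^sup>2 - z\<^sup>2\<bar>"
        proof -
          have "x\<^sup>2 - z\<^sup>2 = (x - z) * (x + z)" by (simp add: power2_eq_square algebra_simps)
          moreover have "0 \<le> x + z" using X01 x z by auto
          ultimately show ?thesis by (simp add: abs_mult)
        qed
        finally have "\<bar>x - z\<bar> * (2 / K ^ m) \<le> 5 * l" using 1 by simp
        then have "\<bar>x - z\<bar> * 2 \<le> 5 * l * K ^ m" using K1 by (simp add: field_simps)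
        moreover have "0 \<le> l * K ^ m" using l \<delta> K1 by simp
        ultimately have "\<bar>x - z\<bar> \<le> 3 * K ^ m * l" by (simp add: mult_ac)
        then show "x \<in> {x\<in>A. \<bar>x - z\<bar> \<le> 3 * K ^ m * l}" using x XA by auto
      qed
      then have "card ?W \<le> card {x\<in>A. \<bar>x - z\<bar> \<le> 3 * K ^ m * l}"
        using finA by (intro card_mono) auto
      also have "real \<dots> \<le> 2 * K * (3 * K ^ m * l) powr s * ?n"
      proof (rule frostman_centred)
        have "1 \<le> K ^ m" using K1 by simp
        then have "1 * l \<le> 3 * K ^ m * l" using l \<delta> by (intro mult_right_mono) auto
        then show "\<delta> \<le> 3 * K ^ m * l" using l by linarith
      qed
      also have "\<dots> \<le> 2 * K * (3 * K ^ m * l powr s) * ?n"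
      proof -
        have "1 \<le> K ^ m" using K1 by simp
        then have "(3 * K ^ m * l) powr s \<le> 3 * K ^ m * l powr s"
          using l \<delta> s by (intro powr_mult_le) auto
        then show ?thesis using K1 by (intro mult_right_mono mult_left_mono) auto
      qed
      also have "\<dots> = 6 * (K * K ^ m * l powr s * ?n)" by simp
      also have "\<dots> \<le> K * (K * K ^ m * l powr s * ?n)" using K by (intro mult_right_mono) auto
      also have "\<dots> = M" by (simp add: M_def mult_ac)
      finally show ?thesis using le by linarith
    qed
  qed
  have Zt: "card (Z t) \<le> M * K ^ (p * (2 * k + 2))" for t
  proof -
    have cP: "card ?P = card X" by (rule card_image[OF inj2])
    have "real (card (Z t)) * card ?P \<le> M * card (iterated_diffset (Suc (2 * k)) ?P)"
      by (rule card_iterated_diffset_local[OF finP _ local]) (auto simp: Z_def)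
    also have "\<dots> \<le> M * (K ^ (p * Suc (2 * k)) * ?n)"
      by (intro mult_left_mono diff2 M0)
    also have "\<dots> \<le> M * (K ^ (p * Suc (2 * k)) * (K ^ p * card X))"
      using X_large M0 K1 by (intro mult_left_mono) auto
    also have "K ^ (p * Suc (2 * k)) * (K ^ p * card X) = K ^ (p * (2 * k + 2)) * card X"
    proof -
      have "K ^ (p * Suc (2 * k)) * K ^ p = K ^ (p * Suc (2 * k) + p)" by (rule power_add[symmetric])
      also have "p * Suc (2 * k) + p = p * (2 * k + 2)" by simp
      finally show ?thesis by (simp only: mult.assoc[symmetric])
    qed
    finally have "real (card (Z t)) * card X \<le> M * K ^ (p * (2 * k + 2)) * card X"
      by (simp add: cP mult_ac)
    moreover have "0 < card X" using X_large card_pos by (auto intro: gr0I)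
    ultimately show ?thesis by simp
  qed
  have "card ((\<lambda>e. \<lfloor>e / \<theta>\<rfloor>) ` E) \<le> card (\<Union>t\<in>T. (\<lambda>q. t + q) ` Z t)"
    using sub T(1) finZ by (intro card_mono) auto
  also have "\<dots> \<le> (\<Sum>t\<in>T. card ((\<lambda>q. t + q) ` Z t))" using T(1) by (rule card_UN_le)
  also have "\<dots> \<le> (\<Sum>t\<in>T. card (Z t))" using finZ by (intro sum_mono card_image_le) auto
  finally have "real (card ((\<lambda>e. \<lfloor>e / \<theta>\<rfloor>) ` E)) \<le> (\<Sum>t\<in>T. real (card (Z t)))"
    by (metis of_nat_le_iff of_nat_sum)
  also have "\<dots> \<le> (\<Sum>t\<in>T. M * K ^ (p * (2 * k + 2)))" using Zt by (intro sum_mono)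
  also have "\<dots> = card T * (M * K ^ (p * (2 * k + 2)))" by simp
  also have "\<dots> \<le> ?L ^ k * (M * K ^ (p * (2 * k + 2)))"
    using T(2) M0 K1 by (intro mult_right_mono) auto
  also have "\<dots> = ?L ^ k * K ^ (m + 2 + p * (2 * k + 2)) * l powr s * ?n"
    by (simp add: M_def power_add mult_ac)
  finally show ?thesis .
qed

text \<open>The cells of 2b X0 + 2a X0 are few by \<open>card_cells_le\<close>, so by
  Cauchy--Schwarz there are many collisions, which is the hypothesis \<open>energy\<close>. The
  exponent is 12p + 4 for replacing n^4 by |X0|^4, plus 50p + 9m + 35 for the number of cells, plus
  the margin 10 of \<open>small_dilate_sums\<close>.\<close>

theorem contradiction_if_loss_small:
  assumes small: "K ^ (62 * p + 9 * m + 49) \<le> \<delta> powr (- ((1 - s) / 10 * s))"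
  shows False
proof -
  let ?n = "real (card A)"
  let ?q = "62 * p + 9 * m + 39"
  have cX: "card (f1 ` X) = card X" by (rule card_image[OF inj1])
  have cX0: "0 < card X" using X_large card_pos by (auto intro: gr0I)
  have "card (iterated_diffset 1 (f1 ` X)) \<le> K ^ p * ?n" using diff1[of 1] by simp
  also have "\<dots> \<le> K ^ p * (K ^ p * card X)" using X_large K1 by (intro mult_left_mono) auto
  also have "\<dots> = K ^ (2 * p) * card (f1 ` X)" by (simp add: cX mult_2 power_add)
  finally have small_diff: "card (iterated_diffset 1 (f1 ` X)) \<le> K ^ (2 * p) * card (f1 ` X)" .
  have fX: "finite (f1 ` X)" "f1 ` X \<noteq> {}" using finX cX0 by auto
  have K2p: "0 < K ^ (2 * p)" using K1 by simp
  obtain z0 P0 where z0: "z0 \<in> f1 ` X" and P0: "P0 \<subseteq> f1 ` X" "card (f1 ` X) \<le> 2 * K ^ (2 * p) * card P0"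
    and pop: "\<And>z. z \<in> P0 \<Longrightarrow> card (f1 ` X) \<le> 2 * K ^ (2 * p) * card {w\<in>f1 ` X. w + (z - z0) \<in> f1 ` X}"
    using popular_differences[OF fX K2p small_diff] by blast
  obtain y where y: "y \<in> X" "z0 = f1 y" using z0 by blast
  define X0 where "X0 = {x\<in>X. f1 x \<in> P0}"
  have X0X: "X0 \<subseteq> X" by (auto simp: X0_def)
  have exp: "K ^ p * (2 * K ^ (2 * p) * c) \<le> K ^ (3 * p + 1) * c" if "0 \<le> c" for c
  proof -
    have "K ^ p * K ^ (2 * p) = K ^ (p + 2 * p)" by (rule power_add[symmetric])
    also have "p + 2 * p = 3 * p" by simp
    finally have "2 * ((K ^ p * K ^ (2 * p)) * c) = 2 * (K ^ (3 * p) * c)" by simp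
    then have "K ^ p * (2 * K ^ (2 * p) * c) = 2 * (K ^ (3 * p) * c)"
      by (simp only: mult_ac)
    also have "\<dots> \<le> K * (K ^ (3 * p) * c)" using K K1 that by (intro mult_right_mono) auto
    finally show ?thesis by (simp add: mult.assoc)
  qed
  have P0_eq: "P0 = f1 ` X0" using P0(1) unfolding X0_def by blast
  have cP0: "card P0 = card X0" unfolding P0_eq
    using inj1 X0X by (intro card_image) (rule inj_on_subset)
  have X0_large: "?n \<le> K ^ (3 * p + 1) * card X0"
  proof -
    have "?n \<le> K ^ p * (2 * K ^ (2 * p) * card X0)"
      using X_large P0(2) K1 by (intro order_trans[OF X_large] mult_left_mono) (auto simp: cX cP0)
    then show ?thesis using exp[of "card X0"] by linarith
  qed
  have dil: "controlled 1 ((\<lambda>v. real_of_int \<epsilon> * (2 * (x - y) * v)) ` X)"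
    if x: "x \<in> X0" and \<epsilon>: "\<epsilon> = 1 \<or> \<epsilon> = - 1" for x and \<epsilon> :: int
  proof (rule controlled_dilate[OF _ y(1) _ _ _ \<epsilon>])
    let ?Z = "{v\<in>X. f1 v + (f1 x - z0) \<in> f1 ` X}"
    show "x \<in> X" using x X0X by auto
    show "?Z \<subseteq> X" by auto
    have "{w\<in>f1 ` X. w + (f1 x - z0) \<in> f1 ` X} = f1 ` ?Z" by auto
    moreover have "card (f1 ` ?Z) = card ?Z" 
      by (intro card_image inj_on_subset[OF inj1]) auto
    ultimately have "card X \<le> 2 * K ^ (2 * p) * card ?Z"
      using pop[of "f1 x"] x by (simp add: X0_def cX)
    then have "?n \<le> K ^ p * (2 * K ^ (2 * p) * card ?Z)"
      using K1 by (intro order_trans[OF X_large] mult_left_mono) auto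
    then show "?n \<le> K ^ (3 * p + 1) * card ?Z" using exp[of "card ?Z"] by linarith
    fix v assume "v \<in> ?Z"
    then obtain u where "u \<in> X" "f1 v + (f1 x - z0) = f1 u" by auto
    then show "\<exists>u\<in>X. f1 u - f1 v = f1 x - f1 y" by (intro bexI[of _ u]) (auto simp: y(2))
  qed
  interpret small_dilate_sums s K \<delta> A X0 ?q "(1 - s) / 10"
  proof
    show "X0 \<subseteq> A" using X0X XA by auto
    show "?n \<le> K ^ ?q * card X0"
    proof -
      have "K ^ (3 * p + 1) * card X0 \<le> K ^ ?q * card X0"
        using K1 by (intro mult_right_mono power_increasing) auto
      then show ?thesis using X0_large by linarith
    qed
    have "?q + 10 = 62 * p + 9 * m + 49" by simp
    then show "K ^ (?q + 10) \<le> \<delta> powr (- ((1 - s) / 10 * s))" using small by (simp only:)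
    fix x1 x2 x3 x4 x5 x6 b a
    assume x: "x1 \<in> X0" "x2 \<in> X0" "x3 \<in> X0" "x4 \<in> X0" "x5 \<in> X0" "x6 \<in> X0"
      and b: "b = 2 * (x3 - x4)" and a: "a = (x1 - x2) + (x5 - x6)"
      and b\<delta>: "\<delta> \<le> \<bar>b\<bar>" and ab: "\<bar>a\<bar> \<le> \<bar>b\<bar>"
    let ?C = "{(v, w, v', w'). v \<in> X0 \<and> w \<in> X0 \<and> v' \<in> X0 \<and> w' \<in> X0 \<and> \<bar>b * (v - v') + a * (w - w')\<bar> \<le> \<delta>}"
    let ?D = "\<lambda>x. (\<lambda>v. real_of_int 1 * (2 * (x - y) * v)) ` X"
    let ?D' = "\<lambda>x. (\<lambda>v. real_of_int (- 1) * (2 * (x - y) * v)) ` X"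
    \<comment> \<open>x - x' is the difference of x - y and x' - y, both popular with the same base
      point y; this needs dilates of both signs. Each of 2a and 2b consists of two such pairs, which
      gives the total of 8.\<close>
    have pair: "controlled (1 + 1) ((\<lambda>v. 2 * (x - x') * v) ` X)" if "x \<in> X0" "x' \<in> X0" for x x'
    proof (rule controlled_add[OF dil[OF that(1), of 1] dil[OF that(2), of "-1"]])
      fix g assume "g \<in> (\<lambda>v. 2 * (x - x') * v) ` X"
      then obtain v where "v \<in> X" "g = 2 * (x - x') * v" by auto
      then show "\<exists>e\<in>?D x. \<exists>f\<in>?D' x'. g = e + f"
        by (intro bexI[of _ "real_of_int 1 * (2 * (x - y) * v)"] bexI[of _ "real_of_int (- 1) * (2 * (x' - y) * v)"])
          (auto simp: algebra_simps)
    qed auto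
    have B: "controlled ((1 + 1) + (1 + 1)) ((\<lambda>v. 2 * b * v) ` X)"
    proof (rule controlled_add[OF pair[OF x(3,4)] pair[OF x(3,4)]])
      fix g assume "g \<in> (\<lambda>v. 2 * b * v) ` X"
      then obtain v where "v \<in> X" "g = 2 * b * v" by auto
      then show "\<exists>e\<in>(\<lambda>v. 2 * (x3 - x4) * v) ` X. \<exists>f\<in>(\<lambda>v. 2 * (x3 - x4) * v) ` X. g = e + f"
        by (intro bexI[of _ "2 * (x3 - x4) * v"]) (auto simp: b)
    qed
    have A': "controlled ((1 + 1) + (1 + 1)) ((\<lambda>v. 2 * a * v) ` X)"
    proof (rule controlled_add[OF pair[OF x(1,2)] pair[OF x(5,6)]])
      fix g assume "g \<in> (\<lambda>v. 2 * a * v) ` X"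
      then obtain v where "v \<in> X" "g = 2 * a * v" by auto
      then show "\<exists>e\<in>(\<lambda>v. 2 * (x1 - x2) * v) ` X. \<exists>f\<in>(\<lambda>v. 2 * (x5 - x6) * v) ` X. g = e + f"
        by (intro bexI[of _ "2 * (x1 - x2) * v"] bexI[of _ "2 * (x5 - x6) * v"]) (auto simp: a algebra_simps)
    qed
    \<comment> \<open>The coefficients are doubled because the controlled dilates are by 2(x - y).
      Two equal cells then give 2 |b(v - v') + a(w - w')| \<le> \<theta>, more than enough for
      \<delta>.\<close>
    define E where "E = (\<lambda>(v, w). 2 * b * v + 2 * a * w) ` (X0 \<times> X0)"
    have "controlled (((1 + 1) + (1 + 1)) + ((1 + 1) + (1 + 1))) E"
      by (rule controlled_add[OF B A']) (use X0X in \<open>auto simp: E_def\<close>)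
    moreover have "((1 + 1) + (1 + 1)) + ((1 + 1) + (1 + 1)) = (8::nat)" by simp
    ultimately have E8: "controlled 8 E" by (simp only:)
    have E_le: "\<bar>e\<bar> \<le> 4 * \<bar>b\<bar>" if e: "e \<in> E" for e
    proof -
      obtain v w where vw: "v \<in> X0" "w \<in> X0" "e = 2 * b * v + 2 * a * w" using e by (auto simp: E_def)
      have vw1: "\<bar>v\<bar> \<le> 1" "\<bar>w\<bar> \<le> 1" using vw X0X X01[of v] X01[of w] by auto
      have "\<bar>b * v\<bar> \<le> \<bar>b\<bar> * 1" "\<bar>a * w\<bar> \<le> \<bar>a\<bar> * 1"
        unfolding abs_mult by (intro mult_left_mono vw1 abs_ge_zero)+
      moreover have "e = 2 * (b * v) + 2 * (a * w)" using vw by simp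
      ultimately show ?thesis using ab by linarith
    qed
    let ?f = "\<lambda>(v, w). \<lfloor>(2 * b * v + 2 * a * w) / \<theta>\<rfloor>"
    let ?S = "X0 \<times> X0"
    let ?Col = "{(x, y). x \<in> ?S \<and> y \<in> ?S \<and> ?f x = ?f y}"
    have finX0: "finite X0" using X0X finX finite_subset by blast
    have finC: "finite ?C"
      by (rule finite_subset[of _ "X0 \<times> X0 \<times> X0 \<times> X0"]) (use finX0 in auto)
    have "card (?f ` ?S) = card ((\<lambda>e. \<lfloor>e / \<theta>\<rfloor>) ` E)"
      by (rule arg_cong[where f=card]) (auto simp: E_def image_image case_prod_beta)
    also have "real \<dots> \<le> (K ^ (4 * p + m + 4)) ^ 8 * K ^ (m + 2 + p * (2 * 8 + 2)) * (4 * \<bar>b\<bar>) powr s * ?n"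
      by (rule card_cells_le[OF E8 E_le]) (use b\<delta> in auto)
    also have "\<dots> \<le> (K ^ (4 * p + m + 4)) ^ 8 * K ^ (m + 2 + p * (2 * 8 + 2)) * (K * \<bar>b\<bar> powr s) * ?n"
    proof -
      have "(4 * \<bar>b\<bar>) powr s \<le> 4 * \<bar>b\<bar> powr s" using s by (intro powr_mult_le) auto
      also have "\<dots> \<le> K * \<bar>b\<bar> powr s" using K by (intro mult_right_mono) auto
      finally show ?thesis using K1 by (intro mult_right_mono mult_left_mono) auto
    qed
    also have "\<dots> = K ^ (50 * p + 9 * m + 35) * \<bar>b\<bar> powr s * ?n"
    proof -
      have "(K ^ (4 * p + m + 4)) ^ 8 * K ^ (m + 2 + p * (2 * 8 + 2)) * K
          = K ^ ((4 * p + m + 4) * 8 + (m + 2 + p * (2 * 8 + 2)) + 1)"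
        by (simp only: power_add power_mult power_one_right)
      also have "(4 * p + m + 4) * 8 + (m + 2 + p * (2 * 8 + 2)) + 1 = 50 * p + 9 * m + 35" by simp
      finally have e: "(K ^ (4 * p + m + 4)) ^ 8 * K ^ (m + 2 + p * (2 * 8 + 2)) * K = K ^ (50 * p + 9 * m + 35)" .
      show ?thesis unfolding e[symmetric] by (simp only: mult_ac)
    qed
    finally have cells: "card (?f ` ?S) \<le> K ^ (50 * p + 9 * m + 35) * \<bar>b\<bar> powr s * ?n" .
    have "card ?Col \<le> card ?C"
    proof (rule card_inj_on_le[where f="\<lambda>((v, w), (v', w')). (v, w, v', w')"])
      show "inj_on (\<lambda>((v, w), (v', w')). (v, w, v', w')) ?Col" by (auto simp: inj_on_def)
      show "(\<lambda>((v, w), (v', w')). (v, w, v', w')) ` ?Col \<subseteq> ?C"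
      proof
        fix z assume "z \<in> (\<lambda>((v, w), (v', w')). (v, w, v', w')) ` ?Col"
        then obtain v w v' w' where z: "z = (v, w, v', w')"
          and X: "v \<in> X0" "w \<in> X0" "v' \<in> X0" "w' \<in> X0"
          and eq: "\<lfloor>(2 * b * v + 2 * a * w) / \<theta>\<rfloor> = \<lfloor>(2 * b * v' + 2 * a * w') / \<theta>\<rfloor>"
          by auto
        have "\<bar>(2 * b * v + 2 * a * w) - (2 * b * v' + 2 * a * w')\<bar> \<le> \<theta>"
          using floor_divide_bounds[OF \<theta>_bounds(1), of "2 * b * v + 2 * a * w"]
            floor_divide_bounds[OF \<theta>_bounds(1), of "2 * b * v' + 2 * a * w'"] unfolding eq by linarith
        moreover have "(2 * b * v + 2 * a * w) - (2 * b * v' + 2 * a * w') = 2 * (b * (v - v') + a * (w - w'))"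
          by (simp add: algebra_simps)
        ultimately have "2 * \<bar>b * (v - v') + a * (w - w')\<bar> \<le> \<theta>" by (simp only: abs_mult abs_numeral)
        then show "z \<in> ?C" using X \<theta>_bounds by (auto simp: z)
      qed
    qed (rule finC)
    then have Col: "real (card ?Col) \<le> card ?C" by simp
    have "?n * ?n ^ 3 = ?n ^ 4" by (simp add: eval_nat_numeral)
    also have "\<dots> \<le> (K ^ (3 * p + 1) * card X0) ^ 4" using X0_large by (intro power_mono) auto
    also have "\<dots> = K ^ (12 * p + 4) * (real (card ?S))\<^sup>2"
    proof -
      have "(K ^ (3 * p + 1)) ^ 4 = K ^ ((3 * p + 1) * 4)" by (rule power_mult[symmetric])
      also have "(3 * p + 1) * 4 = 12 * p + 4" by simp
      finally show ?thesis
        by (simp add: card_cartesian_product power_mult_distrib power2_eq_square power4_eq_xxxx mult.assoc)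
    qed
    also have "\<dots> \<le> K ^ (12 * p + 4) * (card (?f ` ?S) * real (card ?Col))"
      using card_collisions[of ?S ?f] finX0 K1 by (intro mult_left_mono) auto
    also have "\<dots> \<le> K ^ (12 * p + 4) * ((K ^ (50 * p + 9 * m + 35) * \<bar>b\<bar> powr s * ?n) * card ?C)"
      using cells Col K1 by (intro mult_left_mono mult_mono) auto
    also have "\<dots> = ?n * (K ^ ?q * \<bar>b\<bar> powr s * card ?C)"
    proof -
      have "K ^ ?q = K ^ (12 * p + 4) * K ^ (50 * p + 9 * m + 35)"
        by (simp add: power_add[symmetric] add.commute add.left_commute)
      then show ?thesis by simp
    qed
    finally show "?n ^ 3 \<le> K ^ ?q * \<bar>b\<bar> powr s * card ?C"
      by (rule mult_left_le_imp_le) (rule card_pos)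
  qed simp
  show False by (rule contradiction)
qed

end

subsection \<open>Partial sumsets and covering numbers\<close>

lemma covering_number_witness:
  assumes "finite E" "0 \<le> \<delta>"
  obtains F where "finite F" "card F = covering_number \<delta> E" "E \<subseteq> (\<Union>a\<in>F. {a..a+\<delta>})"
proof -
  have "\<exists>n F. finite F \<and> card F = n \<and> E \<subseteq> (\<Union>a\<in>F. {a..a+\<delta>})"
    using assms by (intro exI[of _ "card E"] exI[of _ E]) auto
  from LeastI_ex[OF this] show thesis
    unfolding covering_number_def[symmetric] using that by blast
qed

text \<open>After division by \<eta> an interval of length \<delta> meets O(\<delta>/|\<eta>| + 1)
  integers, and the sum of two floors differs from the floor of the sum by 0 or 1. The bound for all
  subsets H refers to the cover of the full set E, so it persists when the graph is thinned. \<eta>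
  may be negative, since it will contain the coefficient \<alpha>.\<close>

lemma card_partial_floor_sums:
  fixes \<phi> :: "'a \<Rightarrow> real" and \<psi> :: "'b \<Rightarrow> real"
  assumes fin: "finite G" and \<delta>: "0 \<le> \<delta>" and \<eta>: "\<eta> \<noteq> 0" and H: "H \<subseteq> G"
    and E: "E = (\<lambda>(x, y). \<phi> x + \<psi> y) ` G"
  shows "card ((\<lambda>(x, y). \<lfloor>\<phi> x / \<eta>\<rfloor> + \<lfloor>\<psi> y / \<eta>\<rfloor>) ` H)
    \<le> 2 * (2 * (\<delta> / \<bar>\<eta>\<bar>) + 3) * covering_number \<delta> E"
proof -
  have "finite E" using fin E by simp
  then obtain F where F: "finite F" "card F = covering_number \<delta> E" "E \<subseteq> (\<Union>a\<in>F. {a..a+\<delta>})"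
    using covering_number_witness \<delta> by blast
  define r where "r = \<delta> / \<bar>\<eta>\<bar> + 1"
  have r: "0 \<le> r" using \<delta> by (simp add: r_def)
  define B where "B = (\<Union>a\<in>F. {j::int. \<bar>real_of_int j - a / \<eta>\<bar> \<le> r})"
  have finB: "finite B" unfolding B_def using F(1) card_int_near(1)[OF r] by blast
  have "card B \<le> (\<Sum>a\<in>F. card {j::int. \<bar>real_of_int j - a / \<eta>\<bar> \<le> r})"
    unfolding B_def using F(1) by (rule card_UN_le)
  then have "real (card B) \<le> (\<Sum>a\<in>F. real (card {j::int. \<bar>real_of_int j - a / \<eta>\<bar> \<le> r}))"
    by (metis of_nat_le_iff of_nat_sum)
  also have "\<dots> \<le> (\<Sum>a\<in>F. 2 * r + 1)" by (intro sum_mono card_int_near(2)[OF r])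
  also have "\<dots> = (2 * r + 1) * card F" by simp
  also have "2 * r + 1 = 2 * (\<delta> / \<bar>\<eta>\<bar>) + 3" by (simp add: r_def)
  finally have cB: "real (card B) \<le> (2 * (\<delta> / \<bar>\<eta>\<bar>) + 3) * card F" .
  have "(\<lambda>(x, y). \<lfloor>\<phi> x / \<eta>\<rfloor> + \<lfloor>\<psi> y / \<eta>\<rfloor>) ` H \<subseteq> (\<lambda>(j, i). j - i) ` (B \<times> {0, 1})"
  proof clarify
    fix x y assume "(x, y) \<in> H"
    then have "\<phi> x + \<psi> y \<in> E" using H E by auto
    then obtain a where a: "a \<in> F" "a \<le> \<phi> x + \<psi> y" "\<phi> x + \<psi> y \<le> a + \<delta>" using F(3) by auto
    have "\<bar>(\<phi> x + \<psi> y) / \<eta> - a / \<eta>\<bar> = \<bar>\<phi> x + \<psi> y - a\<bar> / \<bar>\<eta>\<bar>"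
      by (simp add: diff_divide_distrib[symmetric])
    also have "\<dots> \<le> \<delta> / \<bar>\<eta>\<bar>" using a by (intro divide_right_mono) auto
    finally have "\<bar>real_of_int \<lfloor>(\<phi> x + \<psi> y) / \<eta>\<rfloor> - a / \<eta>\<bar> \<le> r" unfolding r_def by linarith
    then have j: "\<lfloor>(\<phi> x + \<psi> y) / \<eta>\<rfloor> \<in> B" using a(1) by (auto simp: B_def)
    define i where "i = \<lfloor>(\<phi> x + \<psi> y) / \<eta>\<rfloor> - (\<lfloor>\<phi> x / \<eta>\<rfloor> + \<lfloor>\<psi> y / \<eta>\<rfloor>)"
    have "i = 0 \<or> i = 1" unfolding i_def add_divide_distrib by linarith
    then show "\<lfloor>\<phi> x / \<eta>\<rfloor> + \<lfloor>\<psi> y / \<eta>\<rfloor> \<in> (\<lambda>(j, i). j - i) ` (B \<times> {0, 1})"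
      using j by (intro image_eqI[of _ _ "(\<lfloor>(\<phi> x + \<psi> y) / \<eta>\<rfloor>, i)"]) (auto simp: i_def)
  qed
  then have "card ((\<lambda>(x, y). \<lfloor>\<phi> x / \<eta>\<rfloor> + \<lfloor>\<psi> y / \<eta>\<rfloor>) ` H) \<le> card ((\<lambda>(j, i). j - i) ` (B \<times> {0, 1::int}))"
    using finB by (intro card_mono) auto
  also have "\<dots> \<le> card (B \<times> {0, 1::int})" using finB by (intro card_image_le) auto
  also have "\<dots> = 2 * card B" by (simp add: card_cartesian_product)
  finally have "real (card ((\<lambda>(x, y). \<lfloor>\<phi> x / \<eta>\<rfloor> + \<lfloor>\<psi> y / \<eta>\<rfloor>) ` H)) \<le> 2 * real (card B)" by linarith
  also have "\<dots> \<le> 2 * ((2 * (\<delta> / \<bar>\<eta>\<bar>) + 3) * card F)" using cB by (rule mult_left_mono) simp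
  finally show ?thesis by (simp only: F(2) mult.assoc)
qed

lemma floor_neq: "1 \<le> \<bar>a - b\<bar> \<Longrightarrow> \<lfloor>a\<rfloor> \<noteq> \<lfloor>b :: real\<rfloor>"
  by linarith

context frostman_set
begin

text \<open>The interval [0, K^(-m)] holds at most K K^(-ms) n \<le> n/K^2 points, so at most
  2n^2/K^2 pairs are lost, while G has at least n^2/K.\<close>

lemma dense_away_from_0:
  assumes G: "G \<subseteq> A \<times> A" and G_large: "(real (card A))\<^sup>2 \<le> K * card G"
    and m: "3 \<le> m * s" and x0: "\<delta> \<le> 1 / K ^ m"
  shows "(real (card A))\<^sup>2 \<le> K\<^sup>2 * card (G \<inter> {1 / K ^ m..} \<times> {1 / K ^ m..})"
proof -
  define n where "n = real (card A)"
  define A0 where "A0 = A \<inter> {0..0 + 1 / K ^ m}"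
  let ?G1 = "G \<inter> {1 / K ^ m..} \<times> {1 / K ^ m..}"
  have K0: "0 < K" using K by simp
  have fin: "finite G" "finite A0" using G finA finite_subset by (auto simp: A0_def)
  have "real (card A0) \<le> K * (1 / K ^ m) powr s * n"
    unfolding A0_def n_def by (rule frostman[OF x0])
  also have "(1 / K ^ m) powr s = 1 / K powr (m * s)"
    using K0 by (simp add: powr_divide powr_powr flip: powr_realpow)
  also have "K * (1 / K powr (m * s)) * n \<le> K * (1 / K ^ 3) * n"
  proof -
    have "K powr 3 \<le> K powr (m * s)" using m K by (intro powr_mono) auto
    then have "K ^ 3 \<le> K powr (m * s)" using K0 by (simp add: powr_numeral)
    then show ?thesis using K0
      by (intro mult_right_mono mult_left_mono divide_left_mono) (auto simp: n_def)
  qed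
  also have "\<dots> = n / K\<^sup>2" using K0 by (simp add: power2_eq_square power3_eq_cube)
  finally have cA0: "real (card A0) \<le> n / K\<^sup>2" .
  have "G \<subseteq> ?G1 \<union> (A0 \<times> A \<union> A \<times> A0)"
    using G A01 by (auto simp: A0_def)
  then have "card G \<le> card (?G1 \<union> (A0 \<times> A \<union> A \<times> A0))"
    using fin finA by (intro card_mono) auto
  also have "\<dots> \<le> card ?G1 + (card (A0 \<times> A) + card (A \<times> A0))"
    by (meson card_Un_le order_trans add_left_mono)
  finally have "real (card G) \<le> real (card ?G1 + (card (A0 \<times> A) + card (A \<times> A0)))"
    by (simp only: of_nat_le_iff)
  also have "\<dots> = card ?G1 + 2 * (n * card A0)"
    by (simp add: card_cartesian_product n_def)
  also have "\<dots> \<le> card ?G1 + 2 * (n * (n / K\<^sup>2))"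
    using cA0 by (intro add_left_mono mult_left_mono) (auto simp: n_def)
  finally have "K\<^sup>2 * card G \<le> K\<^sup>2 * (card ?G1 + 2 * (n * (n / K\<^sup>2)))"
    by (intro mult_left_mono) auto
  also have "\<dots> = K\<^sup>2 * card ?G1 + 2 * n\<^sup>2"
    using K0 by (simp add: distrib_left power2_eq_square)
  finally have "K * (K * card G) \<le> K\<^sup>2 * card ?G1 + 2 * n\<^sup>2"
    by (simp add: power2_eq_square mult.assoc)
  moreover have "3 * n\<^sup>2 \<le> K * (K * card G)"
    using G_large K by (intro mult_mono) (auto simp: n_def)
  ultimately show ?thesis by (simp add: n_def)
qed

lemma partial_sums_not_both_small:
  assumes sep: "delta_separated \<delta> A" and G: "G \<subseteq> A \<times> A" "(real (card A))\<^sup>2 \<le> K * card G"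
    and \<alpha>: "\<alpha> \<noteq> 0" "1 / \<bar>\<alpha>\<bar> \<le> K" and \<beta>: "\<beta> \<noteq> 0" "\<bar>\<alpha>\<bar> / \<bar>\<beta>\<bar> \<le> K"
    and m: "3 \<le> m * s"
    and small: "K ^ (381 * m + 8109) \<le> \<delta> powr (- ((1 - s) / 10 * s))"
    and cov1: "covering_number \<delta> (partial_sumset G) \<le> K * card A"
    and cov2: "covering_number \<delta> (partial_sq_sumset \<alpha> \<beta> G) \<le> K * card A"
  shows False
proof -
  define n where "n = real (card A)"
  have n: "0 < n" using card_pos by (simp add: n_def)
  have K0: "0 < K" "1 \<le> K" using K by auto
  have x0: "\<delta> \<le> 1 / K ^ m"
  proof -
    have "K ^ m \<le> K ^ (381 * m + 8109)" using K0 by (intro power_increasing) auto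
    also have "\<dots> \<le> \<delta> powr (- ((1 - s) / 10 * s))" by (rule small)
    also have "\<dots> \<le> \<delta> powr (- 1)"
    proof (rule powr_mono')
      have "(1 - s) / 10 * s \<le> 1 * 1" using s by (intro mult_mono) auto
      then show "- 1 \<le> - ((1 - s) / 10 * s)" by simp
    qed (use \<delta> in auto)
    also have "\<dots> = 1 / \<delta>" using \<delta> by (simp add: powr_minus_divide)
    finally show ?thesis using \<delta> K0 by (simp add: field_simps)
  qed
  \<comment> \<open>Points above K^(-m) that are \<delta>-separated have squares at distance at
    least 2\<delta>/K^m = 2K\<theta>. The spare factor K is what keeps \<open>g2\<close> injective,
    since |\<beta>|/|\<alpha>| may be as small as 1/K.\<close>
  define \<theta> where "\<theta> = \<delta> / K ^ (m + 1)"
  have \<theta>: "0 < \<theta>" "\<delta> / \<theta> = K ^ (m + 1)" using \<delta> K0 by (auto simp: \<theta>_def)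
  define A1 where "A1 = A \<inter> {1 / K ^ m..}"
  define G1 where "G1 = G \<inter> {1 / K ^ m..} \<times> {1 / K ^ m..}"
  have finA1: "finite A1" and A1A: "A1 \<subseteq> A" using finA by (auto simp: A1_def)
  have finG: "finite G" using G finA finite_subset by auto
  have G1: "G1 \<subseteq> A1 \<times> A1" "G1 \<subseteq> G" using G by (auto simp: G1_def A1_def)
  have G1_large: "n\<^sup>2 \<le> K\<^sup>2 * card G1"
    unfolding n_def G1_def by (rule dense_away_from_0[OF G m x0])
  define f1 where "f1 x = \<lfloor>x / \<delta>\<rfloor>" for x
  define f2 where "f2 x = \<lfloor>x\<^sup>2 / \<theta>\<rfloor>" for x
  \<comment> \<open>Dividing \<alpha>x^2 + \<beta>y^2 by \<alpha>\<theta> leaves the plain square in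
    the first variable, so \<open>f2\<close> is free of \<alpha> and \<beta>.\<close>
  define g2 where "g2 y = \<lfloor>\<beta> * y\<^sup>2 / (\<alpha> * \<theta>)\<rfloor>" for y
  have gap: "\<delta> \<le> \<bar>x - y\<bar>" if "x \<in> A1" "y \<in> A1" "x \<noteq> y" for x y
    using sep that A1A by (auto simp: delta_separated_def)
  have sq_gap: "2 * K \<le> \<bar>x\<^sup>2 - y\<^sup>2\<bar> / \<theta>" if "x \<in> A1" "y \<in> A1" "x \<noteq> y" for x y
  proof -
    have ge: "1 / K ^ m \<le> x" "1 / K ^ m \<le> y" using that by (auto simp: A1_def)
    have "0 < 1 / K ^ m" using K0 by simp
    then have "0 \<le> x + y" "2 / K ^ m \<le> x + y" using ge by linarith+
    have "\<bar>x\<^sup>2 - y\<^sup>2\<bar> = \<bar>x - y\<bar> * (x + y)"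
    proof -
      have "x\<^sup>2 - y\<^sup>2 = (x - y) * (x + y)" by (simp add: power2_eq_square algebra_simps)
      then show ?thesis using \<open>0 \<le> x + y\<close> by (simp add: abs_mult)
    qed
    moreover have "\<delta> * (2 / K ^ m) \<le> \<bar>x - y\<bar> * (x + y)"
      using gap[OF that] \<delta> K0 \<open>2 / K ^ m \<le> x + y\<close> by (intro mult_mono) auto
    ultimately have "\<delta> * (2 / K ^ m) / \<theta> \<le> \<bar>x\<^sup>2 - y\<^sup>2\<bar> / \<theta>"
      using \<theta> by (intro divide_right_mono) auto
    also have "\<delta> * (2 / K ^ m) / \<theta> = 2 / K ^ m * (\<delta> / \<theta>)" by simp
    also have "\<dots> = 2 * K" unfolding \<theta>(2) using K0 by simp
    finally show ?thesis .
  qed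
  have inj1: "inj_on f1 A1"
  proof (rule inj_onI, rule ccontr)
    fix x y assume xy: "x \<in> A1" "y \<in> A1" "f1 x = f1 y" "x \<noteq> y"
    have "\<bar>x / \<delta> - y / \<delta>\<bar> = \<bar>x - y\<bar> / \<delta>" using \<delta> by (simp add: diff_divide_distrib[symmetric])
    also have "1 \<le> \<dots>" using gap[OF xy(1,2,4)] \<delta> by simp
    finally show False using floor_neq xy(3) unfolding f1_def by blast
  qed
  have inj2: "inj_on f2 A1"
  proof (rule inj_onI, rule ccontr)
    fix x y assume xy: "x \<in> A1" "y \<in> A1" "f2 x = f2 y" "x \<noteq> y"
    have "1 \<le> \<bar>x\<^sup>2 - y\<^sup>2\<bar> / \<theta>" using sq_gap[OF xy(1,2,4)] K0 by linarith
    also have "\<bar>x\<^sup>2 - y\<^sup>2\<bar> / \<theta> = \<bar>x\<^sup>2 / \<theta> - y\<^sup>2 / \<theta>\<bar>" using \<theta> by (simp add: diff_divide_distrib[symmetric])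
    finally show False using floor_neq xy(3) unfolding f2_def by blast
  qed
  have inj3: "inj_on g2 A1"
  proof (rule inj_onI, rule ccontr)
    fix x y assume xy: "x \<in> A1" "y \<in> A1" "g2 x = g2 y" "x \<noteq> y"
    have ba: "1 / K \<le> \<bar>\<beta>\<bar> / \<bar>\<alpha>\<bar>" using \<alpha> \<beta> K0 by (simp add: field_simps)
    have "1 \<le> 1 / K * (2 * K)" using K0 by simp
    also have "\<dots> \<le> \<bar>\<beta>\<bar> / \<bar>\<alpha>\<bar> * (\<bar>x\<^sup>2 - y\<^sup>2\<bar> / \<theta>)"
      using ba sq_gap[OF xy(1,2,4)] K0 by (intro mult_mono) auto
    also have "\<dots> = \<bar>\<beta> * (x\<^sup>2 - y\<^sup>2) / (\<alpha> * \<theta>)\<bar>" using \<theta> by (simp add: abs_mult)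
    also have "\<beta> * (x\<^sup>2 - y\<^sup>2) / (\<alpha> * \<theta>) = \<beta> * x\<^sup>2 / (\<alpha> * \<theta>) - \<beta> * y\<^sup>2 / (\<alpha> * \<theta>)"
      by (simp add: right_diff_distrib diff_divide_distrib)
    finally show False using floor_neq xy(3) unfolding g2_def by blast
  qed
  have S1: "real (card ((\<lambda>(x, y). f1 x + f1 y) ` H)) \<le> K\<^sup>2 * n" if "H \<subseteq> G" for H
  proof -
    have "real (card ((\<lambda>(x, y). f1 x + f1 y) ` H))
        \<le> 2 * (2 * (\<delta> / \<bar>\<delta>\<bar>) + 3) * covering_number \<delta> (partial_sumset G)"
      unfolding f1_def
      by (rule card_partial_floor_sums[OF finG _ _ that]) (use \<delta> in \<open>auto simp: partial_sumset_def\<close>)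
    also have "\<dots> = 10 * real (covering_number \<delta> (partial_sumset G))" using \<delta> by simp
    also have "\<dots> \<le> K * (K * n)" using cov1 K n unfolding n_def by (intro mult_mono) auto
    finally show ?thesis by (simp add: power2_eq_square mult.assoc)
  qed
  have S2: "real (card ((\<lambda>(x, y). f2 x + g2 y) ` H)) \<le> K ^ (m + 4) * n" if "H \<subseteq> G" for H
  proof -
    have "f2 x = \<lfloor>\<alpha> * x\<^sup>2 / (\<alpha> * \<theta>)\<rfloor>" for x using \<alpha> by (simp add: f2_def)
    then have "real (card ((\<lambda>(x, y). f2 x + g2 y) ` H))
        \<le> 2 * (2 * (\<delta> / \<bar>\<alpha> * \<theta>\<bar>) + 3) * covering_number \<delta> (partial_sq_sumset \<alpha> \<beta> G)"
      unfolding g2_def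
      by (simp only:) (rule card_partial_floor_sums[OF finG _ _ that], use \<delta> \<theta> \<alpha> in \<open>auto simp: partial_sq_sumset_def\<close>)
    also have "\<delta> / \<bar>\<alpha> * \<theta>\<bar> = 1 / \<bar>\<alpha>\<bar> * (\<delta> / \<theta>)" using \<theta>(1) by (simp add: abs_mult)
    also have "2 * (2 * (1 / \<bar>\<alpha>\<bar> * (\<delta> / \<theta>)) + 3) * covering_number \<delta> (partial_sq_sumset \<alpha> \<beta> G)
        \<le> K ^ (m + 3) * (K * n)"
    proof (intro mult_mono)
      have ge: "1 \<le> K ^ (m + 2)" by (rule one_le_power[OF K0(2)])
      have "1 / \<bar>\<alpha>\<bar> * (\<delta> / \<theta>) \<le> K * K ^ (m + 1)"
        unfolding \<theta>(2) using \<alpha> K0 by (intro mult_right_mono) auto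
      then have "1 / \<bar>\<alpha>\<bar> * (\<delta> / \<theta>) \<le> K ^ (m + 2)" by simp
      moreover have "2 * (2 * x + 3) \<le> 10 * y" if "x \<le> y" "1 \<le> y" for x y :: real
        using that by simp
      ultimately have "2 * (2 * (1 / \<bar>\<alpha>\<bar> * (\<delta> / \<theta>)) + 3) \<le> 10 * K ^ (m + 2)" using ge by blast
      also have "\<dots> \<le> K * K ^ (m + 2)" using K by (intro mult_right_mono) auto
      finally show "2 * (2 * (1 / \<bar>\<alpha>\<bar> * (\<delta> / \<theta>)) + 3) \<le> K ^ (m + 3)" by (simp add: eval_nat_numeral)
    qed (use cov2 K0 in \<open>auto simp: n_def\<close>)
    also have "\<dots> = K ^ (m + 4) * n" by (simp add: eval_nat_numeral)
    finally show ?thesis .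
  qed
  have K24: "24 \<le> K" "12288 \<le> K ^ 3"
  proof -
    have "100 ^ 3 \<le> K ^ 3" using K by (intro power_mono) auto
    then show "24 \<le> K" "12288 \<le> K ^ 3" using K by auto
  qed
  have cA1: "n\<^sup>2 \<le> K\<^sup>2 * (real (card A1) * card A1)"
  proof -
    have "card G1 \<le> card (A1 \<times> A1)" using G1 finA1 by (intro card_mono) auto
    then have "real (card G1) \<le> real (card A1) * card A1"
      by (metis card_cartesian_product of_nat_le_iff of_nat_mult)
    then have "K\<^sup>2 * card G1 \<le> K\<^sup>2 * (real (card A1) * card A1)" by (intro mult_left_mono) auto
    then show ?thesis using G1_large by linarith
  qed
  have A1_le: "real (card A1) * card A1 \<le> n\<^sup>2"
  proof -
    have "real (card A1) \<le> n" unfolding n_def using A1A finA by (intro of_nat_mono card_mono)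
    then show ?thesis unfolding power2_eq_square using n by (intro mult_mono) auto
  qed
  have "G1 \<noteq> {}" using G1_large n by auto
  moreover have "real (card A1) * card A1 \<le> K\<^sup>2 * card G1" using A1_le G1_large by linarith
  moreover have "1 \<le> K\<^sup>2" using K0 by simp
  ultimately obtain A' B' where AB': "A' \<subseteq> A1" "B' \<subseteq> A1"
    "real (card A1) * card A1 \<le> 24 * (K\<^sup>2)\<^sup>2 * card (G1 \<inter> A' \<times> B')"
    "card (f1 ` A' + f1 ` B') * (real (card A1) * card A1)
       \<le> 12288 * (K\<^sup>2) ^ 5 * real (card ((\<lambda>(x, y). f1 x + f1 y) ` G1)) ^ 3"
    using Balog_Szemeredi_Gowers[OF finA1 finA1 G1(1) _ _ _ inj1 inj1, of "K\<^sup>2"] by blast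
  \<comment> \<open>The squares are treated inside the edges that survive the first application, so
    that one set X inherits both small sumsets. This uses that the surviving graph is still
    dense.\<close>
  define G2 where "G2 = G1 \<inter> A' \<times> B'"
  have fin': "finite A'" "finite B'" using AB' finA1 finite_subset by auto
  have G2: "real (card A1) * card A1 \<le> K ^ 5 * card G2"
  proof -
    have "24 * (K\<^sup>2)\<^sup>2 * card G2 \<le> K * (K\<^sup>2)\<^sup>2 * card G2"
      using K24 by (intro mult_right_mono) auto
    also have "K * (K\<^sup>2)\<^sup>2 = K ^ 5" by (simp add: eval_nat_numeral)
    finally show ?thesis using AB'(3) by (simp add: G2_def)
  qed
  have n_G2: "n\<^sup>2 \<le> K ^ 7 * card G2"
  proof -
    have "K\<^sup>2 * (real (card A1) * card A1) \<le> K\<^sup>2 * (K ^ 5 * card G2)"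
      using G2 by (intro mult_left_mono) auto
    also have "\<dots> = K ^ 7 * card G2" by (simp add: mult.assoc[symmetric] power_add[symmetric])
    finally show ?thesis using cA1 by linarith
  qed
  have sum1: "card (f1 ` A' + f1 ` B') \<le> K ^ 21 * n"
  proof -
    have "card (f1 ` A' + f1 ` B') * (real (card A1) * card A1)
        \<le> 12288 * (K\<^sup>2) ^ 5 * (K\<^sup>2 * n) ^ 3"
      using S1[OF G1(2)] K0
      by (intro order_trans[OF AB'(4)] mult_left_mono power_mono) auto
    also have "\<dots> \<le> K ^ 3 * (K\<^sup>2) ^ 5 * (K\<^sup>2 * n) ^ 3"
      using K24 n K0 by (intro mult_right_mono) auto
    also have "\<dots> = K ^ 19 * n ^ 3"
      by (simp add: power_mult_distrib power_mult[symmetric] mult.assoc[symmetric] power_add[symmetric])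
    finally have 1: "card (f1 ` A' + f1 ` B') * (real (card A1) * card A1) \<le> K ^ 19 * n ^ 3" .
    have "card (f1 ` A' + f1 ` B') * n\<^sup>2 \<le> card (f1 ` A' + f1 ` B') * (K\<^sup>2 * (real (card A1) * card A1))"
      using cA1 by (intro mult_left_mono) auto
    also have "\<dots> = K\<^sup>2 * (card (f1 ` A' + f1 ` B') * (real (card A1) * card A1))" by simp
    also have "\<dots> \<le> K\<^sup>2 * (K ^ 19 * n ^ 3)" using 1 by (intro mult_left_mono) auto
    also have "\<dots> = ((K\<^sup>2 * K ^ 19) * n) * n\<^sup>2" by (simp add: power2_eq_square power3_eq_cube)
    also have "K\<^sup>2 * K ^ 19 = K ^ 21" by (simp flip: power_add)
    finally show ?thesis using n by simp
  qed
  have le_A1: "real (card A') * card B' \<le> real (card A1) * card A1"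
    using AB' finA1 by (intro mult_mono of_nat_mono card_mono) auto
  have G2_sub: "G2 \<subseteq> A' \<times> B'" "G2 \<subseteq> G" using G1 by (auto simp: G2_def)
  have G2_le: "real (card G2) \<le> real (card A') * card B'"
  proof -
    have "card G2 \<le> card (A' \<times> B')" using G2_sub fin' by (intro card_mono) auto
    then show ?thesis by (metis card_cartesian_product of_nat_le_iff of_nat_mult)
  qed
  have "G2 \<noteq> {}" using n_G2 n by auto
  moreover have "real (card A') * card B' \<le> K ^ 5 * card G2" using le_A1 G2 by linarith
  moreover have "1 \<le> K ^ 5" using K0 by simp
  moreover have "inj_on f2 A'" "inj_on g2 B'" using inj2 inj3 AB' by (auto intro: inj_on_subset)
  ultimately obtain X Y where XY: "X \<subseteq> A'" "Y \<subseteq> B'"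
    "real (card A') * card B' \<le> 24 * (K ^ 5)\<^sup>2 * card (G2 \<inter> X \<times> Y)"
    "card (f2 ` X + g2 ` Y) * (real (card A') * card B')
       \<le> 12288 * (K ^ 5) ^ 5 * real (card ((\<lambda>(x, y). f2 x + g2 y) ` G2)) ^ 3"
    using Balog_Szemeredi_Gowers[OF fin' G2_sub(1), of "K ^ 5" f2 g2] by blast
  have finXY: "finite X" "finite Y" using XY fin' finite_subset by auto
  have XYA: "X \<subseteq> A1" "Y \<subseteq> A1" using XY AB' by auto
  have n_XY: "n\<^sup>2 \<le> K ^ 18 * (real (card X) * card Y)"
  proof -
    have "24 * (K ^ 5)\<^sup>2 * card (G2 \<inter> X \<times> Y) \<le> K * (K ^ 5)\<^sup>2 * (real (card X) * card Y)"
    proof (intro mult_mono)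
      have "card (G2 \<inter> X \<times> Y) \<le> card (X \<times> Y)" using finXY by (intro card_mono) auto
      then show "real (card (G2 \<inter> X \<times> Y)) \<le> real (card X) * card Y"
        by (metis card_cartesian_product of_nat_le_iff of_nat_mult)
    qed (use K24 in auto)
    also have "K * (K ^ 5)\<^sup>2 = K ^ 11" by (simp add: eval_nat_numeral)
    finally have "real (card G2) \<le> K ^ 11 * (real (card X) * card Y)" using G2_le XY(3) by linarith
    then have "K ^ 7 * card G2 \<le> K ^ 7 * (K ^ 11 * (real (card X) * card Y))"
      using K0 by (intro mult_left_mono) auto
    also have "\<dots> = K ^ 18 * (real (card X) * card Y)"
      by (simp add: mult.assoc[symmetric] power_add[symmetric])
    finally show ?thesis using n_G2 by linarith
  qed
  have XYn: "real (card X) \<le> n" "real (card Y) \<le> n"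
    unfolding n_def using XYA A1A finA by (auto intro!: card_mono)
  have n_X: "n \<le> K ^ 18 * card X"
  proof -
    have "n * n \<le> K ^ 18 * (card X * n)"
      using XYn K0 by (intro order_trans[OF n_XY[unfolded power2_eq_square[of n]]] mult_left_mono) auto
    then show ?thesis using n by (simp add: mult.assoc[symmetric])
  qed
  have n_Y: "n \<le> K ^ 18 * card Y"
  proof -
    have "n * n \<le> K ^ 18 * (n * card Y)"
      using XYn K0 by (intro order_trans[OF n_XY[unfolded power2_eq_square[of n]]] mult_left_mono mult_right_mono) auto
    then have "n * n \<le> n * (K ^ 18 * card Y)" by (simp only: mult_ac)
    then show ?thesis using n by simp
  qed
  have sum2: "card (f2 ` X + g2 ` Y) \<le> K ^ (3 * m + 47) * n"
  proof -
    have "card (f2 ` X + g2 ` Y) * (real (card A') * card B')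
        \<le> 12288 * (K ^ 5) ^ 5 * (K ^ (m + 4) * n) ^ 3"
      using S2[OF G2_sub(2)] K0
      by (intro order_trans[OF XY(4)] mult_left_mono power_mono) auto
    also have "\<dots> \<le> K ^ 3 * (K ^ 5) ^ 5 * (K ^ (m + 4) * n) ^ 3"
      using K24 n K0 by (intro mult_right_mono) auto
    also have "\<dots> = K ^ (3 * m + 40) * n ^ 3"
    proof -
      have "K ^ 3 * (K ^ 5) ^ 5 * (K ^ (m + 4)) ^ 3 = K ^ (3 + 5 * 5 + (m + 4) * 3)"
        by (simp only: power_add power_mult)
      also have "3 + 5 * 5 + (m + 4) * 3 = 3 * m + 40" by simp
      finally show ?thesis by (simp only: power_mult_distrib mult.assoc[symmetric])
    qed
    finally have 1: "card (f2 ` X + g2 ` Y) * (real (card A') * card B') \<le> K ^ (3 * m + 40) * n ^ 3" .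
    have "n\<^sup>2 \<le> K ^ 7 * (real (card A') * card B')"
      using G2_le K0 by (intro order_trans[OF n_G2] mult_left_mono) auto
    then have "card (f2 ` X + g2 ` Y) * n\<^sup>2 \<le> card (f2 ` X + g2 ` Y) * (K ^ 7 * (real (card A') * card B'))"
      by (intro mult_left_mono) auto
    also have "\<dots> = K ^ 7 * (card (f2 ` X + g2 ` Y) * (real (card A') * card B'))" by simp
    also have "\<dots> \<le> K ^ 7 * (K ^ (3 * m + 40) * n ^ 3)" using 1 K0 by (intro mult_left_mono) auto
    also have "\<dots> = (K ^ (3 * m + 47) * n) * n\<^sup>2"
    proof -
      have "K ^ 7 * K ^ (3 * m + 40) = K ^ (7 + (3 * m + 40))" by (rule power_add[symmetric])
      also have "7 + (3 * m + 40) = 3 * m + 47" by simp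
      finally show ?thesis by (simp add: mult.assoc[symmetric] power2_eq_square power3_eq_cube)
    qed
    finally show ?thesis using n by simp
  qed
  have cY: "real (card Y) > 0" using n_Y n by (auto intro: gr0I)
  \<comment> \<open>Pluennecke--Ruzsa with P the image of X and Q the image of Y. It serves
    \<open>f1\<close> with \<open>f1\<close> (l = 21) and \<open>f2\<close> with \<open>g2\<close>
    (l = 3m + 47); the exponent 6m + 130 is 2(3m + 47 + 18), where 18 compares n with |Y|.\<close>
  have iter: "card (iterated_diffset k (f ` X)) \<le> K ^ ((6 * m + 130) * k) * card A"
    if g: "inj_on g A1" and le: "card (f ` X + g ` Y) \<le> K ^ l * n" "l \<le> 3 * m + 47"
    for f g :: "real \<Rightarrow> int" and k l
  proof -
    have cgY: "card (g ` Y) = card Y" using g XYA by (intro card_image) (rule inj_on_subset)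
    have "card (f ` X + g ` Y) \<le> K ^ l * (K ^ 18 * card Y)"
      using n_Y K0 by (intro order_trans[OF le(1)] mult_left_mono) auto
    also have "\<dots> = K ^ (l + 18) * card (g ` Y)" by (simp only: cgY power_add mult.assoc)
    finally have "card (iterated_diffset k (f ` X)) \<le> (K ^ (l + 18)) ^ (2 * k) * card (g ` Y)"
      using finXY cY K0 by (intro Pluennecke_Ruzsa) auto
    also have "\<dots> \<le> (K ^ (l + 18)) ^ (2 * k) * n"
      unfolding cgY using XYn K0 by (intro mult_left_mono) auto
    also have "\<dots> \<le> K ^ ((6 * m + 130) * k) * n"
    proof (intro mult_right_mono)
      have "(l + 18) * 2 \<le> 6 * m + 130" using le(2) by simp
      then have "(l + 18) * 2 * k \<le> (6 * m + 130) * k" by (rule mult_right_mono) simp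
      then show "(K ^ (l + 18)) ^ (2 * k) \<le> K ^ ((6 * m + 130) * k)"
        unfolding power_mult[symmetric] using K0 by (intro power_increasing) (auto simp: mult.assoc)
    qed (use n in auto)
    finally show ?thesis by (simp add: n_def)
  qed
  have sum1': "card (f1 ` X + f1 ` Y) \<le> K ^ 21 * n"
  proof -
    have "card (f1 ` X + f1 ` Y) \<le> card (f1 ` A' + f1 ` B')"
      using fin' XY by (intro card_mono finite_set_plus set_plus_mono2 image_mono) auto
    then show ?thesis using sum1 by linarith
  qed
  interpret additively_structured s K \<delta> A X m "6 * m + 130" \<theta>
  proof
    show "X \<subseteq> A" using XYA A1A by auto
    have "K ^ 18 * card X \<le> K ^ (6 * m + 130) * card X"
      using K0 by (intro mult_right_mono power_increasing) auto
    then show "card A \<le> K ^ (6 * m + 130) * card X" using n_X by (simp add: n_def)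
    show "1 / K ^ m \<le> x" if "x \<in> X" for x using that XYA by (auto simp: A1_def)
    show "\<theta> = \<delta> / K ^ (m + 1)" by (rule \<theta>_def)
    show "inj_on (\<lambda>x. \<lfloor>x / \<delta>\<rfloor>) X"
      using inj1 XYA(1) unfolding f1_def by (rule inj_on_subset)
    show "inj_on (\<lambda>x. \<lfloor>x\<^sup>2 / \<theta>\<rfloor>) X"
      using inj2 XYA(1) unfolding f2_def by (rule inj_on_subset)
    show "card (iterated_diffset k ((\<lambda>x. \<lfloor>x / \<delta>\<rfloor>) ` X)) \<le> K ^ ((6 * m + 130) * k) * card A" for k
      using iter[OF inj1 sum1'] unfolding f1_def by simp
    show "card (iterated_diffset k ((\<lambda>x. \<lfloor>x\<^sup>2 / \<theta>\<rfloor>) ` X)) \<le> K ^ ((6 * m + 130) * k) * card A" for k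
      using iter[OF inj3 sum2] unfolding f2_def by simp
  qed
  have exponent: "62 * (6 * m + 130) + 9 * m + 49 = 381 * m + 8109" by simp
  show False by (rule contradiction_if_loss_small) (simp only: exponent small)
qed

end

section \<open>Choice of the exponent and of the threshold scale\<close>

theorem theorem1p5:
  shows "\<forall>s::real. 0 < s \<and> s < 1 \<longrightarrow>
    (\<exists>\<epsilon>>0. \<exists>K>0. \<forall>\<alpha> \<beta>::real. \<alpha> \<noteq> 0 \<and> \<beta> \<noteq> 0 \<longrightarrow>
      (\<exists>c0>0. \<forall>C::real. C \<ge> 1 \<longrightarrow>
        (\<exists>\<delta>0>0. \<forall>\<delta>::real. 0 < \<delta> \<and> \<delta> \<le> \<delta>0 \<longrightarrow>
          (\<forall>A::real set. finite A \<and> A \<subseteq> {0..1} \<and> delta_separated \<delta> A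
             \<and> card A = nat \<lceil>\<delta> powr (-s)\<rceil>
             \<and> (\<forall>a l. l \<ge> \<delta> \<longrightarrow> real (card (A \<inter> {a..a+l})) \<le> C * l powr s * real (card A))
             \<longrightarrow> (\<forall>G. G \<subseteq> A \<times> A \<and> real (card G) \<ge> \<delta> powr \<epsilon> * (real (card A))^2
                  \<longrightarrow> real (covering_number \<delta> (partial_sumset G))
                      + real (covering_number \<delta> (partial_sq_sumset \<alpha> \<beta> G))
                      \<ge> c0 * C powr (-K) * \<delta> powr (-\<epsilon>) * real (card A))))))"
proof (intro allI impI, elim conjE)
  fix s :: real
  assume s: "0 < s" "s < 1"
  \<comment> \<open>m s \<ge> 3 ensures that [0, K^(-m)] contains only a fraction K^(-2) of
    A.\<close>
  define m where "m = nat \<lceil>3 / s\<rceil>"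
  have "3 / s \<le> m" unfolding m_def by linarith
  then have m: "3 \<le> m * s" using s by (simp add: field_simps)
  define N where "N = 381 * m + 8109"
  \<comment> \<open>With K = \<delta>^(-\<epsilon>) this makes K^N equal to \<delta>^(-(1-s)s/10),
    exactly the loss that is permitted. N and hence \<epsilon> depend on s alone.\<close>
  define \<epsilon> where "\<epsilon> = (1 - s) / 10 * s / N"
  have N: "0 < real N" by (simp add: N_def)
  have \<epsilon>: "0 < \<epsilon>" using s N by (simp add: \<epsilon>_def)
  show "\<exists>\<epsilon>>0. \<exists>K>0. \<forall>\<alpha> \<beta>::real. \<alpha> \<noteq> 0 \<and> \<beta> \<noteq> 0 \<longrightarrow>
      (\<exists>c0>0. \<forall>C::real. C \<ge> 1 \<longrightarrow>
        (\<exists>\<delta>0>0. \<forall>\<delta>::real. 0 < \<delta> \<and> \<delta> \<le> \<delta>0 \<longrightarrow>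
          (\<forall>A::real set. finite A \<and> A \<subseteq> {0..1} \<and> delta_separated \<delta> A
             \<and> card A = nat \<lceil>\<delta> powr (-s)\<rceil>
             \<and> (\<forall>a l. l \<ge> \<delta> \<longrightarrow> real (card (A \<inter> {a..a+l})) \<le> C * l powr s * real (card A))
             \<longrightarrow> (\<forall>G. G \<subseteq> A \<times> A \<and> real (card G) \<ge> \<delta> powr \<epsilon> * (real (card A))^2
                  \<longrightarrow> real (covering_number \<delta> (partial_sumset G))
                      + real (covering_number \<delta> (partial_sq_sumset \<alpha> \<beta> G))
                      \<ge> c0 * C powr (-K) * \<delta> powr (-\<epsilon>) * real (card A)))))"
  \<comment> \<open>The value 1 suffices both for c0 and for the exponent of C: the constants
    \<alpha>, \<beta>, C are absorbed through \<open>B\<close> into \<delta>0, and C^(-1) \<le>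
    1.\<close>
  proof (rule exI[of _ \<epsilon>], rule conjI[OF \<epsilon>], rule exI[of _ "1::real"], rule conjI[OF zero_less_one],
      intro allI impI, rule exI[of _ "1::real"], rule conjI[OF zero_less_one], intro allI impI, elim conjE)
    fix \<alpha> \<beta> C :: real
    assume \<alpha>: "\<alpha> \<noteq> 0" and \<beta>: "\<beta> \<noteq> 0" and C: "1 \<le> C"
    define B where "B = 100 + C + 1 / \<bar>\<alpha>\<bar> + \<bar>\<alpha>\<bar> / \<bar>\<beta>\<bar>"
    have nonneg: "0 \<le> 1 / \<bar>\<alpha>\<bar>" "0 \<le> \<bar>\<alpha>\<bar> / \<bar>\<beta>\<bar>" by auto
    have B: "100 \<le> B" "C \<le> B" "1 / \<bar>\<alpha>\<bar> \<le> B" "\<bar>\<alpha>\<bar> / \<bar>\<beta>\<bar> \<le> B"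
      using C nonneg unfolding B_def by linarith+
    \<comment> \<open>The second entry gives \<delta>^(-\<epsilon>) \<ge> B, so that K dominates
      100, C and both ratios of coefficients; the first gives \<delta> < 1.\<close>
    define \<delta>0 where "\<delta>0 = min (1/2) (B powr (- (1 / \<epsilon>)))"
    have \<delta>0: "0 < \<delta>0" using B by (simp add: \<delta>0_def)
    show "\<exists>\<delta>0>0. \<forall>\<delta>::real. 0 < \<delta> \<and> \<delta> \<le> \<delta>0 \<longrightarrow>
          (\<forall>A::real set. finite A \<and> A \<subseteq> {0..1} \<and> delta_separated \<delta> A
             \<and> card A = nat \<lceil>\<delta> powr (-s)\<rceil>
             \<and> (\<forall>a l. l \<ge> \<delta> \<longrightarrow> real (card (A \<inter> {a..a+l})) \<le> C * l powr s * real (card A))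
             \<longrightarrow> (\<forall>G. G \<subseteq> A \<times> A \<and> real (card G) \<ge> \<delta> powr \<epsilon> * (real (card A))^2
                  \<longrightarrow> real (covering_number \<delta> (partial_sumset G))
                      + real (covering_number \<delta> (partial_sq_sumset \<alpha> \<beta> G))
                      \<ge> 1 * C powr (-1) * \<delta> powr (-\<epsilon>) * real (card A)))"
    proof (rule exI[of _ \<delta>0], rule conjI[OF \<delta>0], intro allI impI, elim conjE, rule ccontr)
      fix \<delta> A G
      assume \<delta>: "0 < \<delta>" "\<delta> \<le> \<delta>0" and finA: "finite A" and A01: "A \<subseteq> {0..1}"
        and sep: "delta_separated \<delta> A" and cA: "card A = nat \<lceil>\<delta> powr (-s)\<rceil>"
        and frost: "\<forall>a l. l \<ge> \<delta> \<longrightarrow> real (card (A \<inter> {a..a+l})) \<le> C * l powr s * real (card A)"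
        and G: "G \<subseteq> A \<times> A" "real (card G) \<ge> \<delta> powr \<epsilon> * (real (card A))^2"
        and neg: "\<not> real (covering_number \<delta> (partial_sumset G))
                      + real (covering_number \<delta> (partial_sq_sumset \<alpha> \<beta> G))
                      \<ge> 1 * C powr (-1) * \<delta> powr (-\<epsilon>) * real (card A)"
      define K where "K = \<delta> powr (-\<epsilon>)"
      have \<delta>1: "\<delta> < 1" "\<delta> \<le> B powr (- (1 / \<epsilon>))" using \<delta> by (auto simp: \<delta>0_def)
      have "B = (B powr (- (1 / \<epsilon>))) powr (-\<epsilon>)" using B \<epsilon> by (simp add: powr_powr)
      also have "\<dots> \<le> K" unfolding K_def using \<delta> \<delta>1 \<epsilon> by (intro powr_mono2') auto
      finally have BK: "B \<le> K" .
      have ge1: "1 \<le> \<delta> powr (-s)" using powr_mono'[of "-s" 0 \<delta>] \<delta> \<delta>1 s by simp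
      interpret frostman_set s K \<delta> A
      proof
        show "100 \<le> K" using B BK by linarith
        show "\<delta> powr (-s) \<le> card A" unfolding cA by linarith
        have "real (card A) \<le> \<delta> powr (-s) + 1" unfolding cA using ge1 by linarith
        then show "card A \<le> 2 * \<delta> powr (-s)" using ge1 by linarith
        fix a l :: real assume "\<delta> \<le> l"
        then have "real (card (A \<inter> {a..a+l})) \<le> C * l powr s * real (card A)" using frost by blast
        also have "\<dots> \<le> K * l powr s * real (card A)"
          using B BK by (intro mult_right_mono) auto
        finally show "card (A \<inter> {a..a+l}) \<le> K * l powr s * card A" .
      qed (use s \<delta> \<delta>1 finA A01 in auto)
      have cov: "real (covering_number \<delta> (partial_sumset G))
          + real (covering_number \<delta> (partial_sq_sumset \<alpha> \<beta> G)) \<le> K * card A"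
      proof -
        have "C powr (-1) \<le> 1" using C by (simp add: powr_minus_divide)
        then have "C powr (-1) * (K * card A) \<le> 1 * (K * card A)"
          using K by (intro mult_right_mono) auto
        moreover have "1 * C powr (-1) * \<delta> powr (-\<epsilon>) * real (card A) = C powr (-1) * (K * card A)"
          by (simp add: K_def)
        ultimately show ?thesis using neg by linarith
      qed
      show False
      proof (rule partial_sums_not_both_small[OF sep G(1) _ \<alpha> _ \<beta> _ m])
        have "K * (\<delta> powr \<epsilon> * (real (card A))\<^sup>2) \<le> K * card G"
          using G(2) K by (intro mult_left_mono) auto
        moreover have "K * \<delta> powr \<epsilon> = 1" using \<delta> by (simp add: K_def powr_add[symmetric])
        ultimately show "(real (card A))\<^sup>2 \<le> K * card G" by (simp add: mult.assoc[symmetric])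
        show "1 / \<bar>\<alpha>\<bar> \<le> K" "\<bar>\<alpha>\<bar> / \<bar>\<beta>\<bar> \<le> K" using B BK by linarith+
        have "K ^ N = \<delta> powr (- \<epsilon> * N)" using \<delta> by (simp add: K_def powr_powr flip: powr_realpow)
        also have "- \<epsilon> * N = - ((1 - s) / 10 * s)" using N by (simp add: \<epsilon>_def)
        finally show "K ^ (381 * m + 8109) \<le> \<delta> powr (- ((1 - s) / 10 * s))" by (simp add: N_def)
        show "covering_number \<delta> (partial_sumset G) \<le> K * card A"
          "covering_number \<delta> (partial_sq_sumset \<alpha> \<beta> G) \<le> K * card A" using cov by linarith+
      qed
    qed
  qed
qed

end
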